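(* Let $N\geq 1$, let $\Omega\subset\mathbb{R}^N$ be an open, bounded and connected set with continuous piecewise $C^\infty$ boundary, let $\omega\subset\Omega$ be any non-empty open set, and let $T>T_{max}(\Omega,\omega)$. Let $w_0\in H^1_0(\Omega)$, $v_0\in L^2(\Omega)$, and let $w$ be the unique solution of $$\begin{cases}\partial_t^2 w-\Delta w=0 & \text{in } ]-T,T[\times\Omega,\\ w=0 & \text{on } ]-T,T[\times\partial\Omega,\\ w(\cdot,0)=w_0 & \text{in }\Omega,\\ \partial_t w(\cdot,0)=v_0 & \text{in }\Omega,\end{cases}$$ with $w\in L^2(]-T,T[;H^1_0(\Omega))$, $\partial_t w\in L^2(]-T,T[;L^2(\Omega))$ and $\partial_{tt}w\in L^2(]-T,T[;H^{-1}(\Omega))$. If $w=0$ on $]-T,T[\times\omega$, then $w\equiv 0$. In particular, $w_0$ and $v_0$ are both uniquely determined by the data $w|_{]-T,T[\times\omega}$.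
   Context: Geodesic distance: for $P_1,P_2\in\Omega$, $gd(P_1,P_2)$ is the infimum of the Euclidean lengths of paths from $P_1$ to $P_2$ contained in $\Omega$. For $P\in\Omega$ and non-empty $\Omega_0\subset\Omega$, $gd(P,\Omega_0)=\inf\{gd(P,Q):Q\in\Omega_0\}$, and $T_{max}(\Omega,\Omega_0)=\sup\{gd(P,\Omega_0):P\in\Omega\}$. "Uniquely determined" means: if two pairs of initial data in $H^1_0(\Omega)\times L^2(\Omega)$ produce solutions that coincide on $]-T,T[\times\omega$, then the two pairs are equal. *)

theory Defs
  imports "HOL-Analysis.Analysis"
begin

section \<open>Smooth functions and test functions\<close>

text \<open>
  On an open set, a function is C^(k+1) iff it is differentiable and its partial derivatives
  are C^k. The predicate is only meant for open \<open>U\<close>.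
\<close>

primrec Ck_on :: "nat \<Rightarrow> 'a::euclidean_space set \<Rightarrow> ('a \<Rightarrow> real) \<Rightarrow> bool" where
  "Ck_on 0 U f \<longleftrightarrow> continuous_on U f"
| "Ck_on (Suc k) U f \<longleftrightarrow> (\<forall>x\<in>U. f differentiable (at x)) \<and>
     (\<forall>b\<in>Basis. Ck_on k U (\<lambda>x. frechet_derivative f (at x) b))"

definition smooth_on :: "'a::euclidean_space set \<Rightarrow> ('a \<Rightarrow> real) \<Rightarrow> bool" where
  "smooth_on U f \<longleftrightarrow> (\<forall>k. Ck_on k U f)"

definition test_functions :: "'a::euclidean_space set \<Rightarrow> ('a \<Rightarrow> real) set" where
  "test_functions U = {\<phi>. smooth_on UNIV \<phi> \<and> compact (closure {x. \<phi> x \<noteq> 0}) \<and>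
     closure {x. \<phi> x \<noteq> 0} \<subseteq> U}"

section \<open>Domains with continuous, piecewise smooth boundary\<close>

text \<open>
  Continuous boundary: the closure of \<open>\<Omega>\<close> is, near each boundary point, a topological manifold
  with boundary that lies on one side of its boundary (Grisvard, \<^emph>\<open>Elliptic Problems in Nonsmooth
  Domains\<close>, Def. 1.2.1.2). Every domain that is locally the subgraph of a continuous function
  in suitable orthogonal coordinates has this property.
\<close>

definition continuous_boundary :: "'a::euclidean_space set \<Rightarrow> bool" where
  "continuous_boundary \<Omega> \<longleftrightarrow>
     (\<forall>x\<in>frontier \<Omega>. \<exists>U V (h :: 'a \<Rightarrow> 'a) k e. open U \<and> x \<in> U \<and> open V \<and> e \<noteq> 0 \<and>
        homeomorphism U V h k \<and> h ` (\<Omega> \<inter> U) = {y\<in>V. y \<bullet> e > 0})"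

definition smooth_hypersurface :: "'a::euclidean_space set \<Rightarrow> bool" where
  "smooth_hypersurface S \<longleftrightarrow>
     (\<forall>x\<in>S. \<exists>U \<phi>. open U \<and> x \<in> U \<and> smooth_on U \<phi> \<and>
        (\<forall>y\<in>U. \<exists>b\<in>Basis. frechet_derivative \<phi> (at y) b \<noteq> 0) \<and>
        S \<inter> U = {y\<in>U. \<phi> y = 0})"

text \<open>
  The boundary splits into finitely many smooth connected faces whose closures cover it.
  Smoothness is required on the faces only, not up to their edges, so that corners, edges,
  conical points and cusps are all admitted.
\<close>

definition piecewise_smooth_boundary :: "'a::euclidean_space set \<Rightarrow> bool" where
  "piecewise_smooth_boundary \<Omega> \<longleftrightarrow>
     (\<exists>\<S>. finite \<S> \<and> disjoint \<S> \<and>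
        (\<forall>S\<in>\<S>. openin (top_of_set (frontier \<Omega>)) S \<and> connected S \<and> smooth_hypersurface S) \<and>
        frontier \<Omega> = (\<Union>S\<in>\<S>. closure S))"

section \<open>Geodesic distance\<close>

text \<open>The length of a path is its total variation; it is \<open>\<infinity>\<close> for non-rectifiable paths.\<close>

definition path_length :: "(real \<Rightarrow> 'a::metric_space) \<Rightarrow> ereal" where
  "path_length g =
     (SUP (n, t) \<in> {(n::nat, t). (\<forall>i\<le>n. t i \<in> {0..1}) \<and> (\<forall>i<n. t i \<le> t (Suc i))}.
        ereal (\<Sum>i<n. dist (g (t i)) (g (t (Suc i)))))"

definition gd :: "'a::euclidean_space set \<Rightarrow> 'a \<Rightarrow> 'a \<Rightarrow> ereal" where
  "gd \<Omega> P Q = (INF g \<in> {g. path g \<and> path_image g \<subseteq> \<Omega> \<and> pathstart g = P \<and> pathfinish g = Q}.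
     path_length g)"

definition gd_set :: "'a::euclidean_space set \<Rightarrow> 'a \<Rightarrow> 'a set \<Rightarrow> ereal" where
  "gd_set \<Omega> P \<Omega>0 = (INF Q \<in> \<Omega>0. gd \<Omega> P Q)"

definition T_max :: "'a::euclidean_space set \<Rightarrow> 'a set \<Rightarrow> ereal" where
  "T_max \<Omega> \<Omega>0 = (SUP P \<in> \<Omega>. gd_set \<Omega> P \<Omega>0)"

section \<open>The spaces L2, H1, H10 and the dual of H10\<close>

text \<open>
  Elements of the function spaces are represented by functions on the whole space, of which only
  the restriction to \<open>\<Omega>\<close> matters, up to null sets. All functions are real-valued.
\<close>

definition L2_space :: "'a::euclidean_space set \<Rightarrow> ('a \<Rightarrow> real) set" where
  "L2_space \<Omega> = {u. u \<in> borel_measurable (lebesgue_on \<Omega>) \<and>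
     integrable (lebesgue_on \<Omega>) (\<lambda>x. (u x)\<^sup>2)}"

definition norm_L2 :: "'a::euclidean_space set \<Rightarrow> ('a \<Rightarrow> real) \<Rightarrow> real" where
  "norm_L2 \<Omega> u = sqrt (LINT x|lebesgue_on \<Omega>. (u x)\<^sup>2)"

definition is_weak_grad :: "'a::euclidean_space set \<Rightarrow> ('a \<Rightarrow> real) \<Rightarrow> ('a \<Rightarrow> 'a) \<Rightarrow> bool" where
  "is_weak_grad \<Omega> u G \<longleftrightarrow>
     (\<forall>b\<in>Basis. (\<lambda>x. G x \<bullet> b) \<in> L2_space \<Omega> \<and>
        (\<forall>\<phi>\<in>test_functions \<Omega>.
           (LINT x|lebesgue_on \<Omega>. u x * frechet_derivative \<phi> (at x) b)
             = - (LINT x|lebesgue_on \<Omega>. (G x \<bullet> b) * \<phi> x)))"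

definition weak_grad :: "'a::euclidean_space set \<Rightarrow> ('a \<Rightarrow> real) \<Rightarrow> 'a \<Rightarrow> 'a" where
  "weak_grad \<Omega> u = (SOME G. is_weak_grad \<Omega> u G)"

definition H1_space :: "'a::euclidean_space set \<Rightarrow> ('a \<Rightarrow> real) set" where
  "H1_space \<Omega> = {u \<in> L2_space \<Omega>. \<exists>G. is_weak_grad \<Omega> u G}"

definition norm_H1 :: "'a::euclidean_space set \<Rightarrow> ('a \<Rightarrow> real) \<Rightarrow> real" where
  "norm_H1 \<Omega> u = sqrt ((LINT x|lebesgue_on \<Omega>. (u x)\<^sup>2) +
     (LINT x|lebesgue_on \<Omega>. (norm (weak_grad \<Omega> u x))\<^sup>2))"

definition H10_space :: "'a::euclidean_space set \<Rightarrow> ('a \<Rightarrow> real) set" where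
  "H10_space \<Omega> = {u \<in> H1_space \<Omega>.
     \<forall>\<epsilon>>0. \<exists>\<phi>\<in>test_functions \<Omega>. norm_H1 \<Omega> (\<lambda>x. u x - \<phi> x) < \<epsilon>}"

text \<open>
  The dual space of H10. Functionals are represented by functions on all of \<open>'a \<Rightarrow> real\<close>, of which
  only the restriction to \<open>H10_space \<Omega>\<close> matters.
\<close>

definition Hm1_space :: "'a::euclidean_space set \<Rightarrow> (('a \<Rightarrow> real) \<Rightarrow> real) set" where
  "Hm1_space \<Omega> = {F.
     (\<forall>u\<in>H10_space \<Omega>. \<forall>v\<in>H10_space \<Omega>. \<forall>a b.
        F (\<lambda>x. a * u x + b * v x) = a * F u + b * F v) \<and>
     (\<exists>C. \<forall>u\<in>H10_space \<Omega>. \<bar>F u\<bar> \<le> C * norm_H1 \<Omega> u)}"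

definition norm_Hm1 :: "'a::euclidean_space set \<Rightarrow> (('a \<Rightarrow> real) \<Rightarrow> real) \<Rightarrow> real" where
  "norm_Hm1 \<Omega> F = (SUP u \<in> {u\<in>H10_space \<Omega>. norm_H1 \<Omega> u \<le> 1}. \<bar>F u\<bar>)"

text \<open>The embedding of L2 into Hm1, and the Dirichlet Laplacian from H10 to Hm1.\<close>

definition L2_to_Hm1 :: "'a::euclidean_space set \<Rightarrow> ('a \<Rightarrow> real) \<Rightarrow> ('a \<Rightarrow> real) \<Rightarrow> real" where
  "L2_to_Hm1 \<Omega> u = (\<lambda>\<psi>. LINT x|lebesgue_on \<Omega>. u x * \<psi> x)"

definition laplacian :: "'a::euclidean_space set \<Rightarrow> ('a \<Rightarrow> real) \<Rightarrow> ('a \<Rightarrow> real) \<Rightarrow> real" where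
  "laplacian \<Omega> u = (\<lambda>\<psi>. - (LINT x|lebesgue_on \<Omega>. weak_grad \<Omega> u x \<bullet> weak_grad \<Omega> \<psi> x))"

section \<open>Functions of time with values in a function space\<close>

text \<open>
  In the following, \<open>V\<close> is a space of real functions or functionals and \<open>nrm\<close> its norm.
  \<open>bochner_L2 I V nrm\<close> is the Bochner space L2(I; V): limits almost everywhere of simple functions
  whose norm is square integrable.
\<close>

definition bochner_L2 ::
    "real set \<Rightarrow> ('c \<Rightarrow> real) set \<Rightarrow> (('c \<Rightarrow> real) \<Rightarrow> real) \<Rightarrow> (real \<Rightarrow> 'c \<Rightarrow> real) set" where
  "bochner_L2 I V nrm = {f.
     (AE t in lebesgue_on I. f t \<in> V) \<and>
     (\<exists>s::nat \<Rightarrow> real \<Rightarrow> 'c \<Rightarrow> real.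
        (\<forall>n. simple_function (lebesgue_on I) (s n) \<and> s n ` I \<subseteq> V) \<and>
        (AE t in lebesgue_on I. (\<lambda>n. nrm (\<lambda>x. s n t x - f t x)) \<longlonglongrightarrow> 0)) \<and>
     integrable (lebesgue_on I) (\<lambda>t. (nrm (f t))\<^sup>2)}"

text \<open>
  \<open>has_value_at I V nrm f t0 a\<close>: \<open>f\<close> agrees almost everywhere on \<open>I\<close> with a continuous function
  \<open>g\<close> from \<open>I\<close> to \<open>V\<close> such that \<open>g t0 = a\<close> in \<open>V\<close>.
\<close>

definition has_value_at ::
    "real set \<Rightarrow> ('c \<Rightarrow> real) set \<Rightarrow> (('c \<Rightarrow> real) \<Rightarrow> real) \<Rightarrow>
       (real \<Rightarrow> 'c \<Rightarrow> real) \<Rightarrow> real \<Rightarrow> ('c \<Rightarrow> real) \<Rightarrow> bool" where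
  "has_value_at I V nrm f t0 a \<longleftrightarrow>
     (\<exists>g. (\<forall>t\<in>I. g t \<in> V) \<and>
        (\<forall>t\<in>I. ((\<lambda>s. nrm (\<lambda>x. g s x - g t x)) \<longlongrightarrow> 0) (at t within I)) \<and>
        (AE t in lebesgue_on I. f t \<in> V \<and> nrm (\<lambda>x. g t x - f t x) = 0) \<and>
        a \<in> V \<and> nrm (\<lambda>x. g t0 x - a x) = 0)"

text \<open>
  \<open>G\<close> is the distributional derivative in time of the Hm1-valued function \<open>F\<close> on \<open>I\<close>. The
  identity between the two Hm1-valued integrals is expressed by evaluating both at every
  \<open>\<psi>\<close> in H10.
\<close>

definition has_time_derivative ::
    "real set \<Rightarrow> 'a::euclidean_space set \<Rightarrow> (real \<Rightarrow> ('a \<Rightarrow> real) \<Rightarrow> real) \<Rightarrow>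
       (real \<Rightarrow> ('a \<Rightarrow> real) \<Rightarrow> real) \<Rightarrow> bool" where
  "has_time_derivative I \<Omega> F G \<longleftrightarrow>
     (\<forall>\<theta>\<in>test_functions I. \<forall>\<psi>\<in>H10_space \<Omega>.
        (LINT t|lebesgue_on I. deriv \<theta> t * F t \<psi>) = - (LINT t|lebesgue_on I. \<theta> t * G t \<psi>))"

section \<open>The wave equation\<close>

text \<open>
  The functions \<open>w1\<close> and \<open>w2\<close> are the first and second time derivatives of \<open>w\<close>. The boundary
  condition is contained in the requirement that \<open>w\<close> has values in H10; the equation holds in
  Hm1 for almost every time.
\<close>

definition wave_solution ::
    "'a::euclidean_space set \<Rightarrow> real \<Rightarrow> ('a \<Rightarrow> real) \<Rightarrow> ('a \<Rightarrow> real) \<Rightarrow>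
       (real \<Rightarrow> 'a \<Rightarrow> real) \<Rightarrow> bool" where
  "wave_solution \<Omega> T w0 v0 w \<longleftrightarrow>
     w \<in> bochner_L2 {-T<..<T} (H10_space \<Omega>) (norm_H1 \<Omega>) \<and>
     (\<exists>w1 w2.
        w1 \<in> bochner_L2 {-T<..<T} (L2_space \<Omega>) (norm_L2 \<Omega>) \<and>
        w2 \<in> bochner_L2 {-T<..<T} (Hm1_space \<Omega>) (norm_Hm1 \<Omega>) \<and>
        has_time_derivative {-T<..<T} \<Omega> (\<lambda>t. L2_to_Hm1 \<Omega> (w t)) (\<lambda>t. L2_to_Hm1 \<Omega> (w1 t)) \<and>
        has_time_derivative {-T<..<T} \<Omega> (\<lambda>t. L2_to_Hm1 \<Omega> (w1 t)) w2 \<and>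
        (AE t in lebesgue_on {-T<..<T}. \<forall>\<psi>\<in>H10_space \<Omega>. w2 t \<psi> - laplacian \<Omega> (w t) \<psi> = 0) \<and>
        has_value_at {-T<..<T} (L2_space \<Omega>) (norm_L2 \<Omega>) w 0 w0 \<and>
        has_value_at {-T<..<T} (Hm1_space \<Omega>) (norm_Hm1 \<Omega>)
          (\<lambda>t. L2_to_Hm1 \<Omega> (w1 t)) 0 (L2_to_Hm1 \<Omega> v0))"

end

theory Submission
  imports Defs
begin

text \<open>
  The key is a sharp local unique continuation result: if a solution vanishes for \<open>\<bar>t\<bar> < a\<close> near a
  point, then it vanishes on the double cone over it. Since the coefficients are constant,
  the integrals of \<open>u t\<close> against radial functions centred at a point \<open>y\<close> satisfy a one-dimensional
  wave equation. A weighted integral over \<open>N + 1\<close> extra variables turns the radial Laplacian of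
  \<open>\<real>\<^sup>N\<close> into the one of odd dimension \<open>2 N + 1\<close>, where the reduction is explicit. Uniqueness
  for the one-dimensional equation, with \<open>r\<close> as the evolution variable, makes these integrals vanish
  for all centres \<open>y\<close> near the point; differentiating in \<open>y\<close> yields the same for all polynomial
  multiples of \<open>u t\<close>, hence \<open>u t = 0\<close>.

  Applying this along paths to \<open>\<omega>\<close> gives \<open>u = 0\<close> for \<open>\<bar>t\<bar> < T - T_max\<close>. To reach \<open>\<bar>t\<bar> < T\<close>, note that
  the inner product of \<open>u t\<close> and \<open>u s\<close> solves the one-dimensional wave equation in \<open>(t, s)\<close> and
  vanishes near the axes, which extends the time interval step by step.
\<close>

section \<open>Calculus of smooth functions\<close>

text \<open>Two obstacles shape the cone argument. Spherical means reduce the wave equation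
  explicitly to one space dimension only when the dimension is odd, and \<open>u t\<close> is only
  known in an integrated sense, so it cannot be differentiated. Both are met by duality: the test
  function is transformed, never the solution. With exactly \<open>N + 1\<close> auxiliary variables
  the total dimension \<open>2 N + 1\<close> is odd for every \<open>N\<close>, so parity is not
  distinguished, and the \<open>N\<close> derivatives of the odd-dimensional formula fall on a
  smooth profile.

  The cone argument is purely interior. The boundary condition enters in the extension in time,
  through the symmetry of the Dirichlet form on H10. An energy estimate would test the equation with
  the velocity, which lies only in L2. The solution \<open>w s\<close> at another time is an
  admissible test function for almost every \<open>s\<close>, and this is why a kernel in two times
  appears.\<close>

lemma has_derivative_imp_frechet: "(f has_derivative f') (at x) \<Longrightarrow> frechet_derivative f (at x) = f'"
  using frechet_derivative_at by metis

lemma frechet_derivative_real: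
  fixes f :: "real \<Rightarrow> real"
  assumes "f differentiable (at x)"
  shows "frechet_derivative f (at x) 1 = deriv f x"
proof -
  have "(f has_real_derivative deriv f x) (at x)"
    using assms by (metis DERIV_deriv_iff_real_differentiable)
  then show ?thesis
    unfolding has_field_derivative_def by (simp add: has_derivative_imp_frechet)
qed

lemma Ck_on_cong:
  assumes "open U" "\<And>x. x \<in> U \<Longrightarrow> f x = g x"
  shows "Ck_on k U f = Ck_on k U g"
  using assms(2)
proof (induction k arbitrary: f g)
  case 0
  then show ?case by (simp cong: continuous_on_cong)
next
  case (Suc k)
  have D: "(f has_derivative f') (at x) = (g has_derivative f') (at x)" if "x \<in> U" for x f'
    using that Suc.prems assms(1)
    by (metis has_derivative_transform_within_open)
  have d: "(f differentiable (at x)) = (g differentiable (at x))" if "x \<in> U" for x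
    using D[OF that] unfolding differentiable_def by simp
  have F: "frechet_derivative f (at x) = frechet_derivative g (at x)" if "x \<in> U" for x
    unfolding frechet_derivative_def using D[OF that] by simp
  have "Ck_on k U (\<lambda>x. frechet_derivative f (at x) b) = Ck_on k U (\<lambda>x. frechet_derivative g (at x) b)" for b
    by (rule Suc.IH) (simp add: F)
  with d show ?case by simp
qed

lemma Ck_on_SucI:
  assumes "open U" "\<And>x. x \<in> U \<Longrightarrow> (f has_derivative f' x) (at x)"
    and "\<And>b. b \<in> Basis \<Longrightarrow> Ck_on k U (\<lambda>x. f' x b)"
  shows "Ck_on (Suc k) U f"
proof -
  have "Ck_on k U (\<lambda>x. frechet_derivative f (at x) b) = Ck_on k U (\<lambda>x. f' x b)" for b
    by (rule Ck_on_cong[OF assms(1)]) (metis has_derivative_imp_frechet assms(2))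
  with assms show ?thesis by (auto simp: differentiable_def)
qed

lemma Ck_on_SucD:
  assumes "Ck_on (Suc k) U f" "x \<in> U"
  shows "(f has_derivative frechet_derivative f (at x)) (at x)"
  using assms frechet_derivative_works by auto

lemma Ck_on_Suc_imp: "Ck_on (Suc k) U f \<Longrightarrow> Ck_on k U f"
proof (induction k arbitrary: f)
  case 0
  then show ?case
    by (auto intro!: continuous_at_imp_continuous_on differentiable_imp_continuous_within)
next
  case (Suc k)
  have "Ck_on k U (\<lambda>x. frechet_derivative f (at x) b)" if "b \<in> Basis" for b
    using Suc.prems that by (intro Suc.IH) simp
  then show ?case using Suc.prems by simp
qed

lemma Ck_on_const: "open U \<Longrightarrow> Ck_on k U (\<lambda>x. c)"
proof (induction k arbitrary: c)
  case (Suc k)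
  show ?case by (rule Ck_on_SucI[where f' = "\<lambda>x h. 0"]) (use Suc in auto)
qed simp

lemma Ck_on_linear: "open U \<Longrightarrow> bounded_linear f \<Longrightarrow> Ck_on k U f"
proof (cases k)
  case (Suc k')
  assume "open U" "bounded_linear f"
  then show ?thesis unfolding Suc
    by (intro Ck_on_SucI[where f' = "\<lambda>x. f"]) (auto intro: Ck_on_const bounded_linear_imp_has_derivative)
qed (simp add: linear_continuous_on)

lemma Ck_on_add:
  assumes "open U"
  shows "Ck_on k U f \<Longrightarrow> Ck_on k U g \<Longrightarrow> Ck_on k U (\<lambda>x. f x + g x)"
proof (induction k arbitrary: f g)
  case 0
  then show ?case by (simp add: continuous_on_add)
next
  case (Suc k)
  show ?case
  proof (rule Ck_on_SucI[OF assms, where f' = "\<lambda>x h. frechet_derivative f (at x) h + frechet_derivative g (at x) h"])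
    fix x assume "x \<in> U"
    then show "((\<lambda>x. f x + g x) has_derivative (\<lambda>h. frechet_derivative f (at x) h + frechet_derivative g (at x) h)) (at x)"
      using Ck_on_SucD[OF Suc.prems(1)] Ck_on_SucD[OF Suc.prems(2)] by (intro has_derivative_add)
  next
    fix b :: 'a assume b: "b \<in> Basis"
    with Suc show "Ck_on k U (\<lambda>x. frechet_derivative f (at x) b + frechet_derivative g (at x) b)"
      by simp
  qed
qed

lemma Ck_on_mult:
  assumes "open U"
  shows "Ck_on k U f \<Longrightarrow> Ck_on k U g \<Longrightarrow> Ck_on k U (\<lambda>x. f x * g x)"
proof (induction k arbitrary: f g)
  case 0
  then show ?case by (simp add: continuous_on_mult)
next
  case (Suc k)
  show ?case
  proof (rule Ck_on_SucI[where f' = "\<lambda>x h. f x * frechet_derivative g (at x) h + frechet_derivative f (at x) h * g x"])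
    fix x assume "x \<in> U"
    then show "((\<lambda>x. f x * g x) has_derivative (\<lambda>h. f x * frechet_derivative g (at x) h + frechet_derivative f (at x) h * g x)) (at x)"
      using Ck_on_SucD[OF Suc.prems(1)] Ck_on_SucD[OF Suc.prems(2)] by (intro has_derivative_mult)
  next
    fix b :: 'a assume b: "b \<in> Basis"
    have "Ck_on k U f" "Ck_on k U g"
      by (rule Ck_on_Suc_imp[OF Suc.prems(1)]) (rule Ck_on_Suc_imp[OF Suc.prems(2)])
    moreover have "Ck_on k U (\<lambda>x. frechet_derivative f (at x) b)" "Ck_on k U (\<lambda>x. frechet_derivative g (at x) b)"
      using Suc.prems b by simp_all
    ultimately show "Ck_on k U (\<lambda>x. f x * frechet_derivative g (at x) b + frechet_derivative f (at x) b * g x)"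
      by (intro Ck_on_add[OF assms] Suc.IH)
  qed (use assms in auto)
qed

lemma Ck_on_compose:
  fixes g :: "real \<Rightarrow> real"
  assumes "open U" "open V"
  shows "Ck_on k V g \<Longrightarrow> Ck_on k U f \<Longrightarrow> f ` U \<subseteq> V \<Longrightarrow> Ck_on k U (\<lambda>x. g (f x))"
proof (induction k arbitrary: g)
  case 0
  then show ?case by (simp add: continuous_on_compose2)
next
  case (Suc k)
  show ?case
  proof (rule Ck_on_SucI[where f' = "\<lambda>x h. deriv g (f x) * frechet_derivative f (at x) h"])
    fix x assume x: "x \<in> U"
    then have "f x \<in> V" using Suc.prems(3) by blast
    then have "g differentiable (at (f x))" using Suc.prems(1) by simp
    then have "(g has_real_derivative deriv g (f x)) (at (f x))"
      by (metis DERIV_deriv_iff_real_differentiable)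
    from DERIV_compose_FDERIV[OF this Ck_on_SucD[OF Suc.prems(2) x]]
    show "((\<lambda>x. g (f x)) has_derivative (\<lambda>h. deriv g (f x) * frechet_derivative f (at x) h)) (at x)"
      by (simp add: mult.commute)
  next
    fix b :: 'a assume b: "b \<in> Basis"
    have "Ck_on k V (\<lambda>x. frechet_derivative g (at x) 1) = Ck_on k V (deriv g)"
      by (rule Ck_on_cong[OF assms(2)], rule frechet_derivative_real) (use Suc.prems(1) in simp)
    moreover have "Ck_on k V (\<lambda>x. frechet_derivative g (at x) 1)" using Suc.prems(1) by simp
    ultimately have "Ck_on k V (deriv g)" by simp
    then have "Ck_on k U (\<lambda>x. deriv g (f x))"
      by (rule Suc.IH[OF _ Ck_on_Suc_imp[OF Suc.prems(2)] Suc.prems(3)])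
    moreover have "Ck_on k U (\<lambda>x. frechet_derivative f (at x) b)" using Suc.prems(2) b by simp
    ultimately show "Ck_on k U (\<lambda>x. deriv g (f x) * frechet_derivative f (at x) b)"
      by (rule Ck_on_mult[OF assms(1)])
  qed (use assms in auto)
qed

lemma smooth_on_cong:
  "open U \<Longrightarrow> (\<And>x. x \<in> U \<Longrightarrow> f x = g x) \<Longrightarrow> smooth_on U f = smooth_on U g"
  unfolding smooth_on_def using Ck_on_cong[of U f g] by simp

lemma smooth_on_const [intro, simp]: "open U \<Longrightarrow> smooth_on U (\<lambda>x. c)"
  unfolding smooth_on_def by (simp add: Ck_on_const)

lemma smooth_on_linear: "open U \<Longrightarrow> bounded_linear f \<Longrightarrow> smooth_on U f"
  unfolding smooth_on_def by (simp add: Ck_on_linear)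

lemma smooth_on_inner: "open U \<Longrightarrow> smooth_on U (\<lambda>x. x \<bullet> b)"
  by (rule smooth_on_linear, assumption) (rule bounded_linear_inner_left)

lemma smooth_on_id [intro, simp]: "open U \<Longrightarrow> smooth_on U (\<lambda>x::real. x)"
  by (rule smooth_on_linear, assumption) (rule bounded_linear_ident)

lemma smooth_on_add [intro]:
  "open U \<Longrightarrow> smooth_on U f \<Longrightarrow> smooth_on U g \<Longrightarrow> smooth_on U (\<lambda>x. f x + g x)"
  unfolding smooth_on_def by (simp add: Ck_on_add)

lemma smooth_on_mult [intro]:
  "open U \<Longrightarrow> smooth_on U f \<Longrightarrow> smooth_on U g \<Longrightarrow> smooth_on U (\<lambda>x. f x * g x)"
  unfolding smooth_on_def by (simp add: Ck_on_mult)

lemma smooth_on_uminus [intro]: "open U \<Longrightarrow> smooth_on U f \<Longrightarrow> smooth_on U (\<lambda>x. - f x)"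
  using smooth_on_mult[of U "\<lambda>x. -1" f] by simp

lemma smooth_on_diff [intro]:
  "open U \<Longrightarrow> smooth_on U f \<Longrightarrow> smooth_on U g \<Longrightarrow> smooth_on U (\<lambda>x. f x - g x)"
  using smooth_on_add[OF _ _ smooth_on_uminus, of U f g] by simp

lemma smooth_on_sum [intro]:
  "open U \<Longrightarrow> (\<And>i. i \<in> A \<Longrightarrow> smooth_on U (f i)) \<Longrightarrow> smooth_on U (\<lambda>x. \<Sum>i\<in>A. f i x)"
  by (induction A rule: infinite_finite_induct) auto

lemma smooth_on_power [intro]: "open U \<Longrightarrow> smooth_on U f \<Longrightarrow> smooth_on U (\<lambda>x. f x ^ n)"
  by (induction n) auto

lemma smooth_on_compose:
  fixes g :: "real \<Rightarrow> real"
  shows "open U \<Longrightarrow> open V \<Longrightarrow> smooth_on V g \<Longrightarrow> smooth_on U f \<Longrightarrow> f ` U \<subseteq> V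
     \<Longrightarrow> smooth_on U (\<lambda>x. g (f x))"
  unfolding smooth_on_def by (simp add: Ck_on_compose)

lemma smooth_on_compose_UNIV:
  fixes g :: "real \<Rightarrow> real"
  shows "smooth_on UNIV g \<Longrightarrow> open U \<Longrightarrow> smooth_on U f \<Longrightarrow> smooth_on U (\<lambda>x. g (f x))"
  by (rule smooth_on_compose[where V = UNIV]) auto

lemma smooth_on_differentiable: "smooth_on U f \<Longrightarrow> x \<in> U \<Longrightarrow> f differentiable (at x)"
  unfolding smooth_on_def using Ck_on.simps(2)[of 0 U f] by blast

lemma smooth_on_has_derivative:
  "smooth_on U f \<Longrightarrow> x \<in> U \<Longrightarrow> (f has_derivative frechet_derivative f (at x)) (at x)"
  by (metis smooth_on_differentiable frechet_derivative_works)

lemma smooth_on_partial: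
  "smooth_on U f \<Longrightarrow> b \<in> Basis \<Longrightarrow> smooth_on U (\<lambda>x. frechet_derivative f (at x) b)"
  unfolding smooth_on_def using Ck_on.simps(2)[of _ U f] by blast

lemma smooth_on_continuous_on: "smooth_on U f \<Longrightarrow> continuous_on U f"
  unfolding smooth_on_def using Ck_on.simps(1)[of U f] by blast

lemma smooth_on_continuous_on_UNIV: "smooth_on UNIV f \<Longrightarrow> continuous_on S f"
  using smooth_on_continuous_on continuous_on_subset by blast

lemma smooth_on_has_real_derivative:
  "smooth_on U f \<Longrightarrow> x \<in> U \<Longrightarrow> (f has_real_derivative deriv f x) (at x)"
  by (metis DERIV_deriv_iff_real_differentiable smooth_on_differentiable)

lemma smooth_on_deriv:
  assumes "open U" "smooth_on U f" shows "smooth_on U (deriv f)"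
proof -
  have "smooth_on U (\<lambda>x. frechet_derivative f (at x) 1)"
    using assms by (intro smooth_on_partial) auto
  moreover have "smooth_on U (\<lambda>x. frechet_derivative f (at x) 1) = smooth_on U (deriv f)"
    using assms by (intro smooth_on_cong) (blast intro: frechet_derivative_real smooth_on_differentiable)+
  ultimately show ?thesis by simp
qed

lemma smooth_on_higher_deriv: "smooth_on UNIV f \<Longrightarrow> smooth_on UNIV ((deriv ^^ n) f)"
  by (induction n) (auto intro: smooth_on_deriv)

lemma Ck_on_SucI_real:
  fixes f :: "real \<Rightarrow> real"
  assumes "open U" "\<And>x. x \<in> U \<Longrightarrow> (f has_real_derivative f' x) (at x)" "Ck_on k U f'"
  shows "Ck_on (Suc k) U f"
proof (rule Ck_on_SucI[OF assms(1)])
  show "\<And>x. x \<in> U \<Longrightarrow> (f has_derivative (*) (f' x)) (at x)"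
    using assms(2) by (auto simp: has_field_derivative_def)
qed (use assms(3) in auto)

text \<open>Concrete functions are shown to be smooth by placing them in an explicit family that is
  closed under differentiation; the invariant \<open>P\<close> then serves all orders at
  once.\<close>

lemma smooth_on_coinduct:
  fixes f :: "real \<Rightarrow> real"
  assumes "open U" "P f" "\<And>f. P f \<Longrightarrow> \<exists>g. P g \<and> (\<forall>x\<in>U. (f has_real_derivative g x) (at x))"
  shows "smooth_on U f"
proof -
  have "Ck_on k U f" if "P f" for k f
    using that
  proof (induction k arbitrary: f)
    case 0
    then show ?case using assms(3)[OF 0]
      by (metis Ck_on.simps(1) continuous_at_imp_continuous_on DERIV_isCont)
  next
    case (Suc k)
    then obtain g where g: "P g" "\<forall>x\<in>U. (f has_real_derivative g x) (at x)" using assms(3) by blast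
    show ?case by (rule Ck_on_SucI_real[OF assms(1), of f g]) (use g Suc.IH in auto)
  qed
  then show ?thesis using assms(2) unfolding smooth_on_def by blast
qed

lemma smooth_on_antiderivative:
  fixes f :: "real \<Rightarrow> real"
  assumes "open U" "smooth_on U f" "\<And>x. x \<in> U \<Longrightarrow> (F has_real_derivative f x) (at x)"
  shows "smooth_on U F"
  unfolding smooth_on_def
proof
  fix k show "Ck_on k U F"
    by (rule Ck_on_Suc_imp, rule Ck_on_SucI_real[OF assms(1,3)]) (use assms(2) smooth_on_def in auto)
qed

lemma DERIV_inverse_power:
  "x \<noteq> 0 \<Longrightarrow> ((\<lambda>x. inverse x ^ n) has_real_derivative - real n * inverse x ^ Suc n) (at x)"
  by (rule derivative_eq_intros refl | assumption)+ (cases n; simp add: algebra_simps)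

lemma smooth_on_inverse: "smooth_on {0<..} (inverse :: real \<Rightarrow> real)"
proof (rule smooth_on_coinduct[where P = "\<lambda>f. \<exists>c n. f = (\<lambda>x. c * inverse x ^ n)"])
  show "\<exists>c n. inverse = (\<lambda>x::real. c * inverse x ^ n)"
    by (rule exI[of _ 1], rule exI[of _ 1]) auto
  fix f :: "real \<Rightarrow> real" assume "\<exists>c n. f = (\<lambda>x. c * inverse x ^ n)"
  then obtain c n where f: "f = (\<lambda>x. c * inverse x ^ n)" by blast
  have "(f has_real_derivative (- c * of_nat n) * inverse x ^ Suc n) (at x)" if "x \<in> {0<..}" for x
    unfolding f using that
    using DERIV_cmult[OF DERIV_inverse_power, of x c n] by (simp add: algebra_simps)
  then show "\<exists>g. (\<exists>c n. g = (\<lambda>x. c * inverse x ^ n)) \<and> (\<forall>x\<in>{0<..}. (f has_real_derivative g x) (at x))"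
    by blast
qed auto

lemma smooth_on_sqrt: "smooth_on {0<..} sqrt"
proof (rule smooth_on_coinduct[where P = "\<lambda>f. \<exists>c n. f = (\<lambda>x. c * sqrt x * inverse x ^ n)"])
  show "\<exists>c n. sqrt = (\<lambda>x. c * sqrt x * inverse x ^ n)"
    by (rule exI[of _ 1], rule exI[of _ 0]) auto
  fix f :: "real \<Rightarrow> real" assume "\<exists>c n. f = (\<lambda>x. c * sqrt x * inverse x ^ n)"
  then obtain c n where f: "f = (\<lambda>x. c * sqrt x * inverse x ^ n)" by blast
  have "(f has_real_derivative (c * (1/2 - of_nat n)) * sqrt x * inverse x ^ Suc n) (at x)"
    if "x \<in> {0<..}" for x
  proof -
    have x: "x > 0" using that by auto
    \<comment> \<open>This identity keeps the derivative of \<open>sqrt\<close> inside the family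
      \<open>c * sqrt x * inverse x ^ n\<close>.\<close>
    have s: "inverse (sqrt x) = sqrt x * inverse x"
    proof -
      have "sqrt x * sqrt x = x" "sqrt x > 0" using x by auto
      then have "sqrt x * (inverse (sqrt x) - sqrt x * inverse x) = 0" using x by (simp add: right_diff_distrib flip: mult.assoc)
      then show ?thesis using \<open>sqrt x > 0\<close> by simp
    qed
    show ?thesis
      unfolding f
      by (rule DERIV_cong[OF DERIV_mult[OF DERIV_cmult[OF DERIV_real_sqrt] DERIV_inverse_power]])
         (use x in \<open>auto simp: s algebra_simps\<close>)
  qed
  then show "\<exists>g. (\<exists>c n. g = (\<lambda>x. c * sqrt x * inverse x ^ n)) \<and> (\<forall>x\<in>{0<..}. (f has_real_derivative g x) (at x))"
    by blast
qed auto

section \<open>Bump functions\<close>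

text \<open>The standard function that is smooth but not analytic: every derivative tends to 0 at
  the origin, so it glues to zero. All cutoffs and bumps are built from it.\<close>

definition flat :: "real \<Rightarrow> real" where
  "flat x = (if x > 0 then exp (- inverse x) else 0)"

lemma flat_simps: "x > 0 \<Longrightarrow> flat x > 0" "x \<le> 0 \<Longrightarrow> flat x = 0" "flat x \<ge> 0"
  by (auto simp: flat_def)

lemma tendsto_power_exp_inverse:
  "((\<lambda>x. inverse x ^ n * exp (- inverse x)) \<longlongrightarrow> 0) (at_right (0::real))"
proof -
  have "((\<lambda>y::real. y ^ n / exp y) \<longlongrightarrow> 0) at_top" by (rule tendsto_power_div_exp_0)
  then have "((\<lambda>x::real. inverse x ^ n / exp (inverse x)) \<longlongrightarrow> 0) (at_right 0)"
    by (rule filterlim_compose[OF _ filterlim_inverse_at_top_right])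
  then show ?thesis by (simp add: exp_minus divide_inverse)
qed

lemma smooth_on_flat: "smooth_on UNIV flat"
proof -
  \<comment> \<open>The family closed under differentiation: polynomials in 1/x times
    \<open>exp (- inverse x)\<close>, extended by zero.\<close>
  define G where "G = (\<lambda>p x. if x > 0 then poly p (inverse x) * exp (- inverse x) else (0::real))"
  have lim: "((\<lambda>x. poly p (inverse x) * exp (- inverse x)) \<longlongrightarrow> 0) (at_right (0::real))" for p
  proof -
    have "((\<lambda>x. \<Sum>i\<le>degree p. coeff p i * (inverse x ^ i * exp (- inverse x))) \<longlongrightarrow> (\<Sum>i\<le>degree p. coeff p i * 0)) (at_right (0::real))"
      by (intro tendsto_intros tendsto_power_exp_inverse)
    then show ?thesis by (simp add: poly_altdef sum_distrib_right mult.assoc)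
  qed
  have D: "\<exists>g. (\<exists>p. g = G p) \<and> (\<forall>x\<in>UNIV. (G p has_real_derivative g x) (at x))" for p
  proof -
    \<comment> \<open>With y = 1/x one has dy/dx = - y^2, and the derivative of exp (-y) in x is y^2
      exp (-y); so the factor p(y) turns into y^2 (p(y) - p'(y)).\<close>
    define p' where "p' = monom 1 2 * (p - pderiv p)"
    have "(G p has_real_derivative G p' x) (at x)" for x
    proof -
      consider "x > 0" | "x < 0" | "x = 0" by linarith
      then show ?thesis
      proof cases
        case 1
        have "((\<lambda>x. poly p (inverse x) * exp (- inverse x)) has_real_derivative poly p' (inverse x) * exp (- inverse x)) (at x)"
          using 1 unfolding p'_def
          by (auto intro!: derivative_eq_intros DERIV_chain'[OF _ poly_DERIV] simp: poly_monom algebra_simps power2_eq_square)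
        then have "(G p has_real_derivative poly p' (inverse x) * exp (- inverse x)) (at x)"
          by (rule has_field_derivative_transform_within_open[of _ _ _ "{0<..}"]) (use 1 in \<open>auto simp: G_def\<close>)
        then show ?thesis using 1 by (simp add: G_def)
      next
        case 2
        have "((\<lambda>x. 0) has_real_derivative 0) (at x)" by simp
        then have "(G p has_real_derivative 0) (at x)"
          by (rule has_field_derivative_transform_within_open[of _ _ _ "{..<0}"]) (use 2 in \<open>auto simp: G_def\<close>)
        then show ?thesis using 2 by (simp add: G_def)
      next
        case 3
        have "((\<lambda>h. (G p (0 + h) - G p 0) / h) \<longlongrightarrow> 0) (at (0::real))"
          unfolding filterlim_split_at
        proof (rule filterlim_split_at_real)
          have "((\<lambda>h::real. 0) \<longlongrightarrow> (0::real)) (at_left 0)" by simp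
          then show "((\<lambda>h. (G p (0 + h) - G p 0) / h) \<longlongrightarrow> 0) (at_left 0)"
            by (rule Lim_transform_eventually) (auto simp: G_def eventually_at_filter)
          \<comment> \<open>Division by \<open>h\<close> multiplies the polynomial in 1/h by its
            variable, which is \<open>pCons 0 p\<close>, so the limit already proved
            applies.\<close>
          show "((\<lambda>h. (G p (0 + h) - G p 0) / h) \<longlongrightarrow> 0) (at_right 0)"
            by (rule Lim_transform_eventually[OF lim[of "pCons 0 p"]])
               (auto simp: G_def eventually_at_filter field_simps)
        qed
        moreover have "G p' 0 = 0" by (simp add: G_def)
        ultimately show ?thesis unfolding 3 DERIV_def by simp
      qed
    qed
    then show ?thesis by blast
  qed
  have "smooth_on UNIV (G 1)"
    by (rule smooth_on_coinduct[where P = "\<lambda>f. \<exists>p. f = G p"]) (use D in auto)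
  moreover have "G 1 = flat" by (auto simp: G_def flat_def)
  ultimately show ?thesis by simp
qed

section \<open>Radial test functions\<close>

lemma higher_deriv_cong_open:
  fixes f g :: "real \<Rightarrow> real"
  assumes "open U" "\<And>x. x \<in> U \<Longrightarrow> f x = g x"
  shows "x \<in> U \<Longrightarrow> (deriv ^^ n) f x = (deriv ^^ n) g x"
proof (induction n arbitrary: x)
  case 0 then show ?case using assms by simp
next
  case (Suc n)
  have "eventually (\<lambda>x. x \<in> U) (nhds x)" using assms(1) Suc.prems eventually_nhds by blast
  then have "eventually (\<lambda>x. (deriv ^^ n) f x = (deriv ^^ n) g x) (nhds x)"
    by (rule eventually_mono) (rule Suc.IH)
  then show ?case by (simp add: deriv_cong_ev)
qed

lemma higher_deriv_real_derivative:
  "smooth_on UNIV f \<Longrightarrow> ((deriv ^^ n) f has_real_derivative (deriv ^^ Suc n) f x) (at x)"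
  using smooth_on_has_real_derivative[OF smooth_on_higher_deriv, of f x n] by simp

lemma has_real_derivative_ext:
  assumes "\<And>x. (f has_real_derivative g x) (at x)" shows "deriv f = g"
  using assms DERIV_imp_deriv by blast

text \<open>Up to the area of the unit sphere of R^(N+1), this is the integral of g (\<rho> +
  |\<zeta>|^2) over \<zeta> in R^(N+1), with \<open>z ^ N\<close> as the weight of polar
  coordinates. The bound \<open>M\<close> keeps the integral proper; nothing is lost for \<rho>
  \<ge> 0 when \<open>g\<close> vanishes beyond the square of \<open>M\<close>.\<close>

definition phi :: "nat \<Rightarrow> real \<Rightarrow> (real \<Rightarrow> real) \<Rightarrow> real \<Rightarrow> real" where
  "phi N M g \<rho> = integral {0..M} (\<lambda>z. g (\<rho> + z\<^sup>2) * z ^ N)"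

lemma continuous_on_smooth_compose:
  "smooth_on UNIV (g :: real \<Rightarrow> real) \<Longrightarrow> continuous_on A h \<Longrightarrow> continuous_on A (\<lambda>x. g (h x))"
  using smooth_on_continuous_on by (auto intro: continuous_on_compose2)

lemma phi_has_derivative:
  assumes g: "smooth_on UNIV g"
  shows "(phi N M g has_real_derivative phi N M (deriv g) \<rho>) (at \<rho>)"
proof -
  have g': "smooth_on UNIV (deriv g)" using g smooth_on_deriv by blast
  have "((\<lambda>\<rho>. integral (cbox 0 M) (\<lambda>z. g (\<rho> + z\<^sup>2) * z ^ N)) has_real_derivative
     integral (cbox 0 M) (\<lambda>z. deriv g (\<rho> + z\<^sup>2) * z ^ N)) (at \<rho> within UNIV)"
  proof (rule leibniz_rule_field_derivative)
    fix \<rho> t :: real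
    have "((\<lambda>\<rho>. g (\<rho> + t\<^sup>2)) has_real_derivative deriv g (\<rho> + t\<^sup>2)) (at \<rho>)"
      using smooth_on_has_real_derivative[OF g, of "\<rho> + t\<^sup>2"] by (simp add: DERIV_shift)
    then show "((\<lambda>\<rho>. g (\<rho> + t\<^sup>2) * t ^ N) has_real_derivative deriv g (\<rho> + t\<^sup>2) * t ^ N) (at \<rho> within UNIV)"
      using DERIV_cmult_right[of "\<lambda>\<rho>. g (\<rho> + t\<^sup>2)" _ \<rho> UNIV "t ^ N"] by simp
  next
    fix \<rho> :: real
    show "(\<lambda>z. g (\<rho> + z\<^sup>2) * z ^ N) integrable_on cbox 0 M"
      by (intro integrable_continuous continuous_intros continuous_on_smooth_compose[OF g])
  next
    show "continuous_on (UNIV \<times> cbox 0 M) (\<lambda>(\<rho>, z). deriv g (\<rho> + z\<^sup>2) * z ^ N)"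
      unfolding case_prod_unfold by (intro continuous_intros continuous_on_smooth_compose[OF g'])
  qed auto
  then show ?thesis by (simp add: phi_def[abs_def] cbox_interval)
qed

lemma smooth_on_phi: "smooth_on UNIV g \<Longrightarrow> smooth_on UNIV (phi N M g)"
proof (rule smooth_on_coinduct[where P = "\<lambda>f. \<exists>g. smooth_on UNIV g \<and> f = phi N M g"])
  fix f assume "\<exists>g. smooth_on UNIV g \<and> f = phi N M g"
  then obtain g where "smooth_on UNIV g" "f = phi N M g" by auto
  then show "\<exists>h. (\<exists>g. smooth_on UNIV g \<and> h = phi N M g) \<and> (\<forall>x\<in>UNIV. (f has_real_derivative h x) (at x))"
    using phi_has_derivative[of g N M] smooth_on_deriv[OF open_UNIV, of g]
    by (intro exI[of _ "phi N M (deriv g)"] conjI exI[of _ "deriv g"]) auto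
qed auto

lemma deriv_phi: "smooth_on UNIV g \<Longrightarrow> deriv (phi N M g) = phi N M (deriv g)"
  by (rule has_real_derivative_ext) (rule phi_has_derivative)

lemma phi_cong: "(\<And>\<sigma>. \<sigma> \<ge> \<rho> \<Longrightarrow> g \<sigma> = h \<sigma>) \<Longrightarrow> phi N M g \<rho> = phi N M h \<rho>"
  unfolding phi_def by (rule integral_cong) simp

lemma phi_zero: "(\<And>\<sigma>. \<sigma> \<ge> \<rho> \<Longrightarrow> g \<sigma> = 0) \<Longrightarrow> phi N M g \<rho> = 0"
  using phi_cong[of \<rho> g "\<lambda>_. 0" N M] by (simp add: phi_def)

text \<open>Integrating over \<open>z\<close> against \<open>z ^ N\<close> amounts to integrating a radial function over \<open>N + 1\<close>
  additional variables, hence it raises the dimension \<open>n\<close> in the radial Laplacian by \<open>N + 1\<close>.\<close>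

lemma phi_laplacian:
  assumes g: "smooth_on UNIV g" and z: "\<And>\<sigma>. \<sigma> \<ge> M\<^sup>2 \<Longrightarrow> deriv g \<sigma> = 0" and "M \<ge> 0" "\<rho> \<ge> 0"
  shows "4 * \<rho> * phi N M (deriv (deriv g)) \<rho> + 2 * n * phi N M (deriv g) \<rho>
     = phi N M (\<lambda>\<sigma>. 4 * \<sigma> * deriv (deriv g) \<sigma> + 2 * (n + real N + 1) * deriv g \<sigma>) \<rho>"
proof -
  have g': "smooth_on UNIV (deriv g)" and g'': "smooth_on UNIV (deriv (deriv g))"
    using g smooth_on_deriv by blast+
  \<comment> \<open>The flux in the auxiliary radial variable: its derivative \<open>?h\<close> is
    \<open>z ^ N\<close> times the Laplacian of the profile in the auxiliary variables. The flux
    vanishes at both ends, so this part of the total Laplacian integrates to zero.\<close>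
  let ?H = "\<lambda>z. 2 * z ^ Suc N * deriv g (\<rho> + z\<^sup>2)"
  let ?h = "\<lambda>z. 2 * (real N + 1) * (deriv g (\<rho> + z\<^sup>2) * z ^ N) + 4 * (z\<^sup>2 * deriv (deriv g) (\<rho> + z\<^sup>2) * z ^ N)"
  have "(?h has_integral (?H M - ?H 0)) {0..M}"
  proof (rule fundamental_theorem_of_calculus[OF \<open>M \<ge> 0\<close>])
    fix x :: real assume "x \<in> {0..M}"
    have d: "((\<lambda>z. deriv g (\<rho> + z\<^sup>2)) has_real_derivative deriv (deriv g) (\<rho> + x\<^sup>2) * (2 * x)) (at x)"
      by (rule DERIV_chain'[OF _ smooth_on_has_real_derivative[OF g']]) (auto intro!: derivative_eq_intros)
    have e: "((\<lambda>z. 2 * z ^ Suc N) has_real_derivative 2 * (real (Suc N) * x ^ N)) (at x)"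
      using DERIV_cmult[OF DERIV_pow[of "Suc N" x UNIV], of 2] by simp
    have "(?H has_real_derivative ?h x) (at x)"
      using DERIV_mult[OF e d] by (rule DERIV_cong) (simp add: algebra_simps power2_eq_square)
    then show "(?H has_vector_derivative ?h x) (at x within {0..M})"
      using has_real_derivative_iff_has_vector_derivative has_vector_derivative_at_within by blast
  qed
  moreover have "?H M - ?H 0 = 0" using z[of "\<rho> + M\<^sup>2"] \<open>\<rho> \<ge> 0\<close> by simp
  ultimately have H: "integral {0..M} ?h = 0" by (simp add: integral_unique)
  have i1: "(\<lambda>z. deriv g (\<rho> + z\<^sup>2) * z ^ N) integrable_on {0..M}"
    and i2: "(\<lambda>z. deriv (deriv g) (\<rho> + z\<^sup>2) * z ^ N) integrable_on {0..M}"
    and i3: "?h integrable_on {0..M}"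
    by (intro integrable_continuous_real continuous_intros continuous_on_smooth_compose[OF g'] continuous_on_smooth_compose[OF g''])+
  have "phi N M (\<lambda>\<sigma>. 4 * \<sigma> * deriv (deriv g) \<sigma> + 2 * (n + real N + 1) * deriv g \<sigma>) \<rho>
      = integral {0..M} (\<lambda>z. (4 * \<rho> * (deriv (deriv g) (\<rho> + z\<^sup>2) * z ^ N) + 2 * n * (deriv g (\<rho> + z\<^sup>2) * z ^ N)) + ?h z)"
    unfolding phi_def by (rule integral_cong) (simp add: algebra_simps)
  also have "\<dots> = integral {0..M} (\<lambda>z. 4 * \<rho> * (deriv (deriv g) (\<rho> + z\<^sup>2) * z ^ N) + 2 * n * (deriv g (\<rho> + z\<^sup>2) * z ^ N))"
    by (subst integral_add[OF integrable_add[OF integrable_on_mult_right[OF i2] integrable_on_mult_right[OF i1]] i3])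
       (simp only: H add_0_right)
  also have "\<dots> = 4 * \<rho> * phi N M (deriv (deriv g)) \<rho> + 2 * n * phi N M (deriv g) \<rho>"
    unfolding phi_def
    by (subst integral_add[OF integrable_on_mult_right[OF i2] integrable_on_mult_right[OF i1]]) simp
  finally show ?thesis by simp
qed

text \<open>Profiles are taken in the squared distance, so that a smooth profile gives a function
  that is smooth at the centre \<open>y\<close> as well.\<close>

definition rad :: "'a::euclidean_space \<Rightarrow> (real \<Rightarrow> real) \<Rightarrow> 'a \<Rightarrow> real" where
  "rad y f x = f ((x - y) \<bullet> (x - y))"

lemma rad_has_derivative:
  assumes "(f has_real_derivative f') (at ((x - y) \<bullet> (x - y)))"
  shows "(rad y f has_derivative (\<lambda>h. 2 * ((x - y) \<bullet> h) * f')) (at x)"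
proof -
  have "((\<lambda>x. (x - y) \<bullet> (x - y)) has_derivative (\<lambda>h. 2 * ((x - y) \<bullet> h))) (at x)"
    by (auto intro!: derivative_eq_intros simp: inner_commute)
  from DERIV_compose_FDERIV[OF assms this] show ?thesis by (simp add: rad_def[abs_def])
qed

lemma smooth_on_rad:
  fixes y :: "'a::euclidean_space"
  assumes "smooth_on UNIV f" shows "smooth_on UNIV (rad y f)"
proof -
  have "smooth_on UNIV (\<lambda>x::'a. \<Sum>b\<in>Basis. (x \<bullet> b - y \<bullet> b) ^ 2)"
    by (intro smooth_on_sum smooth_on_power smooth_on_diff smooth_on_inner smooth_on_const open_UNIV)
  moreover have "(x - y) \<bullet> (x - y) = (\<Sum>b\<in>Basis. (x \<bullet> b - y \<bullet> b) ^ 2)" for x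
    by (subst euclidean_inner) (simp add: inner_diff_left power2_eq_square)
  ultimately have "smooth_on UNIV (\<lambda>x. (x - y) \<bullet> (x - y))" by simp
  from smooth_on_compose_UNIV[OF assms open_UNIV this] show ?thesis by (simp add: rad_def[abs_def])
qed

lemma rad_test_function:
  assumes "smooth_on UNIV f" "\<And>\<sigma>. \<sigma> \<ge> R\<^sup>2 \<Longrightarrow> f \<sigma> = 0" "R \<ge> 0" "cball y R \<subseteq> U"
    "smooth_on UNIV p"
  shows "(\<lambda>x. rad y f x * p x) \<in> test_functions U"
proof -
  have "{x. rad y f x * p x \<noteq> 0} \<subseteq> cball y R"
  proof
    fix x assume "x \<in> {x. rad y f x * p x \<noteq> 0}"
    then have "\<not> ((x - y) \<bullet> (x - y) \<ge> R\<^sup>2)" using assms(2) by (auto simp: rad_def)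
    then have "(norm (x - y))\<^sup>2 < R\<^sup>2" by (simp add: power2_norm_eq_inner)
    then have "norm (x - y) \<le> R" using assms(3) power_less_imp_less_base by fastforce
    then show "x \<in> cball y R" by (simp add: dist_norm norm_minus_commute)
  qed
  then have c: "closure {x. rad y f x * p x \<noteq> 0} \<subseteq> cball y R" by (intro closure_minimal) auto
  then have "compact (closure {x. rad y f x * p x \<noteq> 0})"
    by (meson bounded_cball bounded_subset closed_closure compact_eq_bounded_closed)
  with c assms show ?thesis
    unfolding test_functions_def by (auto intro: smooth_on_rad)
qed

definition lap :: "('a::euclidean_space \<Rightarrow> real) \<Rightarrow> 'a \<Rightarrow> real" where
  "lap \<psi> x = (\<Sum>b\<in>Basis. frechet_derivative (\<lambda>x. frechet_derivative \<psi> (at x) b) (at x) b)"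

text \<open>In the variable \<sigma> = r^2 the operator d^2/dr^2 + (n - 1)/r d/dr becomes 4 \<sigma>
  d^2/d\<sigma>^2 + 2 n d/d\<sigma>, which has no singular coefficient and depends on the dimension
  \<open>n\<close> only through the first-order term.\<close>

lemma lap_rad:
  fixes y :: "'a::euclidean_space"
  assumes f: "smooth_on UNIV f"
  shows "lap (rad y f) x = 4 * ((x - y) \<bullet> (x - y)) * deriv (deriv f) ((x - y) \<bullet> (x - y))
     + 2 * real DIM('a) * deriv f ((x - y) \<bullet> (x - y))"
proof -
  have f': "smooth_on UNIV (deriv f)" using f smooth_on_deriv by blast
  have 1: "frechet_derivative (rad y f) (at x) = (\<lambda>h. 2 * ((x - y) \<bullet> h) * deriv f ((x - y) \<bullet> (x - y)))" for x
    by (intro has_derivative_imp_frechet rad_has_derivative smooth_on_has_real_derivative[OF f]) simp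
  have 2: "frechet_derivative (\<lambda>x. frechet_derivative (rad y f) (at x) b) (at x) b
      = 2 * (b \<bullet> b) * deriv f ((x - y) \<bullet> (x - y)) + 4 * ((x - y) \<bullet> b)\<^sup>2 * deriv (deriv f) ((x - y) \<bullet> (x - y))" for b
  proof -
    have r: "(rad y (deriv f) has_derivative (\<lambda>h. 2 * ((x - y) \<bullet> h) * deriv (deriv f) ((x - y) \<bullet> (x - y)))) (at x)"
      by (intro rad_has_derivative smooth_on_has_real_derivative[OF f']) simp
    have l: "((\<lambda>x. 2 * ((x - y) \<bullet> b)) has_derivative (\<lambda>h. 2 * (h \<bullet> b))) (at x)"
      by (auto intro!: derivative_eq_intros)
    have "((\<lambda>x. 2 * ((x - y) \<bullet> b) * rad y (deriv f) x) has_derivative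
      (\<lambda>h. 2 * ((x - y) \<bullet> b) * (2 * ((x - y) \<bullet> h) * deriv (deriv f) ((x - y) \<bullet> (x - y))) + 2 * (h \<bullet> b) * rad y (deriv f) x)) (at x)"
      by (rule has_derivative_mult[OF l r])
    then have "frechet_derivative (\<lambda>x. 2 * ((x - y) \<bullet> b) * rad y (deriv f) x) (at x) =
      (\<lambda>h. 2 * ((x - y) \<bullet> b) * (2 * ((x - y) \<bullet> h) * deriv (deriv f) ((x - y) \<bullet> (x - y))) + 2 * (h \<bullet> b) * rad y (deriv f) x)"
      by (rule has_derivative_imp_frechet)
    moreover have "(\<lambda>x. frechet_derivative (rad y f) (at x) b) = (\<lambda>x. 2 * ((x - y) \<bullet> b) * rad y (deriv f) x)"
      by (simp add: 1 rad_def fun_eq_iff)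
    ultimately show ?thesis by (simp add: rad_def power2_eq_square)
  qed
  have "(\<Sum>b\<in>Basis. ((x - y) \<bullet> b)\<^sup>2) = (x - y) \<bullet> (x - y)"
    unfolding euclidean_inner[of "x - y" "x - y"] power2_eq_square by (rule refl)
  then have "(\<Sum>b\<in>Basis. 4 * ((x - y) \<bullet> b)\<^sup>2 * deriv (deriv f) ((x - y) \<bullet> (x - y))) = 4 * ((x - y) \<bullet> (x - y)) * deriv (deriv f) ((x - y) \<bullet> (x - y))"
    by (simp flip: sum_distrib_left sum_distrib_right)
  moreover have "(\<Sum>b\<in>(Basis :: 'a set). 2 * (b \<bullet> b) * deriv f ((x - y) \<bullet> (x - y))) = 2 * real DIM('a) * deriv f ((x - y) \<bullet> (x - y))"
    by simp
  ultimately show ?thesis unfolding lap_def 2 by (simp add: sum.distrib)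
qed

text \<open>Differentiating 4 \<sigma> f'' + 2 m f' gives 4 \<sigma> f''' + 2 (m + 2) f'', so each
  derivative in \<sigma> raises the dimension by two; starting from dimension 1, \<open>n\<close> of
  them lead to \<open>2 n + 1\<close>.\<close>

lemma higher_deriv_radial_laplacian:
  assumes f: "smooth_on UNIV f"
  shows "(deriv ^^ n) (\<lambda>\<sigma>. 4 * \<sigma> * deriv (deriv f) \<sigma> + 2 * deriv f \<sigma>)
     = (\<lambda>\<sigma>. 4 * \<sigma> * (deriv ^^ (n + 2)) f \<sigma> + 2 * (2 * real n + 1) * (deriv ^^ (n + 1)) f \<sigma>)"
proof (induction n)
  case 0 then show ?case by (simp add: numeral_2_eq_2)
next
  case (Suc n)
  have "((\<lambda>\<sigma>. 4 * \<sigma> * (deriv ^^ (n + 2)) f \<sigma> + 2 * (2 * real n + 1) * (deriv ^^ (n + 1)) f \<sigma>) has_real_derivative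
     (4 * \<sigma> * (deriv ^^ (n + 3)) f \<sigma> + 2 * (2 * real (Suc n) + 1) * (deriv ^^ (n + 2)) f \<sigma>)) (at \<sigma>)" for \<sigma>
  proof -
    have "((\<lambda>\<sigma>. 4 * \<sigma> * (deriv ^^ (n + 2)) f \<sigma> + 2 * (2 * real n + 1) * (deriv ^^ (n + 1)) f \<sigma>) has_real_derivative
      (4 * (deriv ^^ (n + 2)) f \<sigma> + (deriv ^^ Suc (n + 2)) f \<sigma> * (4 * \<sigma>)) + 2 * (2 * real n + 1) * (deriv ^^ Suc (n + 1)) f \<sigma>) (at \<sigma>)"
      by (intro DERIV_add DERIV_mult DERIV_cmult higher_deriv_real_derivative[OF f]) (auto intro!: derivative_eq_intros)
    then show ?thesis by (rule DERIV_cong) (simp add: algebra_simps numeral_3_eq_3)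
  qed
  then have "deriv (\<lambda>\<sigma>. 4 * \<sigma> * (deriv ^^ (n + 2)) f \<sigma> + 2 * (2 * real n + 1) * (deriv ^^ (n + 1)) f \<sigma>)
     = (\<lambda>\<sigma>. 4 * \<sigma> * (deriv ^^ (n + 3)) f \<sigma> + 2 * (2 * real (Suc n) + 1) * (deriv ^^ (n + 2)) f \<sigma>)"
    by (rule has_real_derivative_ext)
  then show ?case using Suc by (simp add: numeral_3_eq_3)
qed

section \<open>Smooth steps, a smooth substitute for the square root, and spherical waves\<close>

lemma smooth_step_exists:
  assumes "d > (0::real)"
  obtains s where "smooth_on UNIV s" "\<And>\<sigma>. 0 \<le> s \<sigma>" "\<And>\<sigma>. s \<sigma> \<le> 1" "\<And>\<sigma>. \<sigma> \<le> 0 \<Longrightarrow> s \<sigma> = 0" "\<And>\<sigma>. \<sigma> \<ge> d \<Longrightarrow> s \<sigma> = 1"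
proof -
  define D where "D \<sigma> = flat \<sigma> + flat (d - \<sigma>)" for \<sigma>
  have sf: "smooth_on UNIV (\<lambda>\<sigma>. flat (d - \<sigma>))"
    by (rule smooth_on_compose_UNIV[OF smooth_on_flat]) auto
  have D0: "D \<sigma> > 0" for \<sigma>
    using flat_simps(1)[of \<sigma>] flat_simps(1)[of "d - \<sigma>"] flat_simps(3)[of \<sigma>] flat_simps(3)[of "d - \<sigma>"] assms
    unfolding D_def by (cases "\<sigma> > 0") auto
  have sD: "smooth_on UNIV D" unfolding D_def[abs_def] by (intro smooth_on_add smooth_on_flat sf open_UNIV)
  define s where "s \<sigma> = flat \<sigma> * inverse (D \<sigma>)" for \<sigma>
  show ?thesis
  proof (rule that[of s])
    show "smooth_on UNIV s" unfolding s_def[abs_def]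
      by (intro smooth_on_mult smooth_on_flat smooth_on_compose[OF _ _ smooth_on_inverse sD]) (use D0 in auto)
    show "0 \<le> s \<sigma>" "s \<sigma> \<le> 1" for \<sigma>
      using D0[of \<sigma>] flat_simps(3)[of \<sigma>] flat_simps(3)[of "d - \<sigma>"] unfolding s_def by (auto simp: field_simps D_def)
    show "s \<sigma> = 0" if "\<sigma> \<le> 0" for \<sigma> using that by (simp add: s_def flat_simps)
    show "s \<sigma> = 1" if "\<sigma> \<ge> d" for \<sigma>
    proof -
      have "D \<sigma> = flat \<sigma>" using that by (simp add: D_def flat_simps)
      then show ?thesis using D0[of \<sigma>] by (simp add: s_def)
    qed
  qed
qed

lemma smooth_sqrt_exists:
  assumes "d > (0::real)"
  obtains q where "smooth_on UNIV q" "\<And>\<sigma>. \<sigma> \<ge> d \<Longrightarrow> q \<sigma> = sqrt \<sigma>"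
proof -
  obtain s where s: "smooth_on UNIV s" "\<And>\<sigma>. 0 \<le> s \<sigma>" "\<And>\<sigma>. s \<sigma> \<le> 1" "\<And>\<sigma>. \<sigma> \<le> 0 \<Longrightarrow> s \<sigma> = 0" "\<And>\<sigma>. \<sigma> \<ge> d \<Longrightarrow> s \<sigma> = 1"
    by (rule smooth_step_exists[OF assms]) blast
  \<comment> \<open>A convex combination of \<sigma> and \<open>d\<close> for \<sigma> > 0: it
    equals \<sigma> from \<open>d\<close> on and \<open>d\<close> for \<sigma> \<le> 0, and it is
    positive everywhere, so \<open>sqrt\<close> is only evaluated where it is smooth.\<close>
  define m where "m \<sigma> = \<sigma> * s \<sigma> + d * (1 - s \<sigma>)" for \<sigma>
  have sm: "smooth_on UNIV m" unfolding m_def[abs_def] by (intro smooth_on_add smooth_on_mult smooth_on_diff s(1)) auto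
  have m0: "m \<sigma> > 0" for \<sigma>
  proof (cases "\<sigma> > 0")
    case True
    then show ?thesis using s(2)[of \<sigma>] s(3)[of \<sigma>] assms unfolding m_def
      by (cases "s \<sigma> = 0") (auto intro: add_pos_nonneg)
  next
    case False
    then show ?thesis using assms s(4)[of \<sigma>] by (simp add: m_def)
  qed
  show ?thesis
  proof (rule that)
    show "smooth_on UNIV (\<lambda>\<sigma>. sqrt (m \<sigma>))"
      by (rule smooth_on_compose[OF _ _ smooth_on_sqrt sm]) (use m0 in auto)
    show "sqrt (m \<sigma>) = sqrt \<sigma>" if "\<sigma> \<ge> d" for \<sigma> using s(5)[OF that] by (simp add: m_def)
  qed
qed

text \<open>The case of dimension 1, where the radial Laplacian is the plain second derivative in r;
  this is the chain rule for \<sigma> = r^2, on the range where \<open>q\<close> is the square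
  root.\<close>

lemma wave_1d_radial:
  assumes F: "smooth_on UNIV F" and q: "smooth_on UNIV q" "\<And>\<sigma>. \<sigma> \<ge> d \<Longrightarrow> q \<sigma> = sqrt \<sigma>" and d: "d > 0" "\<sigma> > d"
  shows "4 * \<sigma> * deriv (deriv (\<lambda>\<sigma>. F (q \<sigma>))) \<sigma> + 2 * deriv (\<lambda>\<sigma>. F (q \<sigma>)) \<sigma> = deriv (deriv F) (q \<sigma>)"
proof -
  have F': "smooth_on UNIV (deriv F)" using F smooth_on_deriv by blast
  have s: "(sqrt has_real_derivative inverse (sqrt \<sigma>) / 2) (at \<sigma>)" if "\<sigma> > d" for \<sigma>
    using that d DERIV_real_sqrt[of \<sigma>] by auto
  have 1: "deriv (\<lambda>\<sigma>. F (q \<sigma>)) \<sigma> = deriv F (sqrt \<sigma>) * (inverse (sqrt \<sigma>) / 2)" if "\<sigma> > d" for \<sigma>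
  proof -
    have "((\<lambda>\<sigma>. F (sqrt \<sigma>)) has_real_derivative deriv F (sqrt \<sigma>) * (inverse (sqrt \<sigma>) / 2)) (at \<sigma>)"
      by (rule DERIV_chain2[OF smooth_on_has_real_derivative[OF F] s[OF that]]) simp
    then have "((\<lambda>\<sigma>. F (q \<sigma>)) has_real_derivative deriv F (sqrt \<sigma>) * (inverse (sqrt \<sigma>) / 2)) (at \<sigma>)"
      by (rule has_field_derivative_transform_within_open[of _ _ _ "{d<..}"]) (use q that in auto)
    then show ?thesis by (rule DERIV_imp_deriv)
  qed
  define r where "r = sqrt \<sigma>"
  have r: "r > 0" "\<sigma> = r * r" using d by (auto simp: r_def)
  have "((\<lambda>\<sigma>. deriv F (sqrt \<sigma>)) has_real_derivative deriv (deriv F) (sqrt \<sigma>) * (inverse (sqrt \<sigma>) / 2)) (at \<sigma>)"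
    by (rule DERIV_chain2[OF smooth_on_has_real_derivative[OF F'] s[OF d(2)]]) simp
  moreover have "((\<lambda>\<sigma>. inverse (sqrt \<sigma>) / 2) has_real_derivative - (inverse (sqrt \<sigma>) * (inverse (sqrt \<sigma>) / 2) * inverse (sqrt \<sigma>)) / 2) (at \<sigma>)"
    by (rule DERIV_cdivide[OF DERIV_inverse'[OF s[OF d(2)]]]) (use d in auto)
  ultimately have "((\<lambda>\<sigma>. deriv F (sqrt \<sigma>) * (inverse (sqrt \<sigma>) / 2)) has_real_derivative
      (deriv (deriv F) (sqrt \<sigma>) * (inverse (sqrt \<sigma>) / 2)) * (inverse (sqrt \<sigma>) / 2) +
      (- (inverse (sqrt \<sigma>) * (inverse (sqrt \<sigma>) / 2) * inverse (sqrt \<sigma>)) / 2) * deriv F (sqrt \<sigma>)) (at \<sigma>)"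
    by (rule DERIV_mult)
  then have "(deriv (\<lambda>\<sigma>. F (q \<sigma>)) has_real_derivative
      (deriv (deriv F) (sqrt \<sigma>) * (inverse (sqrt \<sigma>) / 2)) * (inverse (sqrt \<sigma>) / 2) +
      (- (inverse (sqrt \<sigma>) * (inverse (sqrt \<sigma>) / 2) * inverse (sqrt \<sigma>)) / 2) * deriv F (sqrt \<sigma>)) (at \<sigma>)"
    by (rule has_field_derivative_transform_within_open[of _ _ _ "{d<..}"]) (use 1 d in auto)
  from DERIV_imp_deriv[OF this] have 2: "deriv (deriv (\<lambda>\<sigma>. F (q \<sigma>))) \<sigma> = (deriv (deriv F) r * (inverse r / 2)) * (inverse r / 2) +
      (- (inverse r * (inverse r / 2) * inverse r) / 2) * deriv F r"
    by (simp add: r_def)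
  have "q \<sigma> = r" using q(2)[of \<sigma>] d by (simp add: r_def)
  then show ?thesis unfolding 2 1[OF d(2)] r_def[symmetric] unfolding r(2) using r(1) by (simp add: field_simps)
qed

text \<open>The \<open>N\<close>-th derivative in \<open>\<sigma> = r\<^sup>2\<close> turns solutions of the one-dimensional wave equation into
  radial solutions in dimension \<open>2 N + 1\<close>.\<close>

definition psi_rad :: "nat \<Rightarrow> real \<Rightarrow> (real \<Rightarrow> real) \<Rightarrow> (real \<Rightarrow> real) \<Rightarrow> real \<Rightarrow> real" where
  "psi_rad N M q F = phi N M ((deriv ^^ N) (\<lambda>\<sigma>. F (q \<sigma>)))"

lemma higher_deriv_zero_right:
  assumes "smooth_on UNIV f" "\<And>\<sigma>. \<sigma> \<ge> (a::real) \<Longrightarrow> f \<sigma> = 0" "\<sigma> \<ge> a"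
  shows "(deriv ^^ n) f \<sigma> = 0"
proof -
  have "\<sigma> \<in> {a<..} \<Longrightarrow> (deriv ^^ n) f \<sigma> = (deriv ^^ n) (\<lambda>_. 0) \<sigma>" for \<sigma>
    by (rule higher_deriv_cong_open[of "{a<..}"]) (use assms in auto)
  moreover have "(deriv ^^ n) (\<lambda>_. 0::real) = (\<lambda>_. 0)" by (induction n) auto
  ultimately have *: "{a<..} \<subseteq> {x. (deriv ^^ n) f x = 0}" by auto
  have "closed {x. (deriv ^^ n) f x = 0}"
    using smooth_on_continuous_on[OF smooth_on_higher_deriv[OF assms(1)]] by (intro closed_Collect_eq) auto
  then have "closure {a<..} \<subseteq> {x. (deriv ^^ n) f x = 0}" using * by (intro closure_minimal) auto
  with assms(3) show ?thesis by auto
qed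

text \<open>The dimension shifts close up: \<open>wave_1d_radial\<close> lives in dimension 1,
  \<open>N\<close> derivatives lead to dimension \<open>2 N + 1\<close>, and \<open>phi\<close>
  returns from there to dimension \<open>N\<close>. As \<open>phi\<close> at a point only sees
  larger values of \<sigma>, the identity holds wherever the squared distance exceeds
  \<open>d\<close>, although \<open>q\<close> differs from the square root below
  \<open>d\<close>.\<close>

lemma lap_psi_rad:
  fixes y :: "'a::euclidean_space"
  assumes F: "smooth_on UNIV F" "\<And>r. r \<ge> M \<Longrightarrow> F r = 0"
    and q: "smooth_on UNIV q" "\<And>\<sigma>. \<sigma> \<ge> d \<Longrightarrow> q \<sigma> = sqrt \<sigma>"
    and d: "d > 0" "d \<le> M\<^sup>2" "M \<ge> 0" and x: "(x - y) \<bullet> (x - y) > d"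
  shows "lap (rad y (psi_rad DIM('a) M q F)) x = rad y (psi_rad DIM('a) M q (deriv (deriv F))) x"
proof -
  let ?n = "DIM('a)" and ?\<rho> = "(x - y) \<bullet> (x - y)"
  define f where "f = (\<lambda>\<sigma>. F (q \<sigma>))"
  have f: "smooth_on UNIV f" unfolding f_def by (rule smooth_on_compose_UNIV[OF F(1) open_UNIV q(1)])
  define g where "g = (deriv ^^ ?n) f"
  have g: "smooth_on UNIV g" unfolding g_def by (rule smooth_on_higher_deriv[OF f])
  have f0: "f \<sigma> = 0" if "\<sigma> \<ge> M\<^sup>2" for \<sigma>
  proof -
    have "sqrt \<sigma> \<ge> M" using that d(3) real_le_rsqrt by blast
    then show ?thesis using that d q(2)[of \<sigma>] F(2) by (simp add: f_def)
  qed
  have g'0: "deriv g \<sigma> = 0" if "\<sigma> \<ge> M\<^sup>2" for \<sigma>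
    using higher_deriv_zero_right[OF f f0 that, of "Suc ?n"] by (simp add: g_def)
  have "lap (rad y (phi ?n M g)) x = 4 * ?\<rho> * phi ?n M (deriv (deriv g)) ?\<rho> + 2 * real ?n * phi ?n M (deriv g) ?\<rho>"
    by (subst lap_rad[OF smooth_on_phi[OF g]]) (simp add: deriv_phi g smooth_on_deriv)
  also have "\<dots> = phi ?n M (\<lambda>\<sigma>. 4 * \<sigma> * deriv (deriv g) \<sigma> + 2 * (real ?n + real ?n + 1) * deriv g \<sigma>) ?\<rho>"
    by (rule phi_laplacian[OF g g'0]) (use d in auto)
  also have "\<dots> = phi ?n M ((deriv ^^ ?n) (\<lambda>\<sigma>. deriv (deriv F) (q \<sigma>))) ?\<rho>"
  proof (rule phi_cong)
    fix \<sigma> assume s: "\<sigma> \<ge> ?\<rho>"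
    have "(deriv ^^ ?n) (\<lambda>\<sigma>. deriv (deriv F) (q \<sigma>)) \<sigma> = (deriv ^^ ?n) (\<lambda>\<sigma>. 4 * \<sigma> * deriv (deriv f) \<sigma> + 2 * deriv f \<sigma>) \<sigma>"
      unfolding f_def by (rule higher_deriv_cong_open[of "{d<..}"]) (use s x in \<open>auto simp: wave_1d_radial[OF F(1) q d(1)]\<close>)
    also have "\<dots> = 4 * \<sigma> * deriv (deriv g) \<sigma> + 2 * (real ?n + real ?n + 1) * deriv g \<sigma>"
      by (simp add: higher_deriv_radial_laplacian[OF f] g_def)
    finally show "4 * \<sigma> * deriv (deriv g) \<sigma> + 2 * (real ?n + real ?n + 1) * deriv g \<sigma>
       = (deriv ^^ ?n) (\<lambda>\<sigma>. deriv (deriv F) (q \<sigma>)) \<sigma>" by simp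
  qed
  finally show ?thesis by (simp add: psi_rad_def rad_def g_def f_def)
qed

lemma smooth_on_psi_rad:
  assumes "smooth_on UNIV F" "smooth_on UNIV q"
  shows "smooth_on UNIV (psi_rad N M q F)"
  unfolding psi_rad_def
  by (intro smooth_on_phi smooth_on_higher_deriv smooth_on_compose_UNIV[OF assms(1) open_UNIV assms(2)])

text \<open>Since \<open>phi\<close> only looks outwards, a profile supported in r < R gives a wave
  supported in the ball of radius \<open>R\<close>. This makes spherical waves test functions, and
  hides those with small profile where the solution vanishes.\<close>

lemma psi_rad_zero:
  assumes F: "smooth_on UNIV F" "\<And>r. r \<ge> R \<Longrightarrow> F r = 0"
    and q: "smooth_on UNIV q" "\<And>\<sigma>. \<sigma> \<ge> d \<Longrightarrow> q \<sigma> = sqrt \<sigma>" "d \<le> R\<^sup>2" "R \<ge> 0" "\<rho> \<ge> R\<^sup>2"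
  shows "psi_rad N M q F \<rho> = 0"
  unfolding psi_rad_def
proof (rule phi_zero)
  fix \<sigma> assume "\<sigma> \<ge> \<rho>"
  show "(deriv ^^ N) (\<lambda>\<sigma>. F (q \<sigma>)) \<sigma> = 0"
  proof (rule higher_deriv_zero_right[of _ "R\<^sup>2"])
    fix \<sigma> assume "R\<^sup>2 \<le> \<sigma>"
    then have "sqrt \<sigma> \<ge> R" using q(4) real_le_rsqrt by blast
    then show "F (q \<sigma>) = 0" using \<open>R\<^sup>2 \<le> \<sigma>\<close> q(3) q(2)[of \<sigma>] F(2) by simp
  qed (use \<open>\<sigma> \<ge> \<rho>\<close> q(5) smooth_on_compose_UNIV[OF F(1) open_UNIV q(1)] in auto)
qed

text \<open>Only the existence of coefficients that do not depend on \<open>F\<close> is needed from Faa di Bruno's formula.\<close>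

lemma higher_deriv_compose:
  assumes q: "smooth_on UNIV (q :: real \<Rightarrow> real)"
  shows "\<exists>c. (\<forall>i. smooth_on UNIV (c i)) \<and>
    (\<forall>F. smooth_on UNIV F \<longrightarrow> (\<forall>\<sigma>. (deriv ^^ n) (\<lambda>\<sigma>. F (q \<sigma>)) \<sigma> = (\<Sum>i\<le>n. (deriv ^^ i) F (q \<sigma>) * c i \<sigma>)))"
proof (induction n)
  case 0
  show ?case by (rule exI[of _ "\<lambda>i \<sigma>. 1"]) auto
next
  case (Suc n)
  from Suc.IH obtain c where c: "\<And>i. smooth_on UNIV (c i)"
    "\<And>F \<sigma>. smooth_on UNIV F \<Longrightarrow> (deriv ^^ n) (\<lambda>\<sigma>. F (q \<sigma>)) \<sigma> = (\<Sum>i\<le>n. (deriv ^^ i) F (q \<sigma>) * c i \<sigma>)" by blast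
  \<comment> \<open>The derivative of order \<open>i\<close> arises in two ways: the coefficient
    \<open>c i\<close> was differentiated, or the chain rule raised order \<open>i - 1\<close>; the
    second way is absent for \<open>i = 0\<close>.\<close>
  define c' where "c' i \<sigma> = (if i \<le> n then deriv (c i) \<sigma> else 0) + (if i = 0 then 0 else c (i - 1) \<sigma> * deriv q \<sigma>)" for i \<sigma>
  have "smooth_on UNIV (c' i)" for i
    unfolding c'_def[abs_def]
    by (cases "i \<le> n"; cases "i = 0") (auto intro!: smooth_on_deriv[OF open_UNIV] c(1) smooth_on_mult smooth_on_add q)
  moreover have "(deriv ^^ Suc n) (\<lambda>\<sigma>. F (q \<sigma>)) \<sigma> = (\<Sum>i\<le>Suc n. (deriv ^^ i) F (q \<sigma>) * c' i \<sigma>)"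
    if F: "smooth_on UNIV F" for F \<sigma>
  proof -
    have "((\<lambda>\<sigma>. \<Sum>i\<le>n. (deriv ^^ i) F (q \<sigma>) * c i \<sigma>) has_real_derivative
      (\<Sum>i\<le>n. (deriv ^^ Suc i) F (q \<sigma>) * deriv q \<sigma> * c i \<sigma> + deriv (c i) \<sigma> * (deriv ^^ i) F (q \<sigma>))) (at \<sigma>)"
      by (intro DERIV_sum DERIV_mult DERIV_chain2[OF higher_deriv_real_derivative[OF F]]
          smooth_on_has_real_derivative[OF q] smooth_on_has_real_derivative[OF c(1)]) auto
    then have "deriv ((deriv ^^ n) (\<lambda>\<sigma>. F (q \<sigma>))) \<sigma> = (\<Sum>i\<le>n. (deriv ^^ Suc i) F (q \<sigma>) * deriv q \<sigma> * c i \<sigma> + deriv (c i) \<sigma> * (deriv ^^ i) F (q \<sigma>))"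
      unfolding c(2)[OF F, abs_def] by (rule DERIV_imp_deriv)
    also have "\<dots> = (\<Sum>i\<le>n. (deriv ^^ i) F (q \<sigma>) * deriv (c i) \<sigma>) + (\<Sum>i\<le>n. (deriv ^^ Suc i) F (q \<sigma>) * (c i \<sigma> * deriv q \<sigma>))"
      by (simp add: sum.distrib algebra_simps)
    also have "\<dots> = (\<Sum>i\<le>Suc n. (deriv ^^ i) F (q \<sigma>) * (if i \<le> n then deriv (c i) \<sigma> else 0))
        + (\<Sum>i\<le>Suc n. (deriv ^^ i) F (q \<sigma>) * (if i = 0 then 0 else c (i - 1) \<sigma> * deriv q \<sigma>))"
      by (subst (2) sum.atMost_Suc_shift) simp
    also have "\<dots> = (\<Sum>i\<le>Suc n. (deriv ^^ i) F (q \<sigma>) * c' i \<sigma>)"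
      unfolding c'_def by (simp only: sum.distrib distrib_left)
    finally show ?thesis by simp
  qed
  ultimately show ?case by (intro exI[of _ c'] conjI allI impI)
qed

section \<open>Uniqueness for the one-dimensional wave equation\<close>

lemma deriv_shift:
  fixes F :: "real \<Rightarrow> real"
  assumes "smooth_on UNIV F"
  shows "deriv (\<lambda>r. F (r + l)) = (\<lambda>r. deriv F (r + l))"
proof
  fix r
  have "(F has_real_derivative deriv F (r + l)) (at (r + l))"
    using smooth_on_has_real_derivative[OF assms] by simp
  then show "deriv (\<lambda>r. F (r + l)) r = deriv F (r + l)"
    using DERIV_shift DERIV_imp_deriv by blast
qed

lemma smooth_on_shift:
  fixes F :: "real \<Rightarrow> real"
  assumes "smooth_on UNIV F" shows "smooth_on UNIV (\<lambda>r. F (r + l))"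
  by (rule smooth_on_compose_UNIV[OF assms]) auto

lemma deriv_zero_right:
  fixes F :: "real \<Rightarrow> real"
  assumes F: "smooth_on UNIV F" and z: "\<And>r. r \<ge> \<rho> \<Longrightarrow> F r = 0" and r: "r \<ge> \<rho>"
  shows "deriv F r = 0"
proof -
  have "deriv F x = 0" if "x \<in> {\<rho><..}" for x
  proof -
    have "(F has_real_derivative 0) (at x)"
      by (rule has_field_derivative_transform_within_open[of "\<lambda>_. 0" _ _ "{\<rho><..}"]) (use that z in auto)
    then show ?thesis by (rule DERIV_imp_deriv)
  qed
  moreover have "closed {x. deriv F x = 0}"
    using smooth_on_continuous_on[OF smooth_on_deriv[OF open_UNIV F]]
    by (intro closed_Collect_eq) auto
  ultimately have "closure {\<rho><..} \<subseteq> {x. deriv F x = 0}" by (intro closure_minimal) auto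
  with r show ?thesis by auto
qed

definition admissible :: "real \<Rightarrow> (real \<Rightarrow> real) \<Rightarrow> bool" where
  "admissible \<rho> F \<longleftrightarrow> smooth_on UNIV F \<and> (\<forall>r\<ge>\<rho>. F r = 0)"

text \<open>\<open>m F t\<close> models the pairing of a profile \<open>F\<close> in the variable
  \<open>r\<close> with a solution that may be a mere distribution in \<open>r\<close>. It is seen
  for r < \<rho>, as admissible profiles vanish from there on, and it is zero for r < \<delta> by
  \<open>m_zero\<close>. Evolution in \<open>r\<close> becomes translation of \<open>F\<close> by
  \<open>l\<close>; after the translation by \<open>\<rho> - \<delta>\<close> the profile only meets
  the zero region.\<close>

locale wave_1d =
  fixes m :: "(real \<Rightarrow> real) \<Rightarrow> real \<Rightarrow> real" and \<alpha> \<beta> \<delta> \<rho> :: real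
  assumes le: "\<delta> \<le> \<rho>"
  assumes m_deriv: "\<And>F t l. \<lbrakk>admissible \<rho> F; t \<in> {\<alpha>..\<beta>}; l \<in> {0..(\<rho> - \<delta>)}\<rbrakk> \<Longrightarrow>
      ((\<lambda>l. m (\<lambda>r. F (r + l)) t) has_real_derivative m (\<lambda>r. deriv F (r + l)) t) (at l within {0..(\<rho> - \<delta>)})"
  assumes m_cont: "\<And>F. admissible \<rho> F \<Longrightarrow> continuous_on ({0..(\<rho> - \<delta>)} \<times> {\<alpha>..\<beta>}) (\<lambda>(l, t). m (\<lambda>r. F (r + l)) t)"
  assumes m_wave: "\<And>\<theta> F. \<lbrakk>smooth_on UNIV \<theta>; \<And>t. t \<notin> {\<alpha>..\<beta>} \<Longrightarrow> \<theta> t = 0; admissible \<rho> F\<rbrakk> \<Longrightarrow>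
      integral {\<alpha>..\<beta>} (\<lambda>t. deriv (deriv \<theta>) t * m F t) = integral {\<alpha>..\<beta>} (\<lambda>t. \<theta> t * m (deriv (deriv F)) t)"
  assumes m_zero: "\<And>F t. \<lbrakk>admissible \<rho> F; \<And>r. r \<ge> \<delta> \<Longrightarrow> F r = 0; t \<in> {\<alpha>..\<beta>}\<rbrakk> \<Longrightarrow> m F t = 0"
begin

definition "E \<theta> F = integral {\<alpha>..\<beta>} (\<lambda>t. \<theta> t * m F t)"

lemma admissible_deriv: "admissible \<rho> F \<Longrightarrow> admissible \<rho> (deriv F)"
  unfolding admissible_def using deriv_zero_right smooth_on_deriv by blast

lemma admissible_shift: "admissible \<rho> F \<Longrightarrow> l \<ge> 0 \<Longrightarrow> admissible \<rho> (\<lambda>r. F (r + l))"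
  unfolding admissible_def by (auto intro: smooth_on_shift)

lemma m_cont_shift:
  assumes "admissible \<rho> F" "l \<in> {0..(\<rho> - \<delta>)}"
  shows "continuous_on {\<alpha>..\<beta>} (m (\<lambda>r. F (r + l)))"
proof -
  have "continuous_on {\<alpha>..\<beta>} (\<lambda>t. case (l, t) of (l, t) \<Rightarrow> m (\<lambda>r. F (r + l)) t)"
    by (rule continuous_on_compose2[OF m_cont[OF assms(1)]]) (use assms in \<open>auto intro!: continuous_intros\<close>)
  then show ?thesis by simp
qed

text \<open>The profile and the time weight are translated together; \<open>k = -1\<close> and
  \<open>k = 1\<close> are the two characteristic directions of the one-dimensional wave
  operator.\<close>

lemma E_deriv:
  assumes \<theta>: "smooth_on UNIV \<theta>" and F: "admissible \<rho> F" and l: "l \<in> {0..(\<rho> - \<delta>)}"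
  shows "((\<lambda>l. E (\<lambda>t. \<theta> (t + k * l)) (\<lambda>r. F (r + l))) has_real_derivative
     (k * E (\<lambda>t. deriv \<theta> (t + k * l)) (\<lambda>r. F (r + l)) + E (\<lambda>t. \<theta> (t + k * l)) (\<lambda>r. deriv F (r + l))))
     (at l within {0..(\<rho> - \<delta>)})"
proof -
  let ?fx = "\<lambda>l t. k * (deriv \<theta> (t + k * l) * m (\<lambda>r. F (r + l)) t) + \<theta> (t + k * l) * m (\<lambda>r. deriv F (r + l)) t"
  have c\<theta>: "continuous_on A (\<lambda>x. \<theta> (h x))" "continuous_on A (\<lambda>x. deriv \<theta> (h x))"
    if "continuous_on A h" for A :: "'x::topological_space set" and h
    using that smooth_on_continuous_on[OF \<theta>] smooth_on_continuous_on[OF smooth_on_deriv[OF open_UNIV \<theta>]]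
    by (auto intro: continuous_on_compose2)
  have cm: "continuous_on {\<alpha>..\<beta>} (m (\<lambda>r. F (r + l)))" "continuous_on {\<alpha>..\<beta>} (m (\<lambda>r. deriv F (r + l)))"
    if "l \<in> {0..(\<rho> - \<delta>)}" for l
    using m_cont_shift F admissible_deriv that by auto
  have cm2: "continuous_on ({0..(\<rho> - \<delta>)} \<times> {\<alpha>..\<beta>}) (\<lambda>x. m (\<lambda>r. F (r + fst x)) (snd x))"
    "continuous_on ({0..(\<rho> - \<delta>)} \<times> {\<alpha>..\<beta>}) (\<lambda>x. m (\<lambda>r. deriv F (r + fst x)) (snd x))"
    using m_cont[OF F] m_cont[OF admissible_deriv[OF F]] by (simp_all add: case_prod_unfold)
  have "((\<lambda>l. integral (cbox \<alpha> \<beta>) (\<lambda>t. \<theta> (t + k * l) * m (\<lambda>r. F (r + l)) t)) has_real_derivative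
      integral (cbox \<alpha> \<beta>) (?fx l)) (at l within {0..(\<rho> - \<delta>)})"
  proof (rule leibniz_rule_field_derivative)
    fix l t assume l: "l \<in> {0..(\<rho> - \<delta>)}" and t: "t \<in> cbox \<alpha> \<beta>"
    have d: "((\<lambda>l. \<theta> (t + k * l)) has_real_derivative deriv \<theta> (t + k * l) * k) (at l within {0..(\<rho> - \<delta>)})"
      by (rule DERIV_chain'[OF _ smooth_on_has_real_derivative[OF \<theta>]]) (auto intro!: derivative_eq_intros)
    show "((\<lambda>l. \<theta> (t + k * l) * m (\<lambda>r. F (r + l)) t) has_real_derivative ?fx l t) (at l within {0..(\<rho> - \<delta>)})"
      using DERIV_mult[OF d m_deriv[OF F _ l, of t]] t by (auto simp: algebra_simps)
  next
    fix l assume "l \<in> {0..(\<rho> - \<delta>)}"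
    then show "(\<lambda>t. \<theta> (t + k * l) * m (\<lambda>r. F (r + l)) t) integrable_on cbox \<alpha> \<beta>"
      by (intro integrable_continuous) (auto intro!: continuous_intros c\<theta> cm simp: cbox_interval)
  next
    show "continuous_on ({0..(\<rho> - \<delta>)} \<times> cbox \<alpha> \<beta>) (\<lambda>(l, t). ?fx l t)"
      unfolding case_prod_unfold cbox_interval
      by (intro continuous_intros c\<theta> cm2)
  qed (use l in auto)
  moreover have "integral (cbox \<alpha> \<beta>) (?fx l) =
      integral (cbox \<alpha> \<beta>) (\<lambda>t. k * (deriv \<theta> (t + k * l) * m (\<lambda>r. F (r + l)) t)) + integral (cbox \<alpha> \<beta>) (\<lambda>t. \<theta> (t + k * l) * m (\<lambda>r. deriv F (r + l)) t)"
    by (intro integral_add integrable_continuous) (auto intro!: continuous_intros c\<theta> cm l simp: cbox_interval)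
  ultimately show ?thesis
    unfolding E_def by simp
qed

lemma E_at_end: 
  assumes "admissible \<rho> F"
  shows "E \<theta> (\<lambda>r. F (r + (\<rho> - \<delta>))) = 0"
proof -
  have "m (\<lambda>r. F (r + (\<rho> - \<delta>))) t = 0" if "t \<in> {\<alpha>..\<beta>}" for t
    using assms le that by (intro m_zero admissible_shift) (auto simp: admissible_def)
  then have "E \<theta> (\<lambda>r. F (r + (\<rho> - \<delta>))) = integral {\<alpha>..\<beta>} (\<lambda>_. 0)"
    unfolding E_def by (intro integral_cong) simp
  then show ?thesis by simp
qed

lemma const_zero:
  assumes "\<And>l. l \<in> {0..(\<rho> - \<delta>)} \<Longrightarrow> (h has_real_derivative 0) (at l within {0..(\<rho> - \<delta>)})" "h (\<rho> - \<delta>) = 0"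
  shows "h 0 = 0"
proof -
  obtain c where "\<forall>x\<in>{0..(\<rho> - \<delta>)}. h x = c"
    using has_field_derivative_zero_constant[of "{0..(\<rho> - \<delta>)}" h] assms(1) by auto
  then show ?thesis using assms(2) le by force
qed

text \<open>The first half of the factorisation of the wave operator into two transport operators.
  Along \<open>k = -1\<close> the mixed terms cancel and the two second-order terms cancel by
  \<open>m_wave\<close>; the quantity is constant in \<open>l\<close>, and it is zero at the end of
  the range.\<close>

lemma E_first_order:
  assumes \<theta>: "smooth_on UNIV \<theta>" and s: "\<And>t. t \<notin> {\<alpha>..\<beta> - (\<rho> - \<delta>)} \<Longrightarrow> \<theta> t = 0" and F: "admissible \<rho> F"
  shows "E (deriv \<theta>) F + E \<theta> (deriv F) = 0"
proof -
  let ?A = "\<lambda>l. E (\<lambda>t. deriv \<theta> (t + (-1) * l)) (\<lambda>r. F (r + l)) + E (\<lambda>t. \<theta> (t + (-1) * l)) (\<lambda>r. deriv F (r + l))"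
  have "?A 0 = 0"
  proof (rule const_zero)
    fix l assume l: "l \<in> {0..(\<rho> - \<delta>)}"
    have \<theta>': "smooth_on UNIV (deriv \<theta>)" using \<theta> smooth_on_deriv by blast
    have "(?A has_real_derivative (-1 * E (\<lambda>t. deriv (deriv \<theta>) (t + -1 * l)) (\<lambda>r. F (r + l)) +
         E (\<lambda>t. deriv \<theta> (t + -1 * l)) (\<lambda>r. deriv F (r + l))) +
        (-1 * E (\<lambda>t. deriv \<theta> (t + -1 * l)) (\<lambda>r. deriv F (r + l)) +
         E (\<lambda>t. \<theta> (t + -1 * l)) (\<lambda>r. deriv (deriv F) (r + l)))) (at l within {0..(\<rho> - \<delta>)})"
      by (rule DERIV_add[OF E_deriv[OF \<theta>' F l] E_deriv[OF \<theta> admissible_deriv[OF F] l]])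
    moreover have "E (\<lambda>t. deriv (deriv \<theta>) (t + -1 * l)) (\<lambda>r. F (r + l)) = E (\<lambda>t. \<theta> (t + -1 * l)) (\<lambda>r. deriv (deriv F) (r + l))"
    proof -
      have "deriv (deriv (\<lambda>t. \<theta> (t + -1 * l))) = (\<lambda>t. deriv (deriv \<theta>) (t + -1 * l))"
        using deriv_shift[OF \<theta>] deriv_shift[OF \<theta>'] by metis
      moreover have "deriv (deriv (\<lambda>r. F (r + l))) = (\<lambda>r. deriv (deriv F) (r + l))"
        using F admissible_deriv[OF F] deriv_shift unfolding admissible_def by metis
      \<comment> \<open>The support moves to the right by at most \<open>\<rho> - \<delta>\<close>,
        which is the room left at the upper end of the time interval.\<close>
      moreover have "\<theta> (t + -1 * l) = 0" if "t \<notin> {\<alpha>..\<beta>}" for t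
        by (rule s) (use that l in auto)
      ultimately show ?thesis
        unfolding E_def using m_wave[OF smooth_on_shift[OF \<theta>, of "-1 * l"] _ admissible_shift[OF F, of l]] l by auto
    qed
    ultimately show "(?A has_real_derivative 0) (at l within {0..(\<rho> - \<delta>)})" by simp
  qed (simp add: E_at_end F admissible_deriv del: mult_minus1)
  then show ?thesis by simp
qed

text \<open>The second half of the factorisation: along \<open>k = 1\<close> the derivative is
  exactly the first-order expression that \<open>E_first_order\<close> annihilates. The loss of
  \<open>\<rho> - \<delta>\<close> at both ends of the time interval is the domain of dependence at
  speed one.\<close>

theorem wave_1d_unique:
  assumes \<theta>: "smooth_on UNIV \<theta>" and s: "\<And>t. t \<notin> {\<alpha> + (\<rho> - \<delta>)..\<beta> - (\<rho> - \<delta>)} \<Longrightarrow> \<theta> t = 0" and F: "admissible \<rho> F"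
  shows "integral {\<alpha>..\<beta>} (\<lambda>t. \<theta> t * m F t) = 0"
proof -
  let ?C = "\<lambda>l. E (\<lambda>t. \<theta> (t + 1 * l)) (\<lambda>r. F (r + l))"
  have "?C 0 = 0"
  proof (rule const_zero)
    fix l assume l: "l \<in> {0..(\<rho> - \<delta>)}"
    \<comment> \<open>Moving to the left consumes the room at the lower end and preserves the gap at
      the upper end that \<open>E_first_order\<close> requires.\<close>
    have "\<theta> (t + 1 * l) = 0" if "t \<notin> {\<alpha>..\<beta> - (\<rho> - \<delta>)}" for t
      by (rule s) (use that l in auto)
    then have "E (\<lambda>t. deriv \<theta> (t + 1 * l)) (\<lambda>r. F (r + l)) + E (\<lambda>t. \<theta> (t + 1 * l)) (\<lambda>r. deriv F (r + l)) = 0"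
      using E_first_order[OF smooth_on_shift[OF \<theta>, of "1 * l"] _ admissible_shift[OF F, of l]] l F
      by (auto simp: deriv_shift \<theta> admissible_def)
    with E_deriv[OF \<theta> F l, of 1]
    show "(?C has_real_derivative 0) (at l within {0..(\<rho> - \<delta>)})" by simp
  qed (simp add: E_at_end F)
  then show ?thesis by (simp add: E_def)
qed

end

section \<open>Integrals\<close>

lemma bounded_mult_integrable:
  fixes v h :: "'x \<Rightarrow> real"
  assumes "integrable M v" "h \<in> borel_measurable M" "\<And>x. x \<in> space M \<Longrightarrow> \<bar>h x\<bar> \<le> C"
  shows "integrable M (\<lambda>x. v x * h x)"
proof (rule Bochner_Integration.integrable_bound[of M "\<lambda>x. C * v x"])
  show "AE x in M. norm (v x * h x) \<le> norm (C * v x)"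
  proof (rule AE_I2)
    fix x assume "x \<in> space M"
    then have "\<bar>h x\<bar> \<le> \<bar>C\<bar>" using assms(3) by fastforce
    then show "norm (v x * h x) \<le> norm (C * v x)"
      by (simp add: abs_mult mult.commute[of "\<bar>v x\<bar>"] mult_right_mono)
  qed
qed (use assms in auto)

lemma abs_integral_mult_le:
  fixes v h :: "'x \<Rightarrow> real"
  assumes "integrable M v" "h \<in> borel_measurable M" "\<And>x. x \<in> space M \<Longrightarrow> \<bar>h x\<bar> \<le> C"
  shows "\<bar>LINT x|M. v x * h x\<bar> \<le> C * (LINT x|M. \<bar>v x\<bar>)"
proof -
  have "\<bar>LINT x|M. v x * h x\<bar> \<le> (LINT x|M. \<bar>v x * h x\<bar>)" by (rule integral_abs_bound)
  also have "\<dots> \<le> (LINT x|M. C * \<bar>v x\<bar>)"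
  proof (rule integral_mono)
    show "integrable M (\<lambda>x. \<bar>v x * h x\<bar>)" using bounded_mult_integrable[OF assms] by simp
    fix x assume "x \<in> space M"
    then show "\<bar>v x * h x\<bar> \<le> C * \<bar>v x\<bar>"
      using assms(3) by (simp add: abs_mult mult.commute[of "\<bar>v x\<bar>"] mult_right_mono)
  qed (use assms in auto)
  finally show ?thesis by simp
qed

text \<open>Dominated convergence along sequences: the bound on the derivative also bounds all
  difference quotients, so \<open>C * \<bar>v x\<bar>\<close> dominates and \<open>v\<close> need
  only be integrable.\<close>

lemma integral_has_real_derivative:
  fixes v :: "'x \<Rightarrow> real" and h :: "real \<Rightarrow> 'x \<Rightarrow> real"
  assumes v: "integrable M v" and U: "convex U" "l \<in> U"
    and m: "\<And>l. l \<in> U \<Longrightarrow> h l \<in> borel_measurable M" and m': "h' l \<in> borel_measurable M"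
    and b: "\<And>l x. l \<in> U \<Longrightarrow> x \<in> space M \<Longrightarrow> \<bar>h l x\<bar> \<le> C"
    and d: "\<And>l x. l \<in> U \<Longrightarrow> x \<in> space M \<Longrightarrow> ((\<lambda>l. h l x) has_real_derivative h' l x) (at l within U)"
    and b': "\<And>l x. l \<in> U \<Longrightarrow> x \<in> space M \<Longrightarrow> \<bar>h' l x\<bar> \<le> C"
  shows "((\<lambda>l. LINT x|M. v x * h l x) has_real_derivative (LINT x|M. v x * h' l x)) (at l within U)"
  unfolding has_field_derivative_iff tendsto_at_iff_sequentially
proof (intro allI impI)
  fix X :: "nat \<Rightarrow> real" assume X: "\<forall>i. X i \<in> U - {l}" and lim: "X \<longlonglongrightarrow> l"
  have int: "integrable M (\<lambda>x. v x * h k x)" if "k \<in> U" for k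
    by (rule bounded_mult_integrable[OF v m[OF that] b[OF that]])
  have "(\<lambda>i. LINT x|M. v x * ((h (X i) x - h l x) / (X i - l))) \<longlonglongrightarrow> (LINT x|M. v x * h' l x)"
  proof (rule integral_dominated_convergence[where w = "\<lambda>x. C * \<bar>v x\<bar>"])
    show "(\<lambda>x. v x * h' l x) \<in> borel_measurable M" using v m' by auto
    show "(\<lambda>x. v x * ((h (X i) x - h l x) / (X i - l))) \<in> borel_measurable M" for i
      using v m[of "X i"] m[of l] X U by auto
    show "integrable M (\<lambda>x. C * \<bar>v x\<bar>)" using v by auto
    show "AE x in M. (\<lambda>i. v x * ((h (X i) x - h l x) / (X i - l))) \<longlonglongrightarrow> v x * h' l x"
    proof (rule AE_I2)
      fix x assume "x \<in> space M"
      then have "((\<lambda>y. (h y x - h l x) / (y - l)) \<longlongrightarrow> h' l x) (at l within U)"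
        using d[OF U(2)] by (simp add: has_field_derivative_iff)
      then have "(\<lambda>i. (h (X i) x - h l x) / (X i - l)) \<longlonglongrightarrow> h' l x"
        using X lim unfolding tendsto_at_iff_sequentially by (auto simp: comp_def)
      then show "(\<lambda>i. v x * ((h (X i) x - h l x) / (X i - l))) \<longlonglongrightarrow> v x * h' l x" by (intro tendsto_intros)
    qed
    show "AE x in M. norm (v x * ((h (X i) x - h l x) / (X i - l))) \<le> C * \<bar>v x\<bar>" for i
    proof (rule AE_I2)
      fix x assume x: "x \<in> space M"
      \<comment> \<open>The mean value inequality on the convex set \<open>U\<close>.\<close>
      have "norm (h (X i) x - h l x) \<le> C * norm (X i - l)"
        by (rule field_differentiable_bound[OF U(1) d[OF _ x]]) (use b' x X U in auto)
      then have "\<bar>(h (X i) x - h l x) / (X i - l)\<bar> \<le> C"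
        using X by (simp add: abs_divide divide_le_eq)
      then show "norm (v x * ((h (X i) x - h l x) / (X i - l))) \<le> C * \<bar>v x\<bar>"
        unfolding real_norm_def abs_mult by (subst mult.commute) (rule mult_right_mono, auto)
    qed
  qed
  moreover have eq: "(LINT x|M. v x * ((h (X i) x - h l x) / (X i - l)))
      = ((LINT x|M. v x * h (X i) x) - (LINT x|M. v x * h l x)) / (X i - l)" for i
  proof -
    have "(LINT x|M. v x * ((h (X i) x - h l x) / (X i - l))) = (LINT x|M. (v x * h (X i) x - v x * h l x) / (X i - l))"
      by (intro Bochner_Integration.integral_cong) (auto simp: right_diff_distrib diff_divide_distrib)
    then show ?thesis using int[of "X i"] int[OF U(2)] X by simp
  qed
  ultimately show "((\<lambda>y. ((LINT x|M. v x * h y x) - (LINT x|M. v x * h l x)) / (y - l)) \<circ> X) \<longlonglongrightarrow> (LINT x|M. v x * h' l x)"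
    by (simp only: comp_def eq)
qed

lemma finite_measure_lebesgue_on_bounded:
  fixes S :: "'a::euclidean_space set"
  assumes "bounded S" "S \<in> sets lebesgue" shows "finite_measure (lebesgue_on S)"
proof (rule finite_measureI)
  have "S \<in> lmeasurable" using assms by (rule bounded_set_imp_lmeasurable)
  then have "emeasure lebesgue S \<noteq> \<infinity>" using fmeasurableD2[of S lebesgue] by simp
  then show "emeasure (lebesgue_on S) (space (lebesgue_on S)) \<noteq> \<infinity>"
    using assms by (simp add: emeasure_restrict_space)
qed

lemma continuous_on_imp_measurable_lebesgue_on:
  fixes f :: "'a::euclidean_space \<Rightarrow> real"
  assumes "continuous_on UNIV f" shows "f \<in> borel_measurable (lebesgue_on S)"
  using borel_measurable_continuous_onI[OF assms]
  by (intro measurable_restrict_space1) (simp add: measurable_completion)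

lemma continuous_bounded_on_bounded:
  fixes f :: "'a::euclidean_space \<Rightarrow> real"
  assumes "continuous_on UNIV f" "bounded S"
  obtains C where "C \<ge> 0" "\<And>x. x \<in> S \<Longrightarrow> \<bar>f x\<bar> \<le> C"
proof -
  have "compact (f ` closure S)"
    using assms by (intro compact_continuous_image) (auto intro: continuous_on_subset)
  then obtain C where "\<forall>y\<in>f ` closure S. norm y \<le> C" using compact_imp_bounded bounded_iff by metis
  then have "\<And>x. x \<in> S \<Longrightarrow> \<bar>f x\<bar> \<le> max 0 C" using closure_subset by fastforce
  then show ?thesis using that[of "max 0 C"] by simp
qed

lemma mult_continuous_integrable:
  fixes v f :: "'a::euclidean_space \<Rightarrow> real"
  assumes "integrable (lebesgue_on S) v" "bounded S" "continuous_on UNIV f"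
  shows "integrable (lebesgue_on S) (\<lambda>x. v x * f x)"
proof -
  obtain C where "\<And>x. x \<in> S \<Longrightarrow> \<bar>f x\<bar> \<le> C"
    by (rule continuous_bounded_on_bounded[OF assms(3,2)]) blast
  then show ?thesis
    by (intro bounded_mult_integrable[OF assms(1) continuous_on_imp_measurable_lebesgue_on[OF assms(3)], of C]) simp
qed

section \<open>Polynomial moments\<close>

text \<open>Stone-Weierstrass on the compact closure of \<open>S\<close>: uniform approximation
  suffices, because \<open>v\<close> is integrable.\<close>

lemma poly_moments_continuous:
  fixes v :: "'a::euclidean_space \<Rightarrow> real"
  assumes S: "bounded S" and v: "integrable (lebesgue_on S) v"
    and p: "\<And>p. real_polynomial_function p \<Longrightarrow> (LINT x|lebesgue_on S. v x * p x) = 0"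
    and f: "continuous_on UNIV f"
  shows "(LINT x|lebesgue_on S. v x * f x) = 0"
proof -
  let ?M = "lebesgue_on S"
  have "\<bar>LINT x|?M. v x * f x\<bar> \<le> 0 + e" if "e > 0" for e
  proof -
    let ?c = "(LINT x|?M. \<bar>v x\<bar>)"
    have c: "?c \<ge> 0" by simp
    \<comment> \<open>The summand 1 covers the case in which the integral of the absolute value of
      \<open>v\<close> is zero.\<close>
    define d where "d = e / (?c + 1)"
    have "d > 0" using that c unfolding d_def by (intro divide_pos_pos) linarith+
    moreover have "d * (?c + 1) = e" using c unfolding d_def by (metis add_nonneg_eq_0_iff nonzero_divide_eq_eq zero_le_one zero_neq_one)
    ultimately have d: "d > 0" "d * ?c \<le> e" by (auto simp: distrib_left)
    obtain g where g: "real_polynomial_function g" "\<And>x. x \<in> closure S \<Longrightarrow> \<bar>f x - g x\<bar> < d"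
      using Stone_Weierstrass_real_polynomial_function[of "closure S" f d] S f d(1)
      by (metis compact_closure continuous_on_subset subset_UNIV)
    have cg: "continuous_on UNIV g"
      using g(1) by (metis continuous_on_polymonial_function real_polynomial_function_eq)
    have "integrable ?M (\<lambda>x. v x * (f x - g x))" "integrable ?M (\<lambda>x. v x * g x)"
      by (intro mult_continuous_integrable v S continuous_intros f cg)+
    from Bochner_Integration.integral_add[OF this]
    have "(LINT x|?M. v x * f x) = (LINT x|?M. v x * (f x - g x)) + (LINT x|?M. v x * g x)"
      by (simp add: algebra_simps)
    also have "\<dots> = (LINT x|?M. v x * (f x - g x))" using p[OF g(1)] by simp
    finally have eq: "(LINT x|?M. v x * f x) = (LINT x|?M. v x * (f x - g x))" .
    have "\<bar>LINT x|?M. v x * (f x - g x)\<bar> \<le> d * ?c"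
    proof (rule abs_integral_mult_le[OF v])
      show "(\<lambda>x. f x - g x) \<in> borel_measurable ?M"
        by (intro continuous_on_imp_measurable_lebesgue_on continuous_intros f cg)
      fix x assume "x \<in> space ?M"
      then have "x \<in> closure S" using closure_subset by auto
      then show "\<bar>f x - g x\<bar> \<le> d" by (rule less_imp_le[OF g(2)])
    qed
    then have "\<bar>LINT x|?M. v x * f x\<bar> \<le> d * ?c" unfolding eq .
    with d show ?thesis by simp
  qed
  then have "\<bar>LINT x|?M. v x * f x\<bar> \<le> 0" by (rule field_le_epsilon)
  then show ?thesis by simp
qed

text \<open>The indicator of a closed set is the pointwise limit of the continuous functions
  \<open>max 0 (1 - real n * infdist x K)\<close>, all between 0 and 1.\<close>

lemma poly_moments_closed:
  fixes v :: "'a::euclidean_space \<Rightarrow> real"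
  assumes S: "bounded S" and v: "integrable (lebesgue_on S) v"
    and p: "\<And>p. real_polynomial_function p \<Longrightarrow> (LINT x|lebesgue_on S. v x * p x) = 0"
    and K: "closed K"
  shows "(LINT x|lebesgue_on S. v x * indicator K x) = 0"
proof (cases "K = {}")
  case False
  let ?f = "\<lambda>n x. max 0 (1 - real n * infdist x K)"
  have c: "continuous_on UNIV (?f n)" for n by (intro continuous_intros)
  have "(\<lambda>n. LINT x|lebesgue_on S. v x * ?f n x) \<longlonglongrightarrow> (LINT x|lebesgue_on S. v x * indicator K x)"
  proof (rule integral_dominated_convergence[where w = "\<lambda>x. \<bar>v x\<bar>"])
    have "(indicator K :: 'a \<Rightarrow> real) \<in> borel_measurable lebesgue"
      using K by (intro borel_measurable_indicator) auto
    then have "(indicator K :: 'a \<Rightarrow> real) \<in> borel_measurable (lebesgue_on S)" by (rule measurable_restrict_space1)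
    then show "(\<lambda>x. v x * indicator K x) \<in> borel_measurable (lebesgue_on S)" using v by auto
    show "(\<lambda>x. v x * ?f n x) \<in> borel_measurable (lebesgue_on S)" for n
      using v continuous_on_imp_measurable_lebesgue_on[OF c] by (intro borel_measurable_times) auto
    show "AE x in lebesgue_on S. (\<lambda>n. v x * ?f n x) \<longlonglongrightarrow> v x * indicator K x"
    proof (rule AE_I2)
      fix x
      have "(\<lambda>n. ?f n x) \<longlonglongrightarrow> indicator K x"
      proof (cases "x \<in> K")
        case True then show ?thesis by simp
      next
        case False
        then have pos: "infdist x K > 0"
          using K \<open>K \<noteq> {}\<close> by (metis in_closed_iff_infdist_zero infdist_nonneg less_eq_real_def)
        obtain n0 where n0: "1 < real n0 * infdist x K" using reals_Archimedean3[OF pos] by blast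
        have "?f n x = 0" if "n \<ge> n0" for n
        proof -
          have "real n0 * infdist x K \<le> real n * infdist x K" using that pos by (intro mult_right_mono) auto
          with n0 show ?thesis by simp
        qed
        then have "eventually (\<lambda>n. ?f n x = indicator K x) sequentially"
          using False eventually_sequentially by auto
        then show ?thesis by (rule tendsto_eventually)
      qed
      then show "(\<lambda>n. v x * ?f n x) \<longlonglongrightarrow> v x * indicator K x" by (intro tendsto_intros)
    qed
    show "AE x in lebesgue_on S. norm (v x * ?f n x) \<le> \<bar>v x\<bar>" for n
    proof (rule AE_I2)
      fix x
      have "\<bar>?f n x\<bar> \<le> 1" by (auto simp: infdist_nonneg)
      then show "norm (v x * ?f n x) \<le> \<bar>v x\<bar>"
        unfolding real_norm_def abs_mult using mult_left_le[of "\<bar>?f n x\<bar>" "\<bar>v x\<bar>"] by simp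
    qed
  qed (use v in auto)
  moreover have "(LINT x|lebesgue_on S. v x * ?f n x) = 0" for n
    by (rule poly_moments_continuous[OF S v p c])
  ultimately have "(\<lambda>n. 0) \<longlonglongrightarrow> (LINT x|lebesgue_on S. v x * indicator K x)" by simp
  then show ?thesis by (simp add: LIMSEQ_const_iff)
qed simp

text \<open>Inner regularity: if \<open>v > 0\<close> held on a set of positive measure, this set
  would contain a closed set of positive measure, over which the integral of \<open>v\<close> is
  both positive and zero.\<close>

lemma poly_moments_nonpos:
  fixes v :: "'a::euclidean_space \<Rightarrow> real"
  assumes S: "bounded S" "S \<in> sets lebesgue" and v: "integrable (lebesgue_on S) v"
    and p: "\<And>p. real_polynomial_function p \<Longrightarrow> (LINT x|lebesgue_on S. v x * p x) = 0"
  shows "AE x in lebesgue_on S. v x \<le> 0"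
proof -
  define A where "A = {x \<in> space (lebesgue_on S). v x > 0}"
  have "A \<in> sets (lebesgue_on S)"
    using borel_measurable_integrable[OF v] unfolding borel_measurable_iff_greater A_def by blast
  moreover have "S \<inter> space lebesgue \<in> sets lebesgue" using S by simp
  ultimately have A: "A \<in> sets lebesgue" "A \<subseteq> S" using sets_restrict_space_iff[of S lebesgue A] by simp_all
  have "emeasure lebesgue A = 0"
  proof (rule ccontr)
    assume ne: "emeasure lebesgue A \<noteq> 0"
    have fin: "A \<in> lmeasurable"
      by (rule bounded_set_imp_lmeasurable[OF bounded_subset[OF S(1) A(2)] A(1)])
    have mA: "measure lebesgue A > 0"
    proof -
      have "measure lebesgue A \<noteq> 0" using ne emeasure_eq_measure2[OF fin] by auto
      then show ?thesis using measure_nonneg[of lebesgue A] by linarith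
    qed
    obtain K where K: "closed K" "K \<subseteq> A" "A - K \<in> lmeasurable" "emeasure lebesgue (A - K) < ennreal (measure lebesgue A)"
      by (rule sets_lebesgue_inner_closed[OF A(1) mA])
    have Ks: "K \<in> sets lebesgue" using K by auto
    have "emeasure lebesgue K \<noteq> 0"
    proof
      assume "emeasure lebesgue K = 0"
      then have "emeasure lebesgue A = emeasure lebesgue (A - K)"
        by (intro emeasure_Diff_null_set[symmetric] null_setsI Ks A(1))
      then show False using K(4) emeasure_eq_measure2[OF fin] by simp
    qed
    have KS: "K \<subseteq> S" using K A by auto
    have ind: "integrable (lebesgue_on S) (\<lambda>x. v x * indicator K x)"
    proof (rule integrable_real_mult_indicator[OF _ v])
      have "S \<inter> space lebesgue \<in> sets lebesgue" using S by simp
      from sets_restrict_space_iff[OF this, of K] show "K \<in> sets (lebesgue_on S)" using Ks KS by simp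
    qed
    have "AE x in lebesgue_on S. 0 \<le> v x * indicator K x"
      using K(2) by (intro AE_I2) (auto simp: A_def indicator_def)
    then have "AE x in lebesgue_on S. v x * indicator K x = 0"
      using integral_nonneg_eq_0_iff_AE[OF ind] poly_moments_closed[OF S(1) v p K(1)] by blast
    moreover have "x \<notin> K" if "v x * indicator K x = 0" for x
      using that K(2) by (auto simp: A_def)
    ultimately have "AE x in lebesgue_on S. x \<notin> K" by (rule eventually_mono)
    then have "AE x in lebesgue. x \<in> S \<longrightarrow> x \<notin> K"
      using S by (subst (asm) AE_restrict_space_iff) auto
    then have "AE x in lebesgue. x \<notin> K"
      by (rule eventually_mono) (use KS in blast)
    then have "emeasure lebesgue K = 0" using AE_iff_measurable[OF Ks, of "\<lambda>x. x \<notin> K"] by simp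
    with \<open>emeasure lebesgue K \<noteq> 0\<close> show False by simp
  qed
  then have "AE x in lebesgue. x \<notin> A" using A by (intro AE_not_in null_setsI)
  then have "AE x in lebesgue. x \<in> S \<longrightarrow> x \<notin> A" by eventually_elim simp
  then have nA: "AE x in lebesgue_on S. x \<notin> A"
    using S by (subst AE_restrict_space_iff) auto
  have imp: "v x \<le> 0" if "x \<in> space (lebesgue_on S)" "x \<notin> A" for x
  proof (rule ccontr)
    assume "\<not> v x \<le> 0"
    then have "v x > 0" by (rule not_le_imp_less)
    with that(1) have "x \<in> A" unfolding A_def by (intro CollectI conjI)
    with that(2) show False by (rule notE)
  qed
  show ?thesis by (rule AE_mp[OF nA], rule AE_I2, rule impI, rule imp)
qed

lemma poly_moments_zero:
  fixes v :: "'a::euclidean_space \<Rightarrow> real"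
  assumes S: "bounded S" "S \<in> sets lebesgue" and v: "integrable (lebesgue_on S) v"
    and p: "\<And>p. real_polynomial_function p \<Longrightarrow> (LINT x|lebesgue_on S. v x * p x) = 0"
  shows "AE x in lebesgue_on S. v x = 0"
proof -
  have "AE x in lebesgue_on S. v x \<le> 0"
    by (rule poly_moments_nonpos[OF S v]) (rule p)
  moreover have "AE x in lebesgue_on S. - v x \<le> 0"
  proof (rule poly_moments_nonpos[OF S])
    show "integrable (lebesgue_on S) (\<lambda>x. - v x)" using v by simp
    show "(LINT x|lebesgue_on S. - v x * p x) = 0" if "real_polynomial_function p" for p
      using p[OF that] by simp
  qed
  ultimately show ?thesis by eventually_elim simp
qed

text \<open>Lindelof: countably many of the balls cover the domain, so their exceptional null sets
  add up to a null set.\<close>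

lemma AE_lebesgue_on_locally:
  fixes \<Omega> :: "'a::euclidean_space set"
  assumes "open \<Omega>" "\<And>y. y \<in> \<Omega> \<Longrightarrow> \<exists>r>0. AE x in lebesgue_on \<Omega>. x \<in> ball y r \<longrightarrow> P x"
  shows "AE x in lebesgue_on \<Omega>. P x"
proof -
  obtain r where r: "\<And>y. y \<in> \<Omega> \<Longrightarrow> r y > 0" "\<And>y. y \<in> \<Omega> \<Longrightarrow> AE x in lebesgue_on \<Omega>. x \<in> ball y (r y) \<longrightarrow> P x"
    using assms(2) by metis
  obtain \<F> where \<F>: "\<F> \<subseteq> (\<lambda>y. ball y (r y)) ` \<Omega>" "countable \<F>" "\<Union>\<F> = \<Union>((\<lambda>y. ball y (r y)) ` \<Omega>)"
    by (rule Lindelof[of "(\<lambda>y. ball y (r y)) ` \<Omega>"]) auto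
  have "AE x in lebesgue_on \<Omega>. \<forall>B\<in>\<F>. x \<in> B \<longrightarrow> P x"
    using \<F> r(2) by (subst AE_ball_countable) auto
  then show ?thesis
  proof (rule AE_mp, intro AE_I2 impI)
    fix x assume "x \<in> space (lebesgue_on \<Omega>)" and *: "\<forall>B\<in>\<F>. x \<in> B \<longrightarrow> P x"
    then have "x \<in> \<Omega>" by simp
    then have "x \<in> \<Union>\<F>" using r(1) \<F>(3) by force
    with * show "P x" by blast
  qed
qed

lemma smooth_on_real_polynomial_function: "real_polynomial_function p \<Longrightarrow> smooth_on UNIV p"
  by (induction p rule: real_polynomial_function.induct)
     (auto intro: smooth_on_linear smooth_on_add smooth_on_mult)

lemma smooth_on_flat_diff: "smooth_on UNIV (\<lambda>\<sigma>. flat (c - \<sigma>))"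
  by (rule smooth_on_compose_UNIV[OF smooth_on_flat]) (auto intro: smooth_on_diff)

lemma continuous_on_rad: "smooth_on UNIV f \<Longrightarrow> continuous_on A (rad y f)"
  by (rule smooth_on_continuous_on_UNIV[OF smooth_on_rad])

lemma test_functions_smooth: "\<phi> \<in> test_functions U \<Longrightarrow> smooth_on UNIV \<phi>"
  by (simp add: test_functions_def)

text \<open>A radial bump that is positive on a ball, times any polynomial, is a test function.
  Hence all polynomial moments of \<open>v\<close> times the bump vanish, and no mollification is
  required.\<close>

theorem fundamental_lemma:
  fixes v :: "'a::euclidean_space \<Rightarrow> real"
  assumes "open \<Omega>" "bounded \<Omega>" and v: "integrable (lebesgue_on \<Omega>) v"
    and z: "\<And>\<phi>. \<phi> \<in> test_functions \<Omega> \<Longrightarrow> (LINT x|lebesgue_on \<Omega>. v x * \<phi> x) = 0"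
  shows "AE x in lebesgue_on \<Omega>. v x = 0"
proof (rule AE_lebesgue_on_locally[OF assms(1)])
  fix y assume "y \<in> \<Omega>"
  then obtain r where r: "r > 0" "cball y r \<subseteq> \<Omega>" using assms(1) open_contains_cball by blast
  let ?f = "\<lambda>\<sigma>. flat (r\<^sup>2 - \<sigma>)"
  have f: "smooth_on UNIV ?f" by (rule smooth_on_flat_diff)
  have "AE x in lebesgue_on \<Omega>. v x * rad y ?f x = 0"
  proof (rule poly_moments_zero[OF assms(2)])
    show "\<Omega> \<in> sets lebesgue" using assms(1) by auto
    show "integrable (lebesgue_on \<Omega>) (\<lambda>x. v x * rad y ?f x)"
      by (rule mult_continuous_integrable[OF v assms(2) continuous_on_rad[OF f]])
    fix p :: "'a \<Rightarrow> real" assume "real_polynomial_function p"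
    then have "(\<lambda>x. rad y ?f x * p x) \<in> test_functions \<Omega>"
      using r by (intro rad_test_function[OF f] smooth_on_real_polynomial_function) (auto simp: flat_simps)
    from z[OF this] show "(LINT x|lebesgue_on \<Omega>. v x * rad y ?f x * p x) = 0" by (simp add: mult.assoc)
  qed
  then have "AE x in lebesgue_on \<Omega>. x \<in> ball y r \<longrightarrow> v x = 0"
  proof (rule eventually_mono, intro impI)
    fix x assume e: "v x * rad y ?f x = 0" and "x \<in> ball y r"
    then have "norm (x - y) < r" by (simp add: dist_norm norm_minus_commute)
    then have "(norm (x - y))\<^sup>2 < r\<^sup>2" by (intro power_strict_mono) auto
    then have "rad y ?f x > 0" by (simp add: rad_def power2_norm_eq_inner flat_simps)
    with e show "v x = 0" by simp
  qed
  with r show "\<exists>r>0. AE x in lebesgue_on \<Omega>. x \<in> ball y r \<longrightarrow> v x = 0" by blast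
qed

text \<open>The set where \<open>f\<close> is nonzero is open and null, hence empty.\<close>

lemma AE_zero_continuous:
  fixes f :: "'a::euclidean_space \<Rightarrow> real"
  assumes "open S" "continuous_on S f" "AE x in lebesgue_on S. f x = 0" "x \<in> S"
  shows "f x = 0"
proof (rule ccontr)
  assume "f x \<noteq> 0"
  define B where "B = {x \<in> S. f x \<noteq> 0}"
  have "B = S \<inter> f -` (- {0})" by (auto simp: B_def)
  then have "open B" using continuous_open_preimage[OF assms(2,1), of "- {0}"] by auto
  have "AE x in lebesgue. x \<in> S \<longrightarrow> f x = 0"
    using assms(1,3) by (subst (asm) AE_restrict_space_iff) auto
  then have "AE x in lebesgue. x \<notin> B" by (rule eventually_mono) (auto simp: B_def)
  then have "emeasure lebesgue B = 0"
    using AE_iff_measurable[of B lebesgue "\<lambda>x. x \<notin> B"] \<open>open B\<close> by auto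
  then have "negligible B" using \<open>open B\<close> by (simp add: negligible_iff_null_sets null_sets_def)
  moreover have "B \<noteq> {}" using \<open>f x \<noteq> 0\<close> assms(4) by (auto simp: B_def)
  ultimately show False using open_not_negligible \<open>open B\<close> by blast
qed

lemma smooth_on_antiderivative_exists:
  fixes g :: "real \<Rightarrow> real"
  assumes g: "smooth_on UNIV g" and z: "\<And>\<sigma>. \<sigma> \<ge> a \<Longrightarrow> g \<sigma> = 0"
  obtains G where "smooth_on UNIV G" "deriv G = g" "\<And>\<sigma>. \<sigma> \<ge> a \<Longrightarrow> G \<sigma> = 0"
proof -
  have "\<exists>F. \<forall>x::real. - \<infinity> < ereal x \<longrightarrow> ereal x < \<infinity> \<longrightarrow> (F has_vector_derivative g x) (at x)"
    by (rule einterval_antiderivative)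
       (use smooth_on_continuous_on[OF g] in \<open>auto simp: continuous_on_eq_continuous_at\<close>)
  then obtain F where F: "\<And>x. (F has_real_derivative g x) (at x)"
    by (auto simp: has_real_derivative_iff_has_vector_derivative)
  define G where "G = (\<lambda>\<sigma>. F \<sigma> - F a)"
  have G: "(G has_real_derivative g x) (at x)" for x
    unfolding G_def using F[of x] by (auto intro!: derivative_eq_intros)
  have "G \<sigma> = 0" if "\<sigma> \<ge> a" for \<sigma>
  proof -
    have "\<exists>c. \<forall>x\<in>{a..}. G x = c"
    proof (rule has_field_derivative_zero_constant)
      show "(G has_real_derivative 0) (at x within {a..})" if "x \<in> {a..}" for x
        using DERIV_subset[OF G[of x]] z[of x] that by auto
    qed simp
    then have "G \<sigma> = G a" using that by auto
    then show ?thesis by (simp add: G_def)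
  qed
  then show ?thesis
    by (rule that[OF smooth_on_antiderivative[OF open_UNIV g G] has_real_derivative_ext[OF G]])
qed

text \<open>Each antiderivative is normalised to vanish at \<open>a\<close>, so the zero half-line
  survives. This will produce a wave profile whose derivative of order \<open>n\<close> in \<sigma>
  is a prescribed \<open>g\<close>.\<close>

lemma smooth_on_higher_antiderivative:
  assumes "smooth_on UNIV g" "\<And>\<sigma>. \<sigma> \<ge> (a::real) \<Longrightarrow> g \<sigma> = 0"
  shows "\<exists>f. smooth_on UNIV f \<and> (deriv ^^ n) f = g \<and> (\<forall>\<sigma>\<ge>a. f \<sigma> = 0)"
proof (induction n)
  case 0 then show ?case using assms by auto
next
  case (Suc n)
  then obtain f where f: "smooth_on UNIV f" "(deriv ^^ n) f = g" "\<And>\<sigma>. \<sigma> \<ge> a \<Longrightarrow> f \<sigma> = 0" by auto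
  obtain F where F: "smooth_on UNIV F" "deriv F = f" "\<And>\<sigma>. \<sigma> \<ge> a \<Longrightarrow> F \<sigma> = 0"
    by (rule smooth_on_antiderivative_exists[OF f(1,3)]) blast+
  then have "(deriv ^^ Suc n) F = g" using f(2) by (simp only: funpow_Suc_right o_apply)
  with F show ?case by blast
qed

section \<open>Functions with vanishing radial integrals\<close>

locale radial_vanishing =
  fixes \<Omega> :: "'a::euclidean_space set" and x0 :: 'a and \<epsilon> \<rho> :: real and N :: nat
  assumes dom: "open \<Omega>" "bounded \<Omega>" and pos: "\<epsilon> > 0" "\<rho> > 0"
begin

text \<open>Quantified over an open set of centres and over all profiles so that the class is stable
  under multiplication by polynomials: moving the centre produces linear factors, and the derivative
  of a profile is again a profile.\<close>

definition vanish :: "('a \<Rightarrow> real) \<Rightarrow> bool" where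
  "vanish v \<longleftrightarrow> integrable (lebesgue_on \<Omega>) v \<and> (\<forall>y\<in>ball x0 \<epsilon>. \<forall>g. smooth_on UNIV g \<longrightarrow> (\<forall>\<sigma>\<ge>\<rho>\<^sup>2. g \<sigma> = 0) \<longrightarrow>
     (LINT x|lebesgue_on \<Omega>. v x * rad y (phi N \<rho> g) x) = 0)"

lemma integrable_rad:
  "integrable (lebesgue_on \<Omega>) v \<Longrightarrow> smooth_on UNIV f \<Longrightarrow> integrable (lebesgue_on \<Omega>) (\<lambda>x. v x * rad y f x)"
  by (rule mult_continuous_integrable[OF _ dom(2) continuous_on_rad])

lemma rad_translate_derivative:
  assumes f: "smooth_on UNIV f"
  shows "((\<lambda>l. rad (y + l *\<^sub>R b) f x) has_real_derivative - 2 * ((x - (y + l *\<^sub>R b)) \<bullet> b) * rad (y + l *\<^sub>R b) (deriv f) x) (at l)"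
proof -
  have "((\<lambda>l. (x - (y + l *\<^sub>R b)) \<bullet> (x - (y + l *\<^sub>R b))) has_derivative (\<lambda>h. (x - (y + l *\<^sub>R b)) \<bullet> (- (h *\<^sub>R b)) + (- (h *\<^sub>R b)) \<bullet> (x - (y + l *\<^sub>R b)))) (at l)"
    by (auto intro!: derivative_eq_intros)
  moreover have "(\<lambda>h. (x - (y + l *\<^sub>R b)) \<bullet> (- (h *\<^sub>R b)) + (- (h *\<^sub>R b)) \<bullet> (x - (y + l *\<^sub>R b))) = (*) (- 2 * ((x - (y + l *\<^sub>R b)) \<bullet> b))"
    by (auto simp: fun_eq_iff inner_commute)
  ultimately have "((\<lambda>l. (x - (y + l *\<^sub>R b)) \<bullet> (x - (y + l *\<^sub>R b))) has_real_derivative - 2 * ((x - (y + l *\<^sub>R b)) \<bullet> b)) (at l)"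
    unfolding has_field_derivative_def by simp
  from DERIV_chain2[OF smooth_on_has_real_derivative[OF f] this] show ?thesis
    by (simp add: rad_def mult.commute)
qed

text \<open>Differentiate with respect to the centre \<open>y\<close>, using that \<open>g\<close> is again a derivative.\<close>

lemma vanish_linear:
  assumes v: "vanish v"
  shows "vanish (\<lambda>x. v x * (x \<bullet> b))"
  unfolding vanish_def
proof (intro conjI ballI allI impI)
  have vi: "integrable (lebesgue_on \<Omega>) v" using v by (simp add: vanish_def)
  show vbi: "integrable (lebesgue_on \<Omega>) (\<lambda>x. v x * (x \<bullet> b))"
    by (rule mult_continuous_integrable[OF vi dom(2)]) (intro continuous_intros)
  fix y g assume y: "y \<in> ball x0 \<epsilon>" and g: "smooth_on UNIV g" "\<forall>\<sigma>\<ge>\<rho>\<^sup>2. g \<sigma> = 0"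
  \<comment> \<open>Moving the centre differentiates the profile; starting from an antiderivative
    makes \<open>g\<close> itself come out.\<close>
  obtain G where G: "smooth_on UNIV G" "deriv G = g" "\<And>\<sigma>. \<sigma> \<ge> \<rho>\<^sup>2 \<Longrightarrow> G \<sigma> = 0"
    by (rule smooth_on_antiderivative_exists[OF g(1)]) (use g(2) in auto)
  let ?P = "phi N \<rho> G" and ?p = "phi N \<rho> g"
  have P: "smooth_on UNIV ?P" "deriv ?P = ?p" and p: "smooth_on UNIV ?p"
    using G g by (auto simp: smooth_on_phi deriv_phi)
  obtain e where e: "e > 0" "ball y e \<subseteq> ball x0 \<epsilon>"
    using y openE[OF open_ball, of y x0 \<epsilon>] by metis
  define d where "d = e / (norm b + 1)"
  have d: "d > 0" using e(1) by (simp add: d_def add_nonneg_pos)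
  let ?U = "{-d<..<d}"
  have U: "y + l *\<^sub>R b \<in> ball x0 \<epsilon>" if "l \<in> ?U" for l
  proof -
    have "\<bar>l\<bar> * norm b \<le> \<bar>l\<bar> * (norm b + 1)" by (intro mult_left_mono) auto
    also have "\<dots> < d * (norm b + 1)" using that by (intro mult_strict_right_mono) (auto simp: add_nonneg_pos)
    also have "\<dots> = e"
    proof -
      have "norm b + 1 \<noteq> 0" using norm_ge_zero[of b] by linarith
      then show ?thesis by (simp add: d_def)
    qed
    finally have "y + l *\<^sub>R b \<in> ball y e" by (simp add: dist_norm)
    then show ?thesis using e(2) by blast
  qed
  let ?h' = "\<lambda>l x. - 2 * ((x - (y + l *\<^sub>R b)) \<bullet> b) * rad (y + l *\<^sub>R b) ?p x"
  obtain C where C: "\<And>l x. l \<in> ?U \<Longrightarrow> x \<in> \<Omega> \<Longrightarrow> \<bar>rad (y + l *\<^sub>R b) ?P x\<bar> \<le> C"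
    "\<And>l x. l \<in> ?U \<Longrightarrow> x \<in> \<Omega> \<Longrightarrow> \<bar>?h' l x\<bar> \<le> C"
  proof -
    have cP: "continuous_on UNIV (\<lambda>z. rad (y + fst z *\<^sub>R b) ?P (snd z))"
      and cp: "continuous_on UNIV (\<lambda>z. ?h' (fst z) (snd z))"
      unfolding rad_def by (intro continuous_intros continuous_on_smooth_compose[OF P(1)] continuous_on_smooth_compose[OF p])+
    have bd: "bounded (?U \<times> \<Omega>)" using dom(2) by (intro bounded_Times) auto
    obtain C1 where C1: "\<And>z. z \<in> ?U \<times> \<Omega> \<Longrightarrow> \<bar>rad (y + fst z *\<^sub>R b) ?P (snd z)\<bar> \<le> C1"
      by (rule continuous_bounded_on_bounded[OF cP bd]) blast
    obtain C2 where C2: "\<And>z. z \<in> ?U \<times> \<Omega> \<Longrightarrow> \<bar>?h' (fst z) (snd z)\<bar> \<le> C2"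
      by (rule continuous_bounded_on_bounded[OF cp bd]) blast
    show ?thesis
    proof (rule that[of "max C1 C2"])
      fix l x assume "l \<in> ?U" "x \<in> \<Omega>"
      then show "\<bar>rad (y + l *\<^sub>R b) ?P x\<bar> \<le> max C1 C2" "\<bar>?h' l x\<bar> \<le> max C1 C2"
        using C1[of "(l, x)"] C2[of "(l, x)"] by auto
    qed
  qed
  have "((\<lambda>l. LINT x|lebesgue_on \<Omega>. v x * rad (y + l *\<^sub>R b) ?P x) has_real_derivative
     (LINT x|lebesgue_on \<Omega>. v x * ?h' 0 x)) (at 0 within ?U)"
  proof (rule integral_has_real_derivative[OF vi, where C = C])
    show "rad (y + l *\<^sub>R b) ?P \<in> borel_measurable (lebesgue_on \<Omega>)" for l
      by (rule continuous_on_imp_measurable_lebesgue_on[OF continuous_on_rad[OF P(1)]])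
    show "?h' 0 \<in> borel_measurable (lebesgue_on \<Omega>)"
      by (intro continuous_on_imp_measurable_lebesgue_on continuous_intros continuous_on_rad[OF p])
    show "((\<lambda>l. rad (y + l *\<^sub>R b) ?P x) has_real_derivative ?h' l x) (at l within ?U)" for l x
      using rad_translate_derivative[OF P(1), of y b x l] unfolding P(2) by (rule DERIV_subset) simp
    show "convex ?U" "0 \<in> ?U" using d by auto
    show "\<bar>rad (y + l *\<^sub>R b) ?P x\<bar> \<le> C" "\<bar>?h' l x\<bar> \<le> C" if "l \<in> ?U" "x \<in> space (lebesgue_on \<Omega>)" for l x
    proof -
      have "x \<in> \<Omega>" using that(2) by simp
      from C(1)[OF that(1) this] C(2)[OF that(1) this]
      show "\<bar>rad (y + l *\<^sub>R b) ?P x\<bar> \<le> C" "\<bar>?h' l x\<bar> \<le> C" by this+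
    qed
  qed
  moreover have "((\<lambda>l. LINT x|lebesgue_on \<Omega>. v x * rad (y + l *\<^sub>R b) ?P x) has_real_derivative 0) (at 0 within ?U)"
  proof (rule has_field_derivative_transform_within[of "\<lambda>_. 0" _ _ _ d])
    fix l assume "l \<in> ?U"
    from v[unfolded vanish_def, THEN conjunct2, rule_format, OF U[OF this] G(1) G(3)]
    show "0 = (LINT x|lebesgue_on \<Omega>. v x * rad (y + l *\<^sub>R b) ?P x)" by simp
  qed (use d in auto)
  ultimately have "((\<lambda>l. LINT x|lebesgue_on \<Omega>. v x * rad (y + l *\<^sub>R b) ?P x) has_real_derivative
     (LINT x|lebesgue_on \<Omega>. v x * ?h' 0 x)) (at 0)"
    "((\<lambda>l. LINT x|lebesgue_on \<Omega>. v x * rad (y + l *\<^sub>R b) ?P x) has_real_derivative 0) (at 0)"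
    using d by (simp_all add: at_within_open[of 0 ?U])
  then have h0: "(LINT x|lebesgue_on \<Omega>. v x * ?h' 0 x) = 0" by (rule DERIV_unique)
  \<comment> \<open>The factor contains the inner product of \<open>x - y\<close> with
    \<open>b\<close>. Its part in \<open>y\<close> is a constant times an integral that vanishes by
    hypothesis, so the part in \<open>x\<close> must vanish as well.\<close>
  have eq: "v x * ?h' 0 x = 2 * (y \<bullet> b) * (v x * rad y ?p x) - 2 * (v x * (x \<bullet> b) * rad y ?p x)" for x
    by (simp add: inner_diff_left algebra_simps)
  have "(LINT x|lebesgue_on \<Omega>. 2 * (y \<bullet> b) * (v x * rad y ?p x) - 2 * (v x * (x \<bullet> b) * rad y ?p x)) = 0"
    using h0 by (simp only: eq)
  also have "(LINT x|lebesgue_on \<Omega>. 2 * (y \<bullet> b) * (v x * rad y ?p x) - 2 * (v x * (x \<bullet> b) * rad y ?p x))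
     = 2 * (y \<bullet> b) * (LINT x|lebesgue_on \<Omega>. v x * rad y ?p x) - 2 * (LINT x|lebesgue_on \<Omega>. v x * (x \<bullet> b) * rad y ?p x)"
    using integrable_rad[OF vi p, of y] integrable_rad[OF vbi p, of y] by simp
  also have "(LINT x|lebesgue_on \<Omega>. v x * rad y ?p x) = 0"
    by (rule v[unfolded vanish_def, THEN conjunct2, rule_format, OF y g(1)]) (use g(2) in simp)
  finally show "(LINT x|lebesgue_on \<Omega>. v x * (x \<bullet> b) * rad y ?p x) = 0" by simp
qed

lemma vanish_polynomial:
  assumes "real_polynomial_function p" "vanish v"
  shows "vanish (\<lambda>x. v x * p x)"
  using assms
proof (induction p arbitrary: v rule: real_polynomial_function.induct)
  case (linear f)
  have "f x = x \<bullet> (\<Sum>b\<in>Basis. f b *\<^sub>R b)" for x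
  proof -
    have l: "linear f" using linear(1) by (rule bounded_linear.linear)
    have "f x = f (\<Sum>b\<in>Basis. (x \<bullet> b) *\<^sub>R b)" by (simp only: euclidean_representation)
    also have "\<dots> = (\<Sum>b\<in>Basis. (x \<bullet> b) * f b)"
      by (simp add: linear_sum[OF l] linear_cmul[OF l])
    also have "\<dots> = x \<bullet> (\<Sum>b\<in>Basis. f b *\<^sub>R b)" by (simp add: inner_sum_right mult.commute)
    finally show ?thesis .
  qed
  then obtain c where "f = (\<lambda>x. x \<bullet> c)" by blast
  then show ?case using vanish_linear[OF linear(2), of c] by simp
next
  case (const c)
  have "(\<lambda>x. v x * c * rad y h x) = (\<lambda>x. c * (v x * rad y h x))" for y h by (simp add: fun_eq_iff)
  then show ?case using const unfolding vanish_def by simp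
next
  case (add f g)
  have f: "vanish (\<lambda>x. v x * f x)" and g: "vanish (\<lambda>x. v x * g x)"
    by (rule add.IH(1)[OF add.prems]) (rule add.IH(2)[OF add.prems])
  from f g have i: "integrable (lebesgue_on \<Omega>) (\<lambda>x. v x * f x)" "integrable (lebesgue_on \<Omega>) (\<lambda>x. v x * g x)"
    by (simp_all add: vanish_def)
  show ?case
    unfolding vanish_def
  proof (intro conjI ballI allI impI)
    show "integrable (lebesgue_on \<Omega>) (\<lambda>x. v x * (f x + g x))" using i by (simp add: distrib_left)
    fix y h assume h: "y \<in> ball x0 \<epsilon>" "smooth_on UNIV h" "\<forall>\<sigma>\<ge>\<rho>\<^sup>2. h \<sigma> = 0"
    let ?r = "rad y (phi N \<rho> h)"
    have "(LINT x|lebesgue_on \<Omega>. v x * (f x + g x) * ?r x) = (LINT x|lebesgue_on \<Omega>. v x * f x * ?r x + v x * g x * ?r x)"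
      by (simp add: algebra_simps)
    also have "\<dots> = (LINT x|lebesgue_on \<Omega>. v x * f x * ?r x) + (LINT x|lebesgue_on \<Omega>. v x * g x * ?r x)"
      by (intro Bochner_Integration.integral_add integrable_rad i smooth_on_phi h(2))
    also have "\<dots> = 0" using f g h unfolding vanish_def by simp
    finally show "(LINT x|lebesgue_on \<Omega>. v x * (f x + g x) * ?r x) = 0" .
  qed
next
  \<comment> \<open>With \<open>v\<close> arbitrary in the induction, the factor \<open>f\<close> is
    absorbed into \<open>v\<close> before \<open>g\<close> is treated.\<close>
  case (mult f g)
  from mult.IH(2)[OF mult.IH(1)[OF mult.prems]] show ?case by (simp add: mult.assoc)
qed

lemma phi_flat_pos:
  assumes "\<sigma> < \<rho>\<^sup>2" "\<sigma> \<ge> 0"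
  shows "phi N \<rho> (\<lambda>s. flat (\<rho>\<^sup>2 - s)) \<sigma> > 0"
proof -
  let ?f = "\<lambda>z. flat (\<rho>\<^sup>2 - (\<sigma> + z\<^sup>2)) * z ^ N"
  have c: "continuous_on {0..\<rho>} ?f"
    by (intro continuous_intros continuous_on_smooth_compose[OF smooth_on_flat])
  have nn: "?f z \<ge> 0" if "z \<in> {0..\<rho>}" for z using that by (auto simp: flat_simps)
  \<comment> \<open>At this point the argument of \<open>flat\<close> equals (\<rho>^2 - \<sigma>)/2
    > 0, so the nonnegative continuous integrand does not vanish identically.\<close>
  define z where "z = sqrt ((\<rho>\<^sup>2 - \<sigma>) / 2)"
  have z: "z > 0" "z\<^sup>2 = (\<rho>\<^sup>2 - \<sigma>) / 2" using assms by (auto simp: z_def)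
  then have "z\<^sup>2 \<le> \<rho>\<^sup>2" using assms by simp
  then have "z \<le> \<rho>" using pos(2) power2_le_imp_le less_imp_le by blast
  moreover have "?f z > 0" using z assms by (intro mult_pos_pos flat_simps(1)) auto
  ultimately have "integral {0..\<rho>} ?f \<noteq> 0"
    using integral_eq_0_iff[OF c pos(2) nn] z(1) by fastforce
  moreover have "integral {0..\<rho>} ?f \<ge> 0"
    by (rule integral_nonneg[OF integrable_continuous_real[OF c] nn])
  ultimately show ?thesis by (simp add: phi_def)
qed

text \<open>Only the centre \<open>x0\<close> is used here; the neighbouring centres have already
  been spent on the polynomial factors. The weight is positive on the whole ball, so nothing of
  \<open>v\<close> is lost in the product.\<close>

lemma vanish_imp_zero:
  assumes v: "vanish v"
  shows "AE x in lebesgue_on \<Omega>. x \<in> ball x0 \<rho> \<longrightarrow> v x = 0"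
proof -
  let ?p = "phi N \<rho> (\<lambda>s. flat (\<rho>\<^sup>2 - s))"
  have p: "smooth_on UNIV ?p" by (rule smooth_on_phi[OF smooth_on_flat_diff])
  have vi: "integrable (lebesgue_on \<Omega>) v" using v by (simp add: vanish_def)
  have "AE x in lebesgue_on \<Omega>. v x * rad x0 ?p x = 0"
  proof (rule poly_moments_zero[OF dom(2)])
    show "\<Omega> \<in> sets lebesgue" using dom(1) by auto
    show "integrable (lebesgue_on \<Omega>) (\<lambda>x. v x * rad x0 ?p x)" by (rule integrable_rad[OF vi p])
    fix q :: "'a \<Rightarrow> real" assume "real_polynomial_function q"
    from vanish_polynomial[OF this v] have "(LINT x|lebesgue_on \<Omega>. v x * q x * rad x0 ?p x) = 0"
      unfolding vanish_def using pos(1) smooth_on_flat_diff[of "\<rho>\<^sup>2"] flat_simps(2) by simp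
    then show "(LINT x|lebesgue_on \<Omega>. v x * rad x0 ?p x * q x) = 0" by (simp add: mult_ac)
  qed
  then show ?thesis
  proof (rule eventually_mono, intro impI)
    fix x assume e: "v x * rad x0 ?p x = 0" and "x \<in> ball x0 \<rho>"
    then have "norm (x - x0) < \<rho>" by (simp add: dist_norm norm_minus_commute)
    then have "(norm (x - x0))\<^sup>2 < \<rho>\<^sup>2" by (intro power_strict_mono) auto
    then have "rad x0 ?p x > 0" unfolding rad_def
      by (intro phi_flat_pos) (simp_all add: power2_norm_eq_inner)
    with e show "v x = 0" by simp
  qed
qed

end

section \<open>Local unique continuation\<close>

lemma LINT_lebesgue_on_eq:
  fixes f :: "'a::euclidean_space \<Rightarrow> real"
  assumes "A \<in> sets lebesgue" "B \<in> sets lebesgue"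
    and "\<And>x. x \<in> A \<Longrightarrow> x \<notin> B \<Longrightarrow> f x = 0" "\<And>x. x \<in> B \<Longrightarrow> x \<notin> A \<Longrightarrow> f x = 0"
  shows "(LINT x|lebesgue_on A. f x) = (LINT x|lebesgue_on B. f x)"
proof -
  have "(\<lambda>x. indicator A x *\<^sub>R f x) = (\<lambda>x. indicator B x *\<^sub>R f x)"
    using assms(3,4) by (auto simp: fun_eq_iff indicator_def)
  then show ?thesis
    using integral_restrict_space[of A lebesgue f] integral_restrict_space[of B lebesgue f] assms(1,2) by simp
qed

lemma integrable_lebesgue_on_subset:
  fixes f :: "'a::euclidean_space \<Rightarrow> real"
  assumes "integrable (lebesgue_on A) f" "A \<in> sets lebesgue" "B \<in> sets lebesgue" "B \<subseteq> A"
  shows "integrable (lebesgue_on B) f"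
proof -
  have "set_integrable lebesgue A f"
    using assms(1,2) integrable_restrict_space[of A lebesgue f] by (simp add: set_integrable_def)
  then have "set_integrable lebesgue B f" by (rule set_integrable_subset[OF _ assms(3,4)])
  then show ?thesis
    using assms(3) integrable_restrict_space[of B lebesgue f] by (simp add: set_integrable_def)
qed

lemma LINT_continuous_on_eq_integral:
  fixes f :: "real \<Rightarrow> real"
  assumes "A \<in> sets lebesgue" "{\<alpha>..\<beta>} \<subseteq> A" "continuous_on {\<alpha>..\<beta>} f" "\<And>t. t \<in> A \<Longrightarrow> t \<notin> {\<alpha>..\<beta>} \<Longrightarrow> f t = 0"
  shows "(LINT t|lebesgue_on A. f t) = integral {\<alpha>..\<beta>} f"
proof -
  have "(LINT t|lebesgue_on A. f t) = (LINT t|lebesgue_on {\<alpha>..\<beta>}. f t)"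
    using assms by (intro LINT_lebesgue_on_eq) auto
  also have "\<dots> = integral {\<alpha>..\<beta>} f"
    by (rule lebesgue_integral_eq_integral[OF continuous_imp_integrable_real[OF assms(3)]]) simp
  finally show ?thesis .
qed

lemma test_function_outside: "\<phi> \<in> test_functions U \<Longrightarrow> x \<notin> U \<Longrightarrow> \<phi> x = 0"
  unfolding test_functions_def using closure_subset[of "{x. \<phi> x \<noteq> 0}"] by blast

lemma time_test_function:
  fixes \<theta> :: "real \<Rightarrow> real"
  assumes "smooth_on UNIV \<theta>" "\<And>t. t \<notin> {\<alpha>..\<beta>} \<Longrightarrow> \<theta> t = 0" "{\<alpha>..\<beta>} \<subseteq> I"
  shows "\<theta> \<in> test_functions I"
proof -
  have "{t. \<theta> t \<noteq> 0} \<subseteq> {\<alpha>..\<beta>}" using assms(2) by blast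
  then have c: "closure {t. \<theta> t \<noteq> 0} \<subseteq> {\<alpha>..\<beta>}" by (rule closure_minimal) simp
  then have "compact (closure {t. \<theta> t \<noteq> 0})"
    by (meson bounded_closed_interval bounded_subset closed_closure compact_eq_bounded_closed)
  with c assms show ?thesis by (simp add: test_functions_def)
qed

lemma deriv_zero_outside:
  fixes \<theta> :: "real \<Rightarrow> real"
  assumes "\<And>t. t \<notin> {\<alpha>..\<beta>} \<Longrightarrow> \<theta> t = 0" "t \<notin> {\<alpha>..\<beta>}"
  shows "deriv \<theta> t = 0"
proof -
  have "((\<lambda>_. 0) has_real_derivative 0) (at t)" by simp
  then have "(\<theta> has_real_derivative 0) (at t)"
    by (rule has_field_derivative_transform_within_open[of _ _ _ "- {\<alpha>..\<beta>}"]) (use assms in auto)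
  then show ?thesis by (rule DERIV_imp_deriv)
qed

text \<open>Shaped to fit \<open>wave_1d_unique\<close>: the integral runs over the large interval
  while the weights live on the smaller one. Continuity of \<open>f\<close> upgrades almost
  everywhere to every time.\<close>

lemma fundamental_lemma_time:
  fixes f :: "real \<Rightarrow> real"
  assumes f: "continuous_on {\<alpha>..\<beta>} f" and le: "\<alpha> \<le> \<alpha>'" "\<beta>' \<le> \<beta>"
    and z: "\<And>\<theta>. \<lbrakk>smooth_on UNIV \<theta>; \<And>t. t \<notin> {\<alpha>'..\<beta>'} \<Longrightarrow> \<theta> t = 0\<rbrakk> \<Longrightarrow> integral {\<alpha>..\<beta>} (\<lambda>t. \<theta> t * f t) = 0"
    and t: "t \<in> {\<alpha>'<..<\<beta>'}"
  shows "f t = 0"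
proof -
  let ?J = "{\<alpha>'<..<\<beta>'}"
  have J: "?J \<subseteq> {\<alpha>..\<beta>}" "?J \<in> sets lebesgue" using le by auto
  have ae: "AE t in lebesgue_on ?J. f t = 0"
  proof (rule fundamental_lemma)
    show "integrable (lebesgue_on ?J) f"
      by (rule integrable_lebesgue_on_subset[OF continuous_imp_integrable_real[OF f] _ J(2,1)]) simp
    fix \<phi> assume \<phi>: "\<phi> \<in> test_functions ?J"
    have o: "\<phi> t = 0" if "t \<notin> ?J" for t by (rule test_function_outside[OF \<phi> that])
    have "(LINT t|lebesgue_on ?J. f t * \<phi> t) = (LINT t|lebesgue_on {\<alpha>..\<beta>}. f t * \<phi> t)"
      by (rule LINT_lebesgue_on_eq) (use J o in auto)
    also have "\<dots> = integral {\<alpha>..\<beta>} (\<lambda>t. f t * \<phi> t)"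
      by (rule LINT_continuous_on_eq_integral)
         (auto intro!: continuous_on_mult f smooth_on_continuous_on_UNIV[OF test_functions_smooth[OF \<phi>]])
    also have "\<dots> = integral {\<alpha>..\<beta>} (\<lambda>t. \<phi> t * f t)" by (simp add: mult.commute)
    also have "\<dots> = 0"
      by (rule z[OF test_functions_smooth[OF \<phi>]]) (rule o, auto)
    finally show "(LINT t|lebesgue_on ?J. f t * \<phi> t) = 0" .
  qed auto
  show ?thesis
    by (rule AE_zero_continuous[OF open_greaterThanLessThan continuous_on_subset[OF f J(1)] ae t])
qed

text \<open>Separate continuity is not enough for joint continuity; a Lipschitz bound in one
  variable that is uniform in the other is.\<close>

lemma continuous_on_Times_lipschitz:
  fixes f :: "real \<Rightarrow> real \<Rightarrow> real"
  assumes L: "\<And>t l l'. \<lbrakk>t \<in> B; l \<in> A; l' \<in> A\<rbrakk> \<Longrightarrow> \<bar>f l t - f l' t\<bar> \<le> L * \<bar>l - l'\<bar>"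
    and c: "\<And>l. l \<in> A \<Longrightarrow> continuous_on B (f l)"
  shows "continuous_on (A \<times> B) (\<lambda>(l, t). f l t)"
  unfolding continuous_on_def
proof
  fix p assume p: "p \<in> A \<times> B"
  obtain l0 t0 where p0: "p = (l0, t0)" "l0 \<in> A" "t0 \<in> B" using p by blast
  let ?F = "at p within A \<times> B"
  have s: "(snd \<longlongrightarrow> t0) ?F" "(fst \<longlongrightarrow> l0) ?F"
    using tendsto_snd[OF tendsto_ident_at, of p "A \<times> B"] tendsto_fst[OF tendsto_ident_at, of p "A \<times> B"] p0 by simp_all
  have "continuous_on (A \<times> B) (\<lambda>x. f l0 (snd x))"
    by (rule continuous_on_compose2[OF c[OF p0(2)]]) (auto intro!: continuous_intros)
  then have 1: "((\<lambda>x. f l0 (snd x)) \<longlongrightarrow> f l0 t0) ?F"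
    using p p0 unfolding continuous_on_def by fastforce
  have "((\<lambda>x. f (fst x) (snd x) - f l0 (snd x)) \<longlongrightarrow> 0) ?F"
  proof (rule Lim_null_comparison)
    show "eventually (\<lambda>x. norm (f (fst x) (snd x) - f l0 (snd x)) \<le> L * \<bar>fst x - l0\<bar>) ?F"
      unfolding eventually_at_filter using L p0 by (intro always_eventually) auto
    have "((\<lambda>x. L * \<bar>fst x - l0\<bar>) \<longlongrightarrow> L * \<bar>l0 - l0\<bar>) ?F" by (intro tendsto_intros s)
    then show "((\<lambda>x. L * \<bar>fst x - l0\<bar>) \<longlongrightarrow> 0) ?F" by simp
  qed
  from tendsto_add[OF this 1] show "((\<lambda>(l, t). f l t) \<longlongrightarrow> (case p of (l, t) \<Rightarrow> f l t)) ?F"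
    using p0 by (simp add: case_prod_unfold)
qed

text \<open>The translation \<open>l\<close> of the profile is an argument of its own, because joint
  continuity and differentiability in \<open>l\<close> are what \<open>wave_1d\<close> asks
  for.\<close>

definition kern :: "nat \<Rightarrow> real \<Rightarrow> (real \<Rightarrow> real) \<Rightarrow> (real \<Rightarrow> real) \<Rightarrow> real \<Rightarrow> real \<Rightarrow> real" where
  "kern N M q F l = psi_rad N M q (\<lambda>r. F (r + l))"

lemma higher_deriv_shift:
  assumes "smooth_on UNIV F"
  shows "(deriv ^^ i) (\<lambda>r. F (r + l)) = (\<lambda>r. (deriv ^^ i) F (r + (l::real)))"
proof (induction i)
  case (Suc i)
  then show ?case using deriv_shift[OF smooth_on_higher_deriv[OF assms]] by simp
qed simp

text \<open>The coefficients depend on \<open>q\<close> alone, so \<open>F\<close> and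
  \<open>l\<close> enter only through derivatives of \<open>F\<close> at translated arguments.
  Continuity and differentiation under the integral can then be read off.\<close>

lemma kern_formula:
  assumes q: "smooth_on UNIV q"
  obtains c where "\<And>i. smooth_on UNIV (c i)"
    "\<And>F l \<rho>. smooth_on UNIV (F :: real \<Rightarrow> real) \<Longrightarrow> kern N M q F l \<rho> =
       integral (cbox 0 M) (\<lambda>z. (\<Sum>i\<le>N. (deriv ^^ i) F (q (\<rho> + z\<^sup>2) + l) * c i (\<rho> + z\<^sup>2)) * z ^ N)"
proof -
  obtain c where c: "\<And>i. smooth_on UNIV (c i)"
    "\<And>F \<sigma>. smooth_on UNIV F \<Longrightarrow> (deriv ^^ N) (\<lambda>\<sigma>. F (q \<sigma>)) \<sigma> = (\<Sum>i\<le>N. (deriv ^^ i) F (q \<sigma>) * c i \<sigma>)"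
    using higher_deriv_compose[OF q, of N] by blast
  show ?thesis
  proof (rule that[OF c(1)])
    fix F :: "real \<Rightarrow> real" and l \<rho> assume F: "smooth_on UNIV F"
    show "kern N M q F l \<rho> = integral (cbox 0 M) (\<lambda>z. (\<Sum>i\<le>N. (deriv ^^ i) F (q (\<rho> + z\<^sup>2) + l) * c i (\<rho> + z\<^sup>2)) * z ^ N)"
      unfolding kern_def psi_rad_def phi_def c(2)[OF smooth_on_shift[OF F]] higher_deriv_shift[OF F] cbox_interval ..
  qed
qed

lemma continuous_on_kern:
  assumes q: "smooth_on UNIV q" and F: "smooth_on UNIV F"
  shows "continuous_on UNIV (\<lambda>p. kern N M q F (fst p) (snd p))"
proof -
  obtain c where c: "\<And>i. smooth_on UNIV (c i)"
    "\<And>F l \<rho>. smooth_on UNIV (F :: real \<Rightarrow> real) \<Longrightarrow> kern N M q F l \<rho> =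
       integral (cbox 0 M) (\<lambda>z. (\<Sum>i\<le>N. (deriv ^^ i) F (q (\<rho> + z\<^sup>2) + l) * c i (\<rho> + z\<^sup>2)) * z ^ N)"
    by (rule kern_formula[OF q]) blast
  show ?thesis
    unfolding c(2)[OF F]
  proof (rule integral_continuous_on_param)
    show "continuous_on (UNIV \<times> cbox 0 M) (\<lambda>(p, z). (\<Sum>i\<le>N. (deriv ^^ i) F (q (snd p + z\<^sup>2) + fst p) * c i (snd p + z\<^sup>2)) * z ^ N)"
      unfolding case_prod_unfold
      by (intro continuous_intros continuous_on_smooth_compose[OF c(1)]
          continuous_on_smooth_compose[OF smooth_on_higher_deriv[OF F]] continuous_on_smooth_compose[OF q])
  qed
qed

lemma kern_has_derivative:
  assumes q: "smooth_on UNIV q" and F: "smooth_on UNIV F"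
  shows "((\<lambda>l. kern N M q F l \<rho>) has_real_derivative kern N M q (deriv F) l \<rho>) (at l)"
proof -
  obtain c where c: "\<And>i. smooth_on UNIV (c i)"
    "\<And>F l \<rho>. smooth_on UNIV (F :: real \<Rightarrow> real) \<Longrightarrow> kern N M q F l \<rho> =
       integral (cbox 0 M) (\<lambda>z. (\<Sum>i\<le>N. (deriv ^^ i) F (q (\<rho> + z\<^sup>2) + l) * c i (\<rho> + z\<^sup>2)) * z ^ N)"
    by (rule kern_formula[OF q]) blast
  have F': "smooth_on UNIV (deriv F)" by (rule smooth_on_deriv[OF open_UNIV F])
  have sw: "(deriv ^^ i) (deriv F) = (deriv ^^ Suc i) F" for i by (simp add: funpow_swap1)
  have "((\<lambda>l. integral (cbox 0 M) (\<lambda>z. (\<Sum>i\<le>N. (deriv ^^ i) F (q (\<rho> + z\<^sup>2) + l) * c i (\<rho> + z\<^sup>2)) * z ^ N)) has_real_derivative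
      integral (cbox 0 M) (\<lambda>z. (\<Sum>i\<le>N. (deriv ^^ i) (deriv F) (q (\<rho> + z\<^sup>2) + l) * c i (\<rho> + z\<^sup>2)) * z ^ N)) (at l within UNIV)"
  proof (rule leibniz_rule_field_derivative)
    fix l z :: real
    have "((\<lambda>l. (deriv ^^ i) F (q (\<rho> + z\<^sup>2) + l)) has_real_derivative (deriv ^^ i) (deriv F) (q (\<rho> + z\<^sup>2) + l)) (at l)" for i
      using higher_deriv_real_derivative[OF F, of i "l + q (\<rho> + z\<^sup>2)"] unfolding sw DERIV_shift
      by (simp add: add.commute)
    then have "((\<lambda>l. \<Sum>i\<le>N. (deriv ^^ i) F (q (\<rho> + z\<^sup>2) + l) * c i (\<rho> + z\<^sup>2)) has_real_derivative
      (\<Sum>i\<le>N. (deriv ^^ i) (deriv F) (q (\<rho> + z\<^sup>2) + l) * c i (\<rho> + z\<^sup>2))) (at l)"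
      by (intro DERIV_sum DERIV_cmult_right)
    from DERIV_cmult_right[OF this, of "z ^ N"]
    show "((\<lambda>l. (\<Sum>i\<le>N. (deriv ^^ i) F (q (\<rho> + z\<^sup>2) + l) * c i (\<rho> + z\<^sup>2)) * z ^ N) has_real_derivative
      (\<Sum>i\<le>N. (deriv ^^ i) (deriv F) (q (\<rho> + z\<^sup>2) + l) * c i (\<rho> + z\<^sup>2)) * z ^ N) (at l within UNIV)" by simp
  next
    fix l :: real
    show "(\<lambda>z. (\<Sum>i\<le>N. (deriv ^^ i) F (q (\<rho> + z\<^sup>2) + l) * c i (\<rho> + z\<^sup>2)) * z ^ N) integrable_on cbox 0 M"
      by (intro integrable_continuous continuous_intros continuous_on_smooth_compose[OF c(1)]
          continuous_on_smooth_compose[OF smooth_on_higher_deriv[OF F]] continuous_on_smooth_compose[OF q])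
  next
    show "continuous_on (UNIV \<times> cbox 0 M) (\<lambda>(l, z). (\<Sum>i\<le>N. (deriv ^^ i) (deriv F) (q (\<rho> + z\<^sup>2) + l) * c i (\<rho> + z\<^sup>2)) * z ^ N)"
      unfolding case_prod_unfold
      by (intro continuous_intros continuous_on_smooth_compose[OF c(1)]
          continuous_on_smooth_compose[OF smooth_on_higher_deriv[OF F']] continuous_on_smooth_compose[OF q])
  qed auto
  then show ?thesis unfolding c(2)[OF F] c(2)[OF F'] by simp
qed

lemma kern_bounded:
  fixes y :: "'a::euclidean_space"
  assumes q: "smooth_on UNIV q" and F: "smooth_on UNIV F" and b: "bounded L" "bounded \<Omega>"
  obtains C where "C \<ge> 0" "\<And>l x. l \<in> L \<Longrightarrow> x \<in> \<Omega> \<Longrightarrow> \<bar>rad y (kern N M q F l) x\<bar> \<le> C"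
proof -
  have "continuous_on UNIV (\<lambda>p::real \<times> 'a. kern N M q F (fst (fst p, (snd p - y) \<bullet> (snd p - y))) (snd (fst p, (snd p - y) \<bullet> (snd p - y))))"
    by (rule continuous_on_compose2[OF continuous_on_kern[OF q F]]) (auto intro!: continuous_intros)
  then have c: "continuous_on UNIV (\<lambda>p::real \<times> 'a. rad y (kern N M q F (fst p)) (snd p))"
    by (simp add: rad_def)
  obtain C where C: "C \<ge> 0" "\<And>p. p \<in> L \<times> \<Omega> \<Longrightarrow> \<bar>rad y (kern N M q F (fst p)) (snd p)\<bar> \<le> C"
    by (rule continuous_bounded_on_bounded[OF c bounded_Times[OF b]]) blast
  show ?thesis
  proof (rule that[OF C(1)])
    fix l x assume "l \<in> L" "x \<in> \<Omega>"
    then show "\<bar>rad y (kern N M q F l) x\<bar> \<le> C" using C(2)[of "(l, x)"] by simp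
  qed
qed

lemma smooth_on_kern: "smooth_on UNIV q \<Longrightarrow> smooth_on UNIV F \<Longrightarrow> smooth_on UNIV (kern N M q F l)"
  unfolding kern_def by (intro smooth_on_psi_rad smooth_on_shift)

text \<open>The interior content of being a solution: integrable time slices, continuity in time
  after pairing, bounds on compact time intervals, and the equation against products of test
  functions. All of it passes to differences of solutions.\<close>

locale weak_wave =
  fixes \<Omega> :: "'a::euclidean_space set" and T :: real and u :: "real \<Rightarrow> 'a \<Rightarrow> real"
  assumes dom: "open \<Omega>" "bounded \<Omega>"
    and u_int: "\<And>t. t \<in> {-T<..<T} \<Longrightarrow> integrable (lebesgue_on \<Omega>) (u t)"
    and u_cont: "\<And>\<psi> C. \<psi> \<in> borel_measurable (lebesgue_on \<Omega>) \<Longrightarrow> (\<And>x. x \<in> \<Omega> \<Longrightarrow> \<bar>\<psi> x\<bar> \<le> C) \<Longrightarrow>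
      continuous_on {-T<..<T} (\<lambda>t. LINT x|lebesgue_on \<Omega>. u t x * \<psi> x)"
    and u_bound: "\<And>c. c < T \<Longrightarrow> \<exists>C. \<forall>t\<in>{-c..c}. (LINT x|lebesgue_on \<Omega>. \<bar>u t x\<bar>) \<le> C"
    and u_wave: "\<And>\<theta> \<psi>. \<theta> \<in> test_functions {-T<..<T} \<Longrightarrow> \<psi> \<in> test_functions \<Omega> \<Longrightarrow>
      (LINT t|lebesgue_on {-T<..<T}. deriv (deriv \<theta>) t * (LINT x|lebesgue_on \<Omega>. u t x * \<psi> x)) =
      (LINT t|lebesgue_on {-T<..<T}. \<theta> t * (LINT x|lebesgue_on \<Omega>. u t x * lap \<psi> x))"
begin

lemma u_cont_continuous:
  assumes "continuous_on UNIV \<psi>"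
  shows "continuous_on {-T<..<T} (\<lambda>t. LINT x|lebesgue_on \<Omega>. u t x * \<psi> x)"
proof -
  obtain C where "\<And>x. x \<in> \<Omega> \<Longrightarrow> \<bar>\<psi> x\<bar> \<le> C" by (rule continuous_bounded_on_bounded[OF assms dom(2)]) blast
  then show ?thesis by (rule u_cont[OF continuous_on_imp_measurable_lebesgue_on[OF assms]])
qed

text \<open>Test functions may be altered freely where \<open>u t\<close> vanishes. This tolerates
  both the artificial \<open>q\<close> and the failure of the one-dimensional reduction near the
  centre.\<close>

lemma LINT_cong_far:
  assumes t: "t \<in> {-T<..<T}" and v: "AE x in lebesgue_on \<Omega>. x \<in> B \<longrightarrow> u t x = 0"
    and c: "continuous_on UNIV f" "continuous_on UNIV h" and eq: "\<And>x. x \<notin> B \<Longrightarrow> f x = h x"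
  shows "(LINT x|lebesgue_on \<Omega>. u t x * f x) = (LINT x|lebesgue_on \<Omega>. u t x * h x)"
proof (rule integral_cong_AE)
  show "(\<lambda>x. u t x * f x) \<in> borel_measurable (lebesgue_on \<Omega>)"
    by (rule borel_measurable_integrable[OF mult_continuous_integrable[OF u_int[OF t] dom(2) c(1)]])
  show "(\<lambda>x. u t x * h x) \<in> borel_measurable (lebesgue_on \<Omega>)"
    by (rule borel_measurable_integrable[OF mult_continuous_integrable[OF u_int[OF t] dom(2) c(2)]])
  show "AE x in lebesgue_on \<Omega>. u t x * f x = u t x * h x"
    using v
  proof (rule eventually_mono)
    fix x assume "x \<in> B \<longrightarrow> u t x = 0"
    then show "u t x * f x = u t x * h x" using eq[of x] by (cases "x \<in> B") auto
  qed
qed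

text \<open>The spherical waves \<open>psi_rad\<close> with profile \<open>F\<close> reduce the claim to the one-dimensional wave
  equation in \<open>(t, r)\<close>; the function \<open>q\<close> only modifies them where \<open>u\<close> vanishes.\<close>

lemma spherical_waves_orthogonal:
  assumes \<epsilon>: "0 < \<epsilon>" "\<epsilon> \<le> \<rho>" and sub: "cball y \<rho> \<subseteq> \<Omega>" and ab: "b + \<rho> < a" "a \<le> T" and t0: "t0 \<in> {-b<..<b}"
    and van: "\<And>t. t \<in> {-a<..<a} \<Longrightarrow> AE x in lebesgue_on \<Omega>. x \<in> ball y \<epsilon> \<longrightarrow> u t x = 0"
    and q: "smooth_on UNIV q" "\<And>\<sigma>. \<sigma> \<ge> d \<Longrightarrow> q \<sigma> = sqrt \<sigma>" and d: "0 < d" "d < \<epsilon>\<^sup>2"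
    and F: "admissible \<rho> F"
  shows "(LINT x|lebesgue_on \<Omega>. u t0 x * rad y (psi_rad DIM('a) \<rho> q F) x) = 0"
proof -
  let ?n = "DIM('a)"
  \<comment> \<open>Strictly between \<open>b + \<rho>\<close> and \<open>a\<close>: the closed
    interval fits into the region of vanishing, and removing \<rho> at each end still leaves more
    than the interval up to \<open>b\<close>.\<close>
  define c where "c = (b + \<rho> + a) / 2"
  have c: "b + \<rho> < c" "c < a" "c < T" "0 < c" using ab t0 \<epsilon> by (auto simp: c_def)
  have I: "{-c..c} \<subseteq> {-T<..<T}" using c by auto
  define m where "m F t = (LINT x|lebesgue_on \<Omega>. u t x * rad y (psi_rad ?n \<rho> q F) x)" for F t
  have mk: "m (\<lambda>r. F (r + l)) t = (LINT x|lebesgue_on \<Omega>. u t x * rad y (kern ?n \<rho> q F l) x)" for F l t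
    by (simp add: m_def kern_def)
  have far: "\<epsilon>\<^sup>2 \<le> (x - y) \<bullet> (x - y)" if "x \<notin> ball y \<epsilon>" for x
  proof -
    have "\<epsilon> \<le> norm (x - y)" using that by (simp add: dist_norm norm_minus_commute)
    then have "\<epsilon>\<^sup>2 \<le> (norm (x - y))\<^sup>2" using \<epsilon>(1) by (intro power_mono) auto
    then show ?thesis by (simp add: power2_norm_eq_inner)
  qed
  have d\<rho>: "d \<le> \<rho>\<^sup>2" using d(2) power_mono[OF \<epsilon>(2), of 2] \<epsilon>(1) by linarith
  have van': "AE x in lebesgue_on \<Omega>. x \<in> ball y \<epsilon> \<longrightarrow> u t x = 0" if "t \<in> {-c..c}" for t
    by (rule van) (use that c in auto)
  have cr: "continuous_on UNIV (rad y (psi_rad ?n \<rho> q F))" if "smooth_on UNIV F" for F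
    by (rule continuous_on_rad[OF smooth_on_psi_rad[OF that q(1)]])
  have ck: "continuous_on UNIV (rad y (kern ?n \<rho> q F l))" if "smooth_on UNIV F" for F l
    by (rule continuous_on_rad[OF smooth_on_kern[OF q(1) that]])
  obtain C where C: "\<And>t. t \<in> {-c..c} \<Longrightarrow> (LINT x|lebesgue_on \<Omega>. \<bar>u t x\<bar>) \<le> C" using u_bound[OF c(3)] by blast
  have D: "((\<lambda>l. m (\<lambda>r. F (r + l)) t) has_real_derivative m (\<lambda>r. deriv F (r + l)) t) (at l within {0..\<rho> - \<epsilon>})"
    if F: "admissible \<rho> F" and t: "t \<in> {-c..c}" and l: "l \<in> {0..\<rho> - \<epsilon>}" for F t l
  proof -
    from F have sF: "smooth_on UNIV F" "smooth_on UNIV (deriv F)" by (auto simp: admissible_def smooth_on_deriv)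
    have bL: "bounded {0..\<rho> - \<epsilon>}" by simp
    obtain C1 where C1: "\<And>l x. l \<in> {0..\<rho> - \<epsilon>} \<Longrightarrow> x \<in> \<Omega> \<Longrightarrow> \<bar>rad y (kern ?n \<rho> q F l) x\<bar> \<le> C1"
      by (rule kern_bounded[OF q(1) sF(1) bL dom(2)]) blast
    obtain C2 where C2: "\<And>l x. l \<in> {0..\<rho> - \<epsilon>} \<Longrightarrow> x \<in> \<Omega> \<Longrightarrow> \<bar>rad y (kern ?n \<rho> q (deriv F) l) x\<bar> \<le> C2"
      by (rule kern_bounded[OF q(1) sF(2) bL dom(2)]) blast
    show ?thesis
      unfolding mk
    proof (rule integral_has_real_derivative[where C = "max C1 C2"])
      show "integrable (lebesgue_on \<Omega>) (u t)" using t I by (intro u_int) blast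
      show "rad y (kern ?n \<rho> q F l) \<in> borel_measurable (lebesgue_on \<Omega>)" for l
        by (rule continuous_on_imp_measurable_lebesgue_on[OF ck[OF sF(1)]])
      show "rad y (kern ?n \<rho> q (deriv F) l) \<in> borel_measurable (lebesgue_on \<Omega>)"
        by (rule continuous_on_imp_measurable_lebesgue_on[OF ck[OF sF(2)]])
      fix l x assume lx: "l \<in> {0..\<rho> - \<epsilon>}" "x \<in> space (lebesgue_on \<Omega>)"
      then have x: "x \<in> \<Omega>" by simp
      show "\<bar>rad y (kern ?n \<rho> q F l) x\<bar> \<le> max C1 C2" using C1[OF lx(1) x] by simp
      show "\<bar>rad y (kern ?n \<rho> q (deriv F) l) x\<bar> \<le> max C1 C2" using C2[OF lx(1) x] by simp
      show "((\<lambda>l. rad y (kern ?n \<rho> q F l) x) has_real_derivative rad y (kern ?n \<rho> q (deriv F) l) x) (at l within {0..\<rho> - \<epsilon>})"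
        unfolding rad_def by (rule DERIV_subset[OF kern_has_derivative[OF q(1) sF(1)]]) simp
    qed (use l in auto)
  qed
  \<comment> \<open>The zero region is r < \<epsilon>: a profile supported there yields a wave
    inside the ball on which \<open>u\<close> vanishes.\<close>
  interpret W: wave_1d m "-c" c \<epsilon> \<rho>
  proof
    show "\<epsilon> \<le> \<rho>" by (rule \<epsilon>(2))
  next
    fix F t l assume "admissible \<rho> F" "t \<in> {-c..c}" "l \<in> {0..\<rho> - \<epsilon>}"
    then show "((\<lambda>l. m (\<lambda>r. F (r + l)) t) has_real_derivative m (\<lambda>r. deriv F (r + l)) t) (at l within {0..\<rho> - \<epsilon>})"
      by (rule D)
  next
    fix F assume F: "admissible \<rho> F"
    then have sF: "smooth_on UNIV F" "smooth_on UNIV (deriv F)" by (auto simp: admissible_def smooth_on_deriv)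
    have bL: "bounded {0..\<rho> - \<epsilon>}" by simp
    obtain C2 where C2: "C2 \<ge> 0" "\<And>l x. l \<in> {0..\<rho> - \<epsilon>} \<Longrightarrow> x \<in> \<Omega> \<Longrightarrow> \<bar>rad y (kern ?n \<rho> q (deriv F) l) x\<bar> \<le> C2"
      by (rule kern_bounded[OF q(1) sF(2) bL dom(2)]) blast
    show "continuous_on ({0..\<rho> - \<epsilon>} \<times> {-c..c}) (\<lambda>(l, t). m (\<lambda>r. F (r + l)) t)"
    proof (rule continuous_on_Times_lipschitz[where L = "C2 * C"])
      fix l show "continuous_on {-c..c} (m (\<lambda>r. F (r + l)))"
        unfolding mk[abs_def] by (rule continuous_on_subset[OF u_cont_continuous[OF ck[OF sF(1)]] I])
    next
      fix t l l' assume t: "t \<in> {-c..c}" and l: "l \<in> {0..\<rho> - \<epsilon>}" "l' \<in> {0..\<rho> - \<epsilon>}"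
      \<comment> \<open>Lipschitz in \<open>l\<close> uniformly in \<open>t\<close>: the derivative
        pairs \<open>u t\<close> with the kernel of \<open>deriv F\<close>, which is at most the
        supremum of that kernel times the bound \<open>C\<close> on the integral of the absolute
        value of \<open>u t\<close>.\<close>
      have "norm (m (\<lambda>r. F (r + l)) t - m (\<lambda>r. F (r + l')) t) \<le> C2 * C * norm (l - l')"
      proof (rule field_differentiable_bound[where S = "{0..\<rho> - \<epsilon>}"])
        fix l assume l: "l \<in> {0..\<rho> - \<epsilon>}"
        show "((\<lambda>l. m (\<lambda>r. F (r + l)) t) has_real_derivative m (\<lambda>r. deriv F (r + l)) t) (at l within {0..\<rho> - \<epsilon>})"
          by (rule D[OF F t l])
        have "\<bar>m (\<lambda>r. deriv F (r + l)) t\<bar> \<le> C2 * (LINT x|lebesgue_on \<Omega>. \<bar>u t x\<bar>)"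
          unfolding mk
        proof (rule abs_integral_mult_le)
          show "integrable (lebesgue_on \<Omega>) (u t)" using t I by (intro u_int) blast
          show "rad y (kern ?n \<rho> q (deriv F) l) \<in> borel_measurable (lebesgue_on \<Omega>)"
            by (rule continuous_on_imp_measurable_lebesgue_on[OF ck[OF sF(2)]])
          show "\<bar>rad y (kern ?n \<rho> q (deriv F) l) x\<bar> \<le> C2" if "x \<in> space (lebesgue_on \<Omega>)" for x
            using C2(2)[OF l, of x] that by simp
        qed
        also have "\<dots> \<le> C2 * C" using C[OF t] C2(1) by (rule mult_left_mono)
        finally show "norm (m (\<lambda>r. deriv F (r + l)) t) \<le> C2 * C" by simp
      qed (use l in auto)
      then show "\<bar>m (\<lambda>r. F (r + l)) t - m (\<lambda>r. F (r + l')) t\<bar> \<le> C2 * C * \<bar>l - l'\<bar>" by simp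
    qed
  next
    fix \<theta> F assume \<theta>: "smooth_on UNIV \<theta>" "\<And>t. t \<notin> {-c..c} \<Longrightarrow> \<theta> t = 0" and F: "admissible \<rho> F"
    have sF: "smooth_on UNIV F" "smooth_on UNIV (deriv (deriv F))" and F0: "\<And>r. r \<ge> \<rho> \<Longrightarrow> F r = 0"
      using F by (auto simp: admissible_def smooth_on_deriv)
    have \<theta>'': "smooth_on UNIV (deriv (deriv \<theta>))" using \<theta>(1) by (auto simp: smooth_on_deriv)
    have z'': "deriv (deriv \<theta>) t = 0" if "t \<notin> {-c..c}" for t
      by (rule deriv_zero_outside[OF deriv_zero_outside[OF \<theta>(2)] that])
    let ?\<psi> = "rad y (psi_rad ?n \<rho> q F)"
    have "(\<lambda>x. ?\<psi> x * 1) \<in> test_functions \<Omega>"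
      by (rule rad_test_function[where R = \<rho>]) (use psi_rad_zero[OF sF(1) F0 q d\<rho>] \<epsilon> sub smooth_on_psi_rad[OF sF(1) q(1)] in auto)
    then have \<psi>: "?\<psi> \<in> test_functions \<Omega>" by simp
    have cl: "continuous_on UNIV (lap ?\<psi>)"
      unfolding lap_def[abs_def]
      by (intro continuous_on_sum smooth_on_continuous_on smooth_on_partial test_functions_smooth[OF \<psi>])
    \<comment> \<open>Outside the ball of radius \<epsilon> the squared distance exceeds
      \<open>d\<close>, so \<open>lap_psi_rad\<close> applies; inside, the two functions may differ
      but \<open>u t\<close> vanishes.\<close>
    have lap: "(LINT x|lebesgue_on \<Omega>. u t x * lap ?\<psi> x) = m (deriv (deriv F)) t" if t: "t \<in> {-c..c}" for t
      unfolding m_def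
    proof (rule LINT_cong_far[OF _ van'[OF t] cl cr[OF sF(2)]])
      show "t \<in> {-T<..<T}" using t I by blast
      fix x assume "x \<notin> ball y \<epsilon>"
      then have "d < (x - y) \<bullet> (x - y)" using far d(2) by fastforce
      then show "lap ?\<psi> x = rad y (psi_rad ?n \<rho> q (deriv (deriv F))) x"
        using lap_psi_rad[OF sF(1) F0 q d(1) d\<rho>] \<epsilon> by simp
    qed
    have "(LINT t|lebesgue_on {-T<..<T}. deriv (deriv \<theta>) t * m F t) = (LINT t|lebesgue_on {-T<..<T}. \<theta> t * (LINT x|lebesgue_on \<Omega>. u t x * lap ?\<psi> x))"
      unfolding m_def by (rule u_wave[OF time_test_function[OF \<theta> I] \<psi>])
    moreover have "(LINT t|lebesgue_on {-T<..<T}. deriv (deriv \<theta>) t * m F t) = integral {-c..c} (\<lambda>t. deriv (deriv \<theta>) t * m F t)"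
    proof (rule LINT_continuous_on_eq_integral[OF _ I])
      show "continuous_on {-c..c} (\<lambda>t. deriv (deriv \<theta>) t * m F t)"
        unfolding m_def
        by (intro continuous_on_mult smooth_on_continuous_on_UNIV[OF \<theta>''] continuous_on_subset[OF u_cont_continuous[OF cr[OF sF(1)]] I])
    qed (use z'' in auto)
    moreover have "(LINT t|lebesgue_on {-T<..<T}. \<theta> t * (LINT x|lebesgue_on \<Omega>. u t x * lap ?\<psi> x)) = integral {-c..c} (\<lambda>t. \<theta> t * (LINT x|lebesgue_on \<Omega>. u t x * lap ?\<psi> x))"
    proof (rule LINT_continuous_on_eq_integral[OF _ I])
      show "continuous_on {-c..c} (\<lambda>t. \<theta> t * (LINT x|lebesgue_on \<Omega>. u t x * lap ?\<psi> x))"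
        by (intro continuous_on_mult smooth_on_continuous_on_UNIV[OF \<theta>(1)] continuous_on_subset[OF u_cont_continuous[OF cl] I])
    qed (use \<theta>(2) in auto)
    moreover have "integral {-c..c} (\<lambda>t. \<theta> t * (LINT x|lebesgue_on \<Omega>. u t x * lap ?\<psi> x)) = integral {-c..c} (\<lambda>t. \<theta> t * m (deriv (deriv F)) t)"
      by (rule integral_cong) (simp only: lap)
    ultimately show "integral {-c..c} (\<lambda>t. deriv (deriv \<theta>) t * m F t) = integral {-c..c} (\<lambda>t. \<theta> t * m (deriv (deriv F)) t)"
      by (simp only:)
  next
    fix F t assume F: "admissible \<rho> F" "\<And>r. r \<ge> \<epsilon> \<Longrightarrow> F r = 0" and t: "t \<in> {-c..c}"
    have sF: "smooth_on UNIV F" using F by (simp add: admissible_def)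
    have "m F t = (LINT x|lebesgue_on \<Omega>. u t x * 0)"
      unfolding m_def
    proof (rule LINT_cong_far[OF _ van'[OF t] cr[OF sF] continuous_on_const])
      show "t \<in> {-T<..<T}" using t I by blast
      fix x assume "x \<notin> ball y \<epsilon>"
      then show "rad y (psi_rad ?n \<rho> q F) x = 0"
        unfolding rad_def by (intro psi_rad_zero[OF sF F(2) q _ _ far]) (use d \<epsilon> in auto)
    qed
    then show "m F t = 0" by simp
  qed
  \<comment> \<open>The time lost is \<open>\<rho> - \<epsilon>\<close> on each side, which
    \<open>b + \<rho> < c\<close> pays for.\<close>
  have "m F t0 = 0"
  proof (rule fundamental_lemma_time[where f = "m F" and t = t0 and \<alpha>' = "-c + (\<rho> - \<epsilon>)" and \<beta>' = "c - (\<rho> - \<epsilon>)"])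
    show "continuous_on {-c..c} (m F)"
      using F unfolding m_def admissible_def by (intro continuous_on_subset[OF u_cont_continuous[OF cr] I]) blast
    show "t0 \<in> {-c + (\<rho> - \<epsilon>)<..<c - (\<rho> - \<epsilon>)}" using t0 c \<epsilon> by auto
    show "integral {-c..c} (\<lambda>t. \<theta> t * m F t) = 0"
      if "smooth_on UNIV \<theta>" "\<And>t. t \<notin> {-c + (\<rho> - \<epsilon>)..c - (\<rho> - \<epsilon>)} \<Longrightarrow> \<theta> t = 0" for \<theta>
      by (rule W.wave_1d_unique[OF that F])
  qed (use \<epsilon> in auto)
  then show ?thesis by (simp add: m_def)
qed

text \<open>The surplus \<epsilon> makes room for moving the centre: for every \<open>y\<close>
  within \<epsilon> of \<open>x0\<close>, the ball of radius \<epsilon> about \<open>y\<close> is in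
  the region of vanishing and the closed ball of radius \<rho> is in the domain. The cost in time is
  \<rho>, however small \<epsilon> is, and so the cone has the right slope.\<close>

theorem local_unique_continuation:
  assumes \<epsilon>: "0 < \<epsilon>" "\<epsilon> \<le> \<rho>" and sub: "cball x0 (\<rho> + \<epsilon>) \<subseteq> \<Omega>" and ab: "b + \<rho> < a" "a \<le> T"
    and van: "\<And>t. t \<in> {-a<..<a} \<Longrightarrow> AE x in lebesgue_on \<Omega>. x \<in> ball x0 (2 * \<epsilon>) \<longrightarrow> u t x = 0"
    and t0: "t0 \<in> {-b<..<b}"
  shows "AE x in lebesgue_on \<Omega>. x \<in> ball x0 \<rho> \<longrightarrow> u t0 x = 0"
proof -
  interpret R: radial_vanishing \<Omega> x0 \<epsilon> \<rho> "DIM('a)"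
    using dom \<epsilon> by unfold_locales auto
  have tT: "t0 \<in> {-T<..<T}" "t0 \<in> {-a<..<a}" using t0 ab \<epsilon> by auto
  have "R.vanish (u t0)"
    unfolding R.vanish_def
  proof (intro conjI ballI allI impI)
    show "integrable (lebesgue_on \<Omega>) (u t0)" by (rule u_int[OF tT(1)])
    fix y g assume y: "y \<in> ball x0 \<epsilon>" and g: "smooth_on UNIV g" "\<forall>\<sigma>\<ge>\<rho>\<^sup>2. g \<sigma> = 0"
    have b1: "ball y \<epsilon> \<subseteq> ball x0 (2 * \<epsilon>)"
    proof
      fix x assume "x \<in> ball y \<epsilon>"
      then show "x \<in> ball x0 (2 * \<epsilon>)" using y dist_triangle[of x0 x y] by simp
    qed
    have b2: "cball y \<rho> \<subseteq> \<Omega>"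
    proof
      fix x assume "x \<in> cball y \<rho>"
      then have "x \<in> cball x0 (\<rho> + \<epsilon>)" using y dist_triangle[of x0 x y] by simp
      then show "x \<in> \<Omega>" using sub by blast
    qed
    have van': "AE x in lebesgue_on \<Omega>. x \<in> ball y \<epsilon> \<longrightarrow> u t x = 0" if "t \<in> {-a<..<a}" for t
      using van[OF that] by (rule eventually_mono) (use b1 in blast)
    define d where "d = \<epsilon>\<^sup>2 / 2"
    have d: "0 < d" "d < \<epsilon>\<^sup>2" using \<epsilon>(1) by (auto simp: d_def)
    obtain q where q: "smooth_on UNIV q" "\<And>\<sigma>. \<sigma> \<ge> d \<Longrightarrow> q \<sigma> = sqrt \<sigma>"
      by (rule smooth_sqrt_exists[OF d(1)]) blast
    \<comment> \<open>Inverting the construction of \<open>psi_rad\<close>: for F (r) = f (r^2) the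
      composition of \<open>F\<close> with \<open>q\<close> is \<open>f\<close> beyond
      \<open>d\<close>, and its derivative of order \<open>N\<close> there is the given
      \<open>g\<close>. Hence spherical waves realise all profiles that \<open>vanish\<close>
      demands.\<close>
    obtain f where f: "smooth_on UNIV f" "(deriv ^^ DIM('a)) f = g" "\<And>\<sigma>. \<sigma> \<ge> \<rho>\<^sup>2 \<Longrightarrow> f \<sigma> = 0"
      using smooth_on_higher_antiderivative[OF g(1), of "\<rho>\<^sup>2" "DIM('a)"] g(2) by blast
    define F where "F r = f (r\<^sup>2)" for r
    have sF: "smooth_on UNIV F"
      unfolding F_def[abs_def] by (rule smooth_on_compose_UNIV[OF f(1)]) (auto intro: smooth_on_power)
    have F: "admissible \<rho> F"
      unfolding admissible_def using sF f(3) \<epsilon> by (auto simp: F_def intro!: power_mono)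
    have "(LINT x|lebesgue_on \<Omega>. u t0 x * rad y (phi DIM('a) \<rho> g) x) = (LINT x|lebesgue_on \<Omega>. u t0 x * rad y (psi_rad DIM('a) \<rho> q F) x)"
    proof (rule LINT_cong_far[OF tT(1) van'[OF tT(2)] continuous_on_rad[OF smooth_on_phi[OF g(1)]] continuous_on_rad[OF smooth_on_psi_rad[OF sF q(1)]]])
      fix x assume "x \<notin> ball y \<epsilon>"
      then have "\<epsilon> \<le> norm (x - y)" by (simp add: dist_norm norm_minus_commute)
      then have "\<epsilon>\<^sup>2 \<le> (norm (x - y))\<^sup>2" using \<epsilon>(1) by (intro power_mono) auto
      then have "d < (x - y) \<bullet> (x - y)" using d by (simp add: power2_norm_eq_inner)
      show "rad y (phi DIM('a) \<rho> g) x = rad y (psi_rad DIM('a) \<rho> q F) x"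
        unfolding rad_def psi_rad_def
      proof (rule phi_cong)
        fix \<sigma> assume s: "(x - y) \<bullet> (x - y) \<le> \<sigma>"
        have "(deriv ^^ DIM('a)) f \<sigma> = (deriv ^^ DIM('a)) (\<lambda>\<sigma>. F (q \<sigma>)) \<sigma>"
        proof (rule higher_deriv_cong_open[of "{d<..}"])
          show "\<sigma> \<in> {d<..}" using s \<open>d < (x - y) \<bullet> (x - y)\<close> by simp
          fix \<sigma> assume "\<sigma> \<in> {d<..}"
          then show "f \<sigma> = F (q \<sigma>)" using q(2)[of \<sigma>] d(1) by (simp add: F_def)
        qed simp
        then show "g \<sigma> = (deriv ^^ DIM('a)) (\<lambda>\<sigma>. F (q \<sigma>)) \<sigma>" using f(2) by simp
      qed
    qed
    also have "\<dots> = 0"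
      by (rule spherical_waves_orthogonal[OF \<epsilon> b2 ab t0 van' q d F])
    finally show "(LINT x|lebesgue_on \<Omega>. u t0 x * rad y (phi DIM('a) \<rho> g) x) = 0" .
  qed
  then show ?thesis by (rule R.vanish_imp_zero)
qed

end

section \<open>Unique continuation along paths\<close>

context weak_wave
begin

text \<open>The radius may shrink as \<open>a\<close> approaches \<open>A\<close>. Thanks to this a
  step costs exactly the distance travelled, and the small surpluses needed in each step do not
  accumulate along a path.\<close>

definition vanishes_near :: "'a \<Rightarrow> real \<Rightarrow> bool" where
  "vanishes_near x A \<longleftrightarrow> (\<forall>a<A. \<exists>\<epsilon>>0. \<forall>t\<in>{-a<..<a}. AE z in lebesgue_on \<Omega>. z \<in> ball x \<epsilon> \<longrightarrow> u t z = 0)"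

text \<open>A cone over \<open>x0\<close> of radius slightly above the distance contains a
  neighbourhood of \<open>x1\<close> at every time below the remaining budget.\<close>

lemma vanishes_near_step:
  assumes van: "vanishes_near x0 A" and "A \<le> T" and R: "ball x0 R \<subseteq> \<Omega>" "dist x0 x1 < R"
  shows "vanishes_near x1 (A - dist x0 x1)"
  unfolding vanishes_near_def
proof (intro allI impI)
  let ?d = "dist x0 x1"
  fix b assume b: "b < A - ?d"
  \<comment> \<open>One \<eta> of time for staying below \<open>A\<close>, one for the radius of the
    new neighbourhood, and the rest for strictness; in space the radius grows by \<eta> and by
    \<epsilon> \<le> \<eta>, which has to stay below \<open>R\<close>.\<close>
  define \<eta> where "\<eta> = min ((A - ?d - b) / 4) ((R - ?d) / 3)"
  have \<eta>0: "\<eta> > 0" using b R(2) by (simp add: \<eta>_def)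
  have "4 * \<eta> \<le> A - ?d - b" "3 * \<eta> \<le> R - ?d" by (auto simp: \<eta>_def min_def)
  with \<eta>0 have \<eta>: "\<eta> > 0" "b + ?d + 2 * \<eta> < A" "?d + 2 * \<eta> < R" by auto
  have "A - \<eta> < A" using \<eta> by simp
  then obtain e where e: "e > 0" "\<And>t. t \<in> {-(A - \<eta>)<..<A - \<eta>} \<Longrightarrow> AE z in lebesgue_on \<Omega>. z \<in> ball x0 e \<longrightarrow> u t z = 0"
    using van unfolding vanishes_near_def by meson
  define \<epsilon> where "\<epsilon> = min (e / 2) \<eta>"
  have \<epsilon>: "0 < \<epsilon>" "2 * \<epsilon> \<le> e" "\<epsilon> \<le> \<eta>" using e(1) \<eta>(1) by (auto simp: \<epsilon>_def)
  have "AE z in lebesgue_on \<Omega>. z \<in> ball x1 \<eta> \<longrightarrow> u t z = 0" if t: "t \<in> {-b<..<b}" for t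
  proof -
    have "AE z in lebesgue_on \<Omega>. z \<in> ball x0 (?d + \<eta>) \<longrightarrow> u t z = 0"
    proof (rule local_unique_continuation[where \<epsilon> = \<epsilon> and a = "A - \<eta>"])
      show "\<epsilon> \<le> ?d + \<eta>" using \<epsilon>(3) zero_le_dist[of x0 x1] by linarith
      show "cball x0 (?d + \<eta> + \<epsilon>) \<subseteq> \<Omega>"
        using R(1) \<eta>(3) \<epsilon>(3) by (intro order_trans[OF _ R(1)]) auto
      show "b + (?d + \<eta>) < A - \<eta>" using \<eta>(2) by simp
      show "A - \<eta> \<le> T" using \<eta>(1) assms(2) by simp
      show "AE z in lebesgue_on \<Omega>. z \<in> ball x0 (2 * \<epsilon>) \<longrightarrow> u t z = 0" if "t \<in> {-(A - \<eta>)<..<A - \<eta>}" for t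
        using e(2)[OF that] by (rule eventually_mono) (use \<epsilon>(2) in auto)
    qed (use \<epsilon>(1) t in auto)
    then show ?thesis
    proof (rule eventually_mono, intro impI)
      fix z assume *: "z \<in> ball x0 (?d + \<eta>) \<longrightarrow> u t z = 0" and "z \<in> ball x1 \<eta>"
      then have "z \<in> ball x0 (?d + \<eta>)" using dist_triangle[of x0 z x1] by simp
      with * show "u t z = 0" by simp
    qed
  qed
  with \<eta>(1) show "\<exists>\<epsilon>>0. \<forall>t\<in>{-b<..<b}. AE z in lebesgue_on \<Omega>. z \<in> ball x1 \<epsilon> \<longrightarrow> u t z = 0" by blast
qed

lemma vanishes_near_mono: "vanishes_near x A \<Longrightarrow> B \<le> A \<Longrightarrow> vanishes_near x B"
  unfolding vanishes_near_def using less_le_trans by blast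

lemma vanishes_near_chain:
  assumes "vanishes_near (p 0) T" and R: "\<And>i. i < n \<Longrightarrow> ball (p i) R \<subseteq> \<Omega>" "\<And>i. i < n \<Longrightarrow> dist (p i) (p (Suc i)) < R"
  shows "j \<le> n \<Longrightarrow> vanishes_near (p j) (T - (\<Sum>i<j. dist (p i) (p (Suc i))))"
proof (induction j)
  case 0 then show ?case using assms(1) by simp
next
  case (Suc j)
  have "vanishes_near (p (Suc j)) (T - (\<Sum>i<j. dist (p i) (p (Suc i))) - dist (p j) (p (Suc j)))"
  proof (rule vanishes_near_step)
    show "vanishes_near (p j) (T - (\<Sum>i<j. dist (p i) (p (Suc i))))" using Suc by simp
    show "T - (\<Sum>i<j. dist (p i) (p (Suc i))) \<le> T" by (simp add: sum_nonneg)
    show "ball (p j) R \<subseteq> \<Omega>" "dist (p j) (p (Suc j)) < R" using R Suc.prems by auto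
  qed
  then show ?case by (simp add: algebra_simps)
qed

text \<open>Compactness gives one radius \<open>R\<close> for all balls about points of the path,
  and uniform continuity a subdivision with steps shorter than \<open>R\<close>. Each step costs a
  chord, and the chords add up to at most the length of the path.\<close>

lemma vanishes_near_path:
  assumes g: "path g" "path_image g \<subseteq> \<Omega>" "pathstart g = P" "pathfinish g = Q"
    and Q: "vanishes_near Q T" and len: "path_length g < ereal \<tau>"
  shows "vanishes_near P (T - \<tau>)"
proof -
  have cg: "continuous_on {0..1} g" using g(1) by (simp add: path_def)
  obtain R where R: "R > 0" "(\<Union>x\<in>path_image g. ball x R) \<subseteq> \<Omega>"
    using compact_subset_open_imp_ball_epsilon_subset[OF compact_path_image[OF g(1)] dom(1) g(2)] by blast
  have "uniformly_continuous_on {0..1} g"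
    by (rule compact_uniformly_continuous[OF cg]) simp
  then obtain \<delta> where \<delta>: "\<delta> > 0" "\<And>s t. s \<in> {0..1} \<Longrightarrow> t \<in> {0..1} \<Longrightarrow> dist t s < \<delta> \<Longrightarrow> dist (g t) (g s) < R"
    using R(1) unfolding uniformly_continuous_on_def by metis
  obtain n where n: "n > 0" "inverse (real n) < \<delta>"
    using reals_Archimedean[OF \<delta>(1)] by (metis zero_less_Suc)
  define s where "s i = real i / real n" for i
  have s01: "s i \<in> {0..1}" if "i \<le> n" for i using that n by (auto simp: s_def)
  have sd: "dist (s i) (s (Suc i)) < \<delta>" for i
  proof -
    have "s (Suc i) - s i = inverse (real n)"
      by (simp add: s_def inverse_eq_divide flip: diff_divide_distrib)
    then have "\<bar>s (Suc i) - s i\<bar> < \<delta>" using n by simp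
    then show ?thesis by (simp add: dist_real_def abs_minus_commute)
  qed
  have gd: "dist (g (s (Suc i))) (g (s i)) < R" if "i < n" for i
    using that sd[of i] by (intro \<delta>(2) s01) (auto simp: dist_commute)
  \<comment> \<open>The chain runs backwards: information starts at the end point \<open>Q\<close>
    and travels to \<open>P\<close>.\<close>
  define p where "p j = g (s (n - j))" for j
  have pd: "dist (p i) (p (Suc i)) = dist (g (s (n - Suc i))) (g (s (Suc (n - Suc i))))" if "i < n" for i
    using that by (simp add: p_def dist_commute Suc_diff_Suc)
  have "vanishes_near (p n) (T - (\<Sum>i<n. dist (p i) (p (Suc i))))"
  proof (rule vanishes_near_chain)
    have "p 0 = Q" using g(4) n(1) by (simp add: p_def s_def pathfinish_def)
    then show "vanishes_near (p 0) T" using Q by simp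
    fix i assume i: "i < n"
    have "p i \<in> path_image g" using s01[of "n - i"] by (auto simp: p_def path_image_def)
    then show "ball (p i) R \<subseteq> \<Omega>" using R(2) by blast
    show "dist (p i) (p (Suc i)) < R" unfolding pd[OF i] using gd[of "n - Suc i"] i by (simp add: dist_commute)
  qed simp
  moreover have "p n = P" using g(3) by (simp add: p_def s_def pathstart_def)
  moreover have "(\<Sum>i<n. dist (p i) (p (Suc i))) \<le> \<tau>"
  proof -
    have "(\<Sum>i<n. dist (p i) (p (Suc i))) = (\<Sum>i<n. dist (g (s (n - Suc i))) (g (s (Suc (n - Suc i)))))"
      by (rule sum.cong) (auto simp: pd)
    also have "\<dots> = (\<Sum>i<n. dist (g (s i)) (g (s (Suc i))))"
      by (rule sum.nat_diff_reindex)
    finally have eq: "(\<Sum>i<n. dist (p i) (p (Suc i))) = (\<Sum>i<n. dist (g (s i)) (g (s (Suc i))))" .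
    have m: "(n, s) \<in> {(n::nat, t). (\<forall>i\<le>n. t i \<in> {0..1}) \<and> (\<forall>i<n. t i \<le> t (Suc i))}"
      using s01 by (auto simp: s_def divide_right_mono)
    have "ereal (\<Sum>i<n. dist (g (s i)) (g (s (Suc i)))) \<le> path_length g"
      unfolding path_length_def using SUP_upper[OF m, of "\<lambda>(n, t). ereal (\<Sum>i<n. dist (g (t i)) (g (t (Suc i))))"] by simp
    then show ?thesis using len eq by (metis ereal_less_eq(3) le_less_trans less_imp_le)
  qed
  ultimately show ?thesis by (metis diff_left_mono vanishes_near_mono)
qed

text \<open>The strict bound on the supremum yields for every \<open>P\<close> a path to the
  observation set shorter than \<tau>. The radius obtained depends on \<open>P\<close>, and this
  suffices for a local statement.\<close>

theorem unique_continuation: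
  assumes \<omega>: "open \<omega>" and van: "\<And>t. t \<in> {-T<..<T} \<Longrightarrow> AE x in lebesgue_on \<Omega>. x \<in> \<omega> \<longrightarrow> u t x = 0"
    and \<tau>: "T_max \<Omega> \<omega> < ereal \<tau>" and t: "t \<in> {-(T - \<tau>)<..<T - \<tau>}"
  shows "AE x in lebesgue_on \<Omega>. u t x = 0"
proof (rule AE_lebesgue_on_locally[OF dom(1)])
  fix P assume P: "P \<in> \<Omega>"
  have "gd_set \<Omega> P \<omega> \<le> T_max \<Omega> \<omega>" unfolding T_max_def by (rule SUP_upper[OF P])
  then have "gd_set \<Omega> P \<omega> < ereal \<tau>" using \<tau> by (rule le_less_trans)
  then obtain Q where Q: "Q \<in> \<omega>" "gd \<Omega> P Q < ereal \<tau>"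
    unfolding gd_set_def INF_less_iff by blast
  then obtain g where g: "path g" "path_image g \<subseteq> \<Omega>" "pathstart g = P" "pathfinish g = Q" "path_length g < ereal \<tau>"
    unfolding gd_def INF_less_iff by blast
  obtain e where e: "e > 0" "ball Q e \<subseteq> \<omega>" by (rule openE[OF \<omega> Q(1)])
  have "vanishes_near Q T"
    unfolding vanishes_near_def
  proof (intro allI impI exI[of _ e] conjI ballI e(1))
    fix a t assume "a < T" "t \<in> {-a<..<a}"
    then have "t \<in> {-T<..<T}" by auto
    from van[OF this] show "AE z in lebesgue_on \<Omega>. z \<in> ball Q e \<longrightarrow> u t z = 0"
      by (rule eventually_mono) (use e(2) in blast)
  qed
  then have v: "vanishes_near P (T - \<tau>)" by (rule vanishes_near_path[OF g(1-4) _ g(5)])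
  \<comment> \<open>\<open>vanishes_near\<close> speaks about every bound strictly below
    \<open>T - \<tau>\<close>, so one is chosen between \<bar>t\<bar> and it.\<close>
  define a where "a = (\<bar>t\<bar> + (T - \<tau>)) / 2"
  have "\<bar>t\<bar> < T - \<tau>" using t by auto
  then have "a < T - \<tau>" "\<bar>t\<bar> < a" by (auto simp: a_def)
  then have "a < T - \<tau>" "t \<in> {-a<..<a}" by auto
  with v show "\<exists>r>0. AE x in lebesgue_on \<Omega>. x \<in> ball P r \<longrightarrow> u t x = 0"
    unfolding vanishes_near_def by meson
qed

end

section \<open>Square integrable functions and weak gradients\<close>

lemma L2_spaceD: "u \<in> L2_space \<Omega> \<Longrightarrow> u \<in> borel_measurable (lebesgue_on \<Omega>)" "u \<in> L2_space \<Omega> \<Longrightarrow> integrable (lebesgue_on \<Omega>) (\<lambda>x. (u x)\<^sup>2)"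
  by (auto simp: L2_space_def)

lemma L2_mult_integrable:
  assumes "u \<in> L2_space \<Omega>" "v \<in> L2_space \<Omega>"
  shows "integrable (lebesgue_on \<Omega>) (\<lambda>x. u x * v x)"
proof (rule Bochner_Integration.integrable_bound[of _ "\<lambda>x. (u x)\<^sup>2 + (v x)\<^sup>2"])
  show "integrable (lebesgue_on \<Omega>) (\<lambda>x. (u x)\<^sup>2 + (v x)\<^sup>2)"
    by (intro Bochner_Integration.integrable_add L2_spaceD(2) assms)
  show "(\<lambda>x. u x * v x) \<in> borel_measurable (lebesgue_on \<Omega>)"
    by (intro borel_measurable_times L2_spaceD(1) assms)
  have "\<bar>a * b\<bar> \<le> a\<^sup>2 + b\<^sup>2" for a b :: real
  proof -
    have "0 \<le> (\<bar>a\<bar> - \<bar>b\<bar>)\<^sup>2" "0 \<le> a\<^sup>2 + b\<^sup>2" by simp_all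
    then have "2 * (\<bar>a\<bar> * \<bar>b\<bar>) \<le> a\<^sup>2 + b\<^sup>2" by (simp add: power2_diff)
    moreover have "0 \<le> \<bar>a\<bar> * \<bar>b\<bar>" by simp
    ultimately show ?thesis unfolding abs_mult by linarith
  qed
  then show "AE x in lebesgue_on \<Omega>. norm (u x * v x) \<le> norm ((u x)\<^sup>2 + (v x)\<^sup>2)" by (intro AE_I2) simp
qed

lemma L2_linear:
  assumes "u \<in> L2_space \<Omega>" "v \<in> L2_space \<Omega>"
  shows "(\<lambda>x. a * u x + b * v x) \<in> L2_space \<Omega>"
proof -
  have eq: "(\<lambda>x. (a * u x + b * v x)\<^sup>2) = (\<lambda>x. a\<^sup>2 * (u x)\<^sup>2 + (2 * a * b) * (u x * v x) + b\<^sup>2 * (v x)\<^sup>2)"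
    by (auto simp: fun_eq_iff power2_eq_square algebra_simps)
  show ?thesis
    unfolding L2_space_def mem_Collect_eq eq
    using L2_spaceD[OF assms(1)] L2_spaceD[OF assms(2)] L2_mult_integrable[OF assms] by auto
qed

lemma L2_diff: "u \<in> L2_space \<Omega> \<Longrightarrow> v \<in> L2_space \<Omega> \<Longrightarrow> (\<lambda>x. u x - v x) \<in> L2_space \<Omega>"
  using L2_linear[of u \<Omega> v 1 "-1"] by simp

text \<open>The algebra behind both Cauchy-Schwarz inequalities below; a vanishing leading
  coefficient is allowed, as happens for functions of norm zero.\<close>

lemma quadratic_nonneg_imp_discriminant:
  fixes a b c :: real
  assumes "\<And>s. 0 \<le> a - 2 * s * b + s\<^sup>2 * c" "a \<ge> 0" "c \<ge> 0"
  shows "\<bar>b\<bar> \<le> sqrt a * sqrt c"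
proof -
  have "b\<^sup>2 \<le> a * c"
  proof (cases "c = 0")
    case True
    have "b = 0"
    proof (rule ccontr)
      assume "b \<noteq> 0"
      \<comment> \<open>For \<open>c = 0\<close> this argument gives the expression the value a - (a
        + 1) = -1.\<close>
      then show False using assms(1)[of "(a + 1) / (2 * b)"] True by (simp add: field_simps)
    qed
    then show ?thesis using assms by simp
  next
    case False
    then have c: "c > 0" using assms(3) by simp
    have "0 \<le> a - 2 * (b / c) * b + (b / c)\<^sup>2 * c" by (rule assms(1))
    also have "\<dots> = a - b\<^sup>2 / c" using c by (simp add: field_simps power2_eq_square)
    finally show ?thesis using c by (simp add: field_simps)
  qed
  then have "sqrt (b\<^sup>2) \<le> sqrt (a * c)" by (rule real_sqrt_le_mono)
  then show ?thesis by (simp add: real_sqrt_mult)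
qed

lemma L2_Cauchy_Schwarz:
  assumes "u \<in> L2_space \<Omega>" "v \<in> L2_space \<Omega>"
  shows "\<bar>LINT x|lebesgue_on \<Omega>. u x * v x\<bar> \<le> norm_L2 \<Omega> u * norm_L2 \<Omega> v"
  unfolding norm_L2_def
proof (rule quadratic_nonneg_imp_discriminant)
  fix s :: real
  have "0 \<le> (LINT x|lebesgue_on \<Omega>. (u x - s * v x)\<^sup>2)" by simp
  also have "\<dots> = (LINT x|lebesgue_on \<Omega>. ((u x)\<^sup>2 - 2 * s * (u x * v x)) + s\<^sup>2 * (v x)\<^sup>2)"
    by (rule Bochner_Integration.integral_cong) (auto simp: power2_eq_square algebra_simps)
  also have "\<dots> = (LINT x|lebesgue_on \<Omega>. (u x)\<^sup>2) - 2 * s * (LINT x|lebesgue_on \<Omega>. u x * v x) + s\<^sup>2 * (LINT x|lebesgue_on \<Omega>. (v x)\<^sup>2)"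
    using L2_spaceD(2)[OF assms(1)] L2_spaceD(2)[OF assms(2)] L2_mult_integrable[OF assms] by simp
  finally show "0 \<le> (LINT x|lebesgue_on \<Omega>. (u x)\<^sup>2) - 2 * s * (LINT x|lebesgue_on \<Omega>. u x * v x) + s\<^sup>2 * (LINT x|lebesgue_on \<Omega>. (v x)\<^sup>2)" .
qed auto

lemma norm_L2_zero_imp_AE:
  assumes "u \<in> L2_space \<Omega>" "norm_L2 \<Omega> u = 0"
  shows "AE x in lebesgue_on \<Omega>. u x = 0"
proof -
  have "AE x in lebesgue_on \<Omega>. (u x)\<^sup>2 = 0"
    using integral_nonneg_eq_0_iff_AE[OF L2_spaceD(2)[OF assms(1)]] assms(2) by (simp add: norm_L2_def)
  then show ?thesis by simp
qed

locale bounded_domain =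
  fixes \<Omega> :: "'a::euclidean_space set"
  assumes dom: "open \<Omega>" "bounded \<Omega>"
begin

lemma dom_sets: "\<Omega> \<in> sets lebesgue"
  using dom(1) by auto

lemma continuous_L2: 
  assumes "continuous_on UNIV f" shows "f \<in> L2_space \<Omega>"
proof -
  interpret finite_measure "lebesgue_on \<Omega>" by (rule finite_measure_lebesgue_on_bounded[OF dom(2) dom_sets])
  have "integrable (lebesgue_on \<Omega>) (\<lambda>x. 1 * (f x)\<^sup>2)"
    by (rule mult_continuous_integrable[OF _ dom(2)]) (auto intro!: continuous_intros assms)
  then show ?thesis
    using continuous_on_imp_measurable_lebesgue_on[OF assms] by (simp add: L2_space_def)
qed

lemma test_L2: "\<phi> \<in> test_functions \<Omega> \<Longrightarrow> \<phi> \<in> L2_space \<Omega>"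
  by (rule continuous_L2[OF smooth_on_continuous_on[OF test_functions_smooth]])

lemma bounded_L2:
  assumes "\<psi> \<in> borel_measurable (lebesgue_on \<Omega>)" "\<And>x. x \<in> \<Omega> \<Longrightarrow> \<bar>\<psi> x\<bar> \<le> C"
  shows "\<psi> \<in> L2_space \<Omega>"
proof -
  interpret finite_measure "lebesgue_on \<Omega>" by (rule finite_measure_lebesgue_on_bounded[OF dom(2) dom_sets])
  have "integrable (lebesgue_on \<Omega>) (\<lambda>x. 1 * (\<psi> x)\<^sup>2)"
  proof (rule bounded_mult_integrable[where C = "C\<^sup>2"])
    fix x assume "x \<in> space (lebesgue_on \<Omega>)"
    then have "\<bar>\<psi> x\<bar> \<le> C" using assms(2) by simp
    then show "\<bar>(\<psi> x)\<^sup>2\<bar> \<le> C\<^sup>2" by (simp add: abs_le_square_iff[symmetric])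
  qed (use assms(1) in auto)
  then show ?thesis using assms(1) by (simp add: L2_space_def)
qed

lemma L2_integrable: "u \<in> L2_space \<Omega> \<Longrightarrow> integrable (lebesgue_on \<Omega>) u"
  using L2_mult_integrable[of u \<Omega> "\<lambda>_. 1"] continuous_L2[of "\<lambda>_. 1"] by simp

lemma L2_abs_integral_le:
  assumes "u \<in> L2_space \<Omega>"
  shows "(LINT x|lebesgue_on \<Omega>. \<bar>u x\<bar>) \<le> norm_L2 \<Omega> u * norm_L2 \<Omega> (\<lambda>_. 1)"
proof -
  have "(\<lambda>x. \<bar>u x\<bar>) \<in> L2_space \<Omega>" using assms by (auto simp: L2_space_def)
  from L2_Cauchy_Schwarz[OF this continuous_L2[of "\<lambda>_. 1"]] show ?thesis by (simp add: norm_L2_def)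
qed

end

section \<open>Test functions and integration by parts\<close>

lemma test_functions_zero: "(\<lambda>x. 0) \<in> test_functions U"
  by (simp add: test_functions_def)

lemma test_functionsI:
  assumes \<phi>: "\<phi> \<in> test_functions U" and s: "smooth_on UNIV \<psi>" and z: "\<And>x. x \<notin> closure {x. \<phi> x \<noteq> 0} \<Longrightarrow> \<psi> x = 0"
  shows "\<psi> \<in> test_functions U"
proof -
  have c: "closure {x. \<psi> x \<noteq> 0} \<subseteq> closure {x. \<phi> x \<noteq> 0}" by (rule closure_minimal) (use z in auto)
  moreover have "compact (closure {x. \<phi> x \<noteq> 0})" "closure {x. \<phi> x \<noteq> 0} \<subseteq> U" using \<phi> by (auto simp: test_functions_def)
  ultimately have "compact (closure {x. \<psi> x \<noteq> 0})"
    by (meson bounded_subset closed_closure compact_eq_bounded_closed)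
  with c \<open>closure {x. \<phi> x \<noteq> 0} \<subseteq> U\<close> s show ?thesis by (auto simp: test_functions_def)
qed

lemma test_functions_mult_smooth:
  assumes "\<phi> \<in> test_functions U" "smooth_on UNIV \<psi>"
  shows "(\<lambda>x. \<phi> x * \<psi> x) \<in> test_functions U"
proof (rule test_functionsI[OF assms(1)])
  show "smooth_on UNIV (\<lambda>x. \<phi> x * \<psi> x)" using test_functions_smooth[OF assms(1)] assms(2) by auto
  show "\<phi> x * \<psi> x = 0" if "x \<notin> closure {x. \<phi> x \<noteq> 0}" for x
    using that closure_subset[of "{x. \<phi> x \<noteq> 0}"] by auto
qed

lemma test_functions_partial:
  assumes \<phi>: "\<phi> \<in> test_functions U" and b: "b \<in> Basis"
  shows "(\<lambda>x. frechet_derivative \<phi> (at x) b) \<in> test_functions U"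
proof (rule test_functionsI[OF \<phi>])
  show "smooth_on UNIV (\<lambda>x. frechet_derivative \<phi> (at x) b)"
    by (rule smooth_on_partial[OF test_functions_smooth[OF \<phi>] b])
  fix x assume x: "x \<notin> closure {x. \<phi> x \<noteq> 0}"
  have "((\<lambda>_. 0) has_derivative (\<lambda>_. 0)) (at x)" by simp
  then have "(\<phi> has_derivative (\<lambda>_. 0)) (at x)"
    by (rule has_derivative_transform_within_open[of _ _ _ _ "- closure {x. \<phi> x \<noteq> 0}"])
       (use x closure_subset[of "{x. \<phi> x \<noteq> 0}"] in auto)
  from has_derivative_imp_frechet[OF this] show "frechet_derivative \<phi> (at x) b = 0" by simp
qed

lemma test_functions_deriv:
  assumes \<theta>: "\<theta> \<in> test_functions (U :: real set)"
  shows "deriv \<theta> \<in> test_functions U"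
proof -
  have "(\<lambda>x. frechet_derivative \<theta> (at x) 1) = deriv \<theta>"
    by (rule ext, rule frechet_derivative_real, rule smooth_on_differentiable[OF test_functions_smooth[OF \<theta>]]) simp
  then show ?thesis using test_functions_partial[OF \<theta>, of 1] by simp
qed

lemma LINT_translate:
  fixes f :: "'a::euclidean_space \<Rightarrow> real"
  assumes "continuous_on UNIV f"
  shows "(LINT x|lebesgue. f (c + x)) = (LINT x|lebesgue. f x)"
proof -
  have f: "f \<in> borel_measurable borel" using assms by (rule borel_measurable_continuous_onI)
  have fc: "(\<lambda>x. f (c + x)) \<in> borel_measurable borel"
    by (rule borel_measurable_continuous_onI, rule continuous_on_compose2[OF assms]) (auto intro!: continuous_intros)
  have "(LINT x|lebesgue. f (c + x)) = (LINT x|lborel. f (c + x))"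
    by (rule integral_completion) (use fc in simp)
  also have "\<dots> = (LINT x|distr lborel borel ((+) c). f x)"
    by (rule integral_distr[symmetric]) (use f in auto)
  also have "\<dots> = (LINT x|lborel. f x)" by (simp only: lborel_distr_plus)
  also have "\<dots> = (LINT x|lebesgue. f x)"
    by (rule integral_completion[symmetric]) (use f in simp)
  finally show ?thesis .
qed

text \<open>Translation invariance, differentiated.\<close>

lemma LINT_partial_test_function:
  fixes \<eta> :: "'a::euclidean_space \<Rightarrow> real"
  assumes U: "open U" and \<eta>: "\<eta> \<in> test_functions U" and b: "b \<in> Basis"
  shows "(LINT x|lebesgue_on U. frechet_derivative \<eta> (at x) b) = 0"
proof -
  have s: "smooth_on UNIV \<eta>" by (rule test_functions_smooth[OF \<eta>])
  let ?D = "\<lambda>x. frechet_derivative \<eta> (at x) b"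
  have sD: "smooth_on UNIV ?D" by (rule smooth_on_partial[OF s b])
  obtain R where R: "R > 0" "closure {x. \<eta> x \<noteq> 0} \<subseteq> ball 0 R"
  proof -
    have "compact (closure {x. \<eta> x \<noteq> 0})" using \<eta> by (simp add: test_functions_def)
    then have "bounded (closure {x. \<eta> x \<noteq> 0})" by (rule compact_imp_bounded)
    from bounded_subset_ballD[OF this, of 0] that show thesis by blast
  qed
  \<comment> \<open>One unit larger than a ball containing the support, so that translates by less
    than 1 still vanish outside and integrating over \<open>B\<close> is integrating over the whole
    space.\<close>
  define B where "B = ball (0::'a) (R + 1)"
  have nb: "norm b = 1" using b by simp
  have out: "\<eta> (l *\<^sub>R b + x) = 0" if "x \<notin> B" "l \<in> {-1<..<1}" for x l
  proof -
    have "norm x \<le> norm (l *\<^sub>R b + x) + norm (l *\<^sub>R b)"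
      using norm_triangle_ineq4[of "l *\<^sub>R b + x" "l *\<^sub>R b"] by simp
    then have "norm (l *\<^sub>R b + x) \<ge> R" using that nb by (auto simp: B_def)
    then have "l *\<^sub>R b + x \<notin> closure {x. \<eta> x \<noteq> 0}" using R(2) by auto
    then show ?thesis using closure_subset[of "{x. \<eta> x \<noteq> 0}"] by blast
  qed
  have BL: "B \<in> sets lebesgue" "bounded B" by (auto simp: B_def)
  interpret fm: finite_measure "lebesgue_on B" by (rule finite_measure_lebesgue_on_bounded[OF BL(2,1)])
  have cont: "continuous_on UNIV (\<lambda>p::real \<times> 'a. \<eta> (fst p *\<^sub>R b + snd p))" "continuous_on UNIV (\<lambda>p::real \<times> 'a. ?D (fst p *\<^sub>R b + snd p))"
    by (rule continuous_on_compose2[OF smooth_on_continuous_on[OF s]], auto intro!: continuous_intros)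
       (rule continuous_on_compose2[OF smooth_on_continuous_on[OF sD]], auto intro!: continuous_intros)
  have bd: "bounded ({-1<..<1::real} \<times> B)" by (intro bounded_Times BL(2)) auto
  obtain C1 where C1: "\<And>p. p \<in> {-1<..<1} \<times> B \<Longrightarrow> \<bar>\<eta> (fst p *\<^sub>R b + snd p)\<bar> \<le> C1"
    by (rule continuous_bounded_on_bounded[OF cont(1) bd]) blast
  obtain C2 where C2: "\<And>p. p \<in> {-1<..<1} \<times> B \<Longrightarrow> \<bar>?D (fst p *\<^sub>R b + snd p)\<bar> \<le> C2"
    by (rule continuous_bounded_on_bounded[OF cont(2) bd]) blast
  have "((\<lambda>l. LINT x|lebesgue_on B. 1 * \<eta> (l *\<^sub>R b + x)) has_real_derivative (LINT x|lebesgue_on B. 1 * ?D (0 *\<^sub>R b + x))) (at 0 within {-1<..<1})"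
  proof (rule integral_has_real_derivative[where C = "max C1 C2" and h' = "\<lambda>l x. ?D (l *\<^sub>R b + x)"])
    show "(\<lambda>x. \<eta> (l *\<^sub>R b + x)) \<in> borel_measurable (lebesgue_on B)" for l
      by (rule continuous_on_imp_measurable_lebesgue_on, rule continuous_on_compose2[OF smooth_on_continuous_on[OF s]]) (auto intro!: continuous_intros)
    show "(\<lambda>x. ?D (0 *\<^sub>R b + x)) \<in> borel_measurable (lebesgue_on B)"
      by (rule continuous_on_imp_measurable_lebesgue_on, rule continuous_on_compose2[OF smooth_on_continuous_on[OF sD]]) (auto intro!: continuous_intros)
    fix l :: real and x :: 'a assume l: "l \<in> {-1<..<1}" and "x \<in> space (lebesgue_on B)"
    then have x: "x \<in> B" by simp
    show "\<bar>\<eta> (l *\<^sub>R b + x)\<bar> \<le> max C1 C2" using C1[of "(l, x)"] l x by simp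
    show "\<bar>?D (l *\<^sub>R b + x)\<bar> \<le> max C1 C2" using C2[of "(l, x)"] l x by simp
    have "((\<lambda>l. l *\<^sub>R b + x) has_derivative (\<lambda>h. h *\<^sub>R b)) (at l)" by (auto intro!: derivative_eq_intros)
    moreover have d: "(\<eta> has_derivative frechet_derivative \<eta> (at (l *\<^sub>R b + x))) (at (l *\<^sub>R b + x))"
      by (rule smooth_on_has_derivative[OF s]) simp
    ultimately have "((\<lambda>l. \<eta> (l *\<^sub>R b + x)) has_derivative (\<lambda>h. frechet_derivative \<eta> (at (l *\<^sub>R b + x)) (h *\<^sub>R b))) (at l)"
      by (rule has_derivative_compose)
    moreover have "frechet_derivative \<eta> (at (l *\<^sub>R b + x)) (h *\<^sub>R b) = ?D (l *\<^sub>R b + x) * h" for h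
      using linear_cmul[OF has_derivative_linear[OF d], of h b] by simp
    ultimately have "((\<lambda>l. \<eta> (l *\<^sub>R b + x)) has_real_derivative ?D (l *\<^sub>R b + x)) (at l)"
      by (simp add: has_field_derivative_def)
    then show "((\<lambda>l. \<eta> (l *\<^sub>R b + x)) has_real_derivative ?D (l *\<^sub>R b + x)) (at l within {-1<..<1})"
      by (rule DERIV_subset) simp
  qed auto
  then have d1: "((\<lambda>l. LINT x|lebesgue_on B. 1 * \<eta> (l *\<^sub>R b + x)) has_real_derivative (LINT x|lebesgue_on B. 1 * ?D (0 *\<^sub>R b + x))) (at 0)"
    unfolding at_within_open[of "0::real" "{-1<..<1}", simplified] .
  have const: "(LINT x|lebesgue_on B. 1 * \<eta> (l *\<^sub>R b + x)) = (LINT x|lebesgue. \<eta> x)" if "l \<in> {-1<..<1}" for l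
  proof -
    have "(LINT x|lebesgue_on B. 1 * \<eta> (l *\<^sub>R b + x)) = (LINT x|lebesgue_on UNIV. \<eta> (l *\<^sub>R b + x))"
      unfolding mult_1 by (rule LINT_lebesgue_on_eq[OF BL(1)]) (use out that in auto)
    also have "\<dots> = (LINT x|lebesgue. \<eta> (l *\<^sub>R b + x))"
      using integral_restrict_space[of UNIV lebesgue "\<lambda>x. \<eta> (l *\<^sub>R b + x)"] by simp
    also have "\<dots> = (LINT x|lebesgue. \<eta> x)" by (rule LINT_translate[OF smooth_on_continuous_on[OF s]])
    finally show ?thesis .
  qed
  have d2: "((\<lambda>l. LINT x|lebesgue_on B. 1 * \<eta> (l *\<^sub>R b + x)) has_real_derivative 0) (at 0)"
  proof (rule has_field_derivative_transform_within_open[of "\<lambda>_. LINT x|lebesgue. \<eta> x" 0 0 "{-1<..<1}"])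
    show "(LINT x|lebesgue. \<eta> x) = (LINT x|lebesgue_on B. 1 * \<eta> (l *\<^sub>R b + x))" if "l \<in> {-1<..<1}" for l
      by (rule const[OF that, symmetric])
  qed auto
  have z: "(LINT x|lebesgue_on B. ?D x) = 0" using DERIV_unique[OF d1 d2] by simp
  have tD: "?D \<in> test_functions U" "?D \<in> test_functions (ball 0 R)"
  proof -
    have "\<eta> \<in> test_functions (ball 0 R)" using \<eta> R(2) by (simp add: test_functions_def)
    from test_functions_partial[OF \<eta> b] test_functions_partial[OF this b]
    show "?D \<in> test_functions U" "?D \<in> test_functions (ball 0 R)" by this+
  qed
  have "(LINT x|lebesgue_on U. ?D x) = (LINT x|lebesgue_on B. ?D x)"
  proof (rule LINT_lebesgue_on_eq[OF _ BL(1)])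
    show "U \<in> sets lebesgue" using U by auto
    show "?D x = 0" if "x \<notin> B" for x by (rule test_function_outside[OF tD(2)]) (use that in \<open>auto simp: B_def\<close>)
    show "?D x = 0" if "x \<notin> U" for x by (rule test_function_outside[OF tD(1) that])
  qed
  with z show ?thesis by simp
qed

section \<open>Weak gradients\<close>

definition grad :: "('a::euclidean_space \<Rightarrow> real) \<Rightarrow> 'a \<Rightarrow> 'a" where
  "grad \<phi> x = (\<Sum>b\<in>Basis. frechet_derivative \<phi> (at x) b *\<^sub>R b)"

lemma grad_inner: "b \<in> Basis \<Longrightarrow> grad \<phi> x \<bullet> b = frechet_derivative \<phi> (at x) b"
  by (simp add: grad_def inner_sum_left_Basis)

lemma is_weak_gradD:
  assumes "is_weak_grad \<Omega> u G" "b \<in> Basis"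
  shows "(\<lambda>x. G x \<bullet> b) \<in> L2_space \<Omega>"
    "\<phi> \<in> test_functions \<Omega> \<Longrightarrow> (LINT x|lebesgue_on \<Omega>. u x * frechet_derivative \<phi> (at x) b) = - (LINT x|lebesgue_on \<Omega>. (G x \<bullet> b) * \<phi> x)"
  using assms by (auto simp: is_weak_grad_def)

lemma inner_L2_integrable:
  assumes "\<And>b. b \<in> Basis \<Longrightarrow> (\<lambda>x. G x \<bullet> b) \<in> L2_space \<Omega>" "\<And>b. b \<in> Basis \<Longrightarrow> (\<lambda>x. H x \<bullet> b) \<in> L2_space \<Omega>"
  shows "integrable (lebesgue_on \<Omega>) (\<lambda>x. G x \<bullet> H x)"
proof -
  have "(\<lambda>x. G x \<bullet> H x) = (\<lambda>x. \<Sum>b\<in>Basis. (G x \<bullet> b) * (H x \<bullet> b))" by (rule ext) (rule euclidean_inner)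
  moreover have "integrable (lebesgue_on \<Omega>) (\<lambda>x. \<Sum>b\<in>Basis. (G x \<bullet> b) * (H x \<bullet> b))"
    by (intro Bochner_Integration.integrable_sum L2_mult_integrable assms)
  ultimately show ?thesis by simp
qed

lemma inner_L2_Cauchy_Schwarz:
  fixes G H :: "'a::euclidean_space \<Rightarrow> 'a"
  assumes G: "\<And>b. b \<in> Basis \<Longrightarrow> (\<lambda>x. G x \<bullet> b) \<in> L2_space \<Omega>" and H: "\<And>b. b \<in> Basis \<Longrightarrow> (\<lambda>x. H x \<bullet> b) \<in> L2_space \<Omega>"
  shows "\<bar>LINT x|lebesgue_on \<Omega>. G x \<bullet> H x\<bar> \<le> sqrt (LINT x|lebesgue_on \<Omega>. (norm (G x))\<^sup>2) * sqrt (LINT x|lebesgue_on \<Omega>. (norm (H x))\<^sup>2)"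
  unfolding power2_norm_eq_inner
proof (rule quadratic_nonneg_imp_discriminant)
  fix s :: real
  have "0 \<le> (LINT x|lebesgue_on \<Omega>. (G x - s *\<^sub>R H x) \<bullet> (G x - s *\<^sub>R H x))" by simp
  also have "\<dots> = (LINT x|lebesgue_on \<Omega>. (G x \<bullet> G x - 2 * s * (G x \<bullet> H x)) + s\<^sup>2 * (H x \<bullet> H x))"
    by (rule Bochner_Integration.integral_cong) (auto simp: inner_diff_left inner_diff_right inner_commute power2_eq_square algebra_simps)
  also have "\<dots> = (LINT x|lebesgue_on \<Omega>. G x \<bullet> G x) - 2 * s * (LINT x|lebesgue_on \<Omega>. G x \<bullet> H x) + s\<^sup>2 * (LINT x|lebesgue_on \<Omega>. H x \<bullet> H x)"
    using inner_L2_integrable[OF G G] inner_L2_integrable[OF H H] inner_L2_integrable[OF G H] by simp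
  finally show "0 \<le> (LINT x|lebesgue_on \<Omega>. G x \<bullet> G x) - 2 * s * (LINT x|lebesgue_on \<Omega>. G x \<bullet> H x) + s\<^sup>2 * (LINT x|lebesgue_on \<Omega>. H x \<bullet> H x)" .
qed auto

context bounded_domain
begin

text \<open>The product of two test functions is a test function, and the integral of its partial
  derivative vanishes; the product rule then is integration by parts.\<close>

lemma is_weak_grad_test:
  assumes \<psi>: "\<psi> \<in> test_functions \<Omega>"
  shows "is_weak_grad \<Omega> \<psi> (grad \<psi>)"
  unfolding is_weak_grad_def
proof (intro ballI conjI)
  fix b :: 'a assume b: "b \<in> Basis"
  have p\<psi>: "(\<lambda>x. frechet_derivative \<psi> (at x) b) \<in> test_functions \<Omega>" by (rule test_functions_partial[OF \<psi> b])
  then show "(\<lambda>x. grad \<psi> x \<bullet> b) \<in> L2_space \<Omega>" using b by (simp add: grad_inner test_L2)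
  fix \<phi> assume \<phi>: "\<phi> \<in> test_functions \<Omega>"
  have p\<phi>: "(\<lambda>x. frechet_derivative \<phi> (at x) b) \<in> test_functions \<Omega>" by (rule test_functions_partial[OF \<phi> b])
  have "frechet_derivative (\<lambda>x. \<psi> x * \<phi> x) (at x) b = \<psi> x * frechet_derivative \<phi> (at x) b + frechet_derivative \<psi> (at x) b * \<phi> x" for x
  proof -
    have "((\<lambda>x. \<psi> x * \<phi> x) has_derivative (\<lambda>h. \<psi> x * frechet_derivative \<phi> (at x) h + frechet_derivative \<psi> (at x) h * \<phi> x)) (at x)"
      by (intro has_derivative_mult smooth_on_has_derivative[OF test_functions_smooth[OF \<psi>]] smooth_on_has_derivative[OF test_functions_smooth[OF \<phi>]]) auto
    from has_derivative_imp_frechet[OF this] show ?thesis by simp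
  qed
  then have "0 = (LINT x|lebesgue_on \<Omega>. \<psi> x * frechet_derivative \<phi> (at x) b + frechet_derivative \<psi> (at x) b * \<phi> x)"
    using LINT_partial_test_function[OF dom(1) test_functions_mult_smooth[OF \<psi> test_functions_smooth[OF \<phi>]] b] by simp
  also have "\<dots> = (LINT x|lebesgue_on \<Omega>. \<psi> x * frechet_derivative \<phi> (at x) b) + (LINT x|lebesgue_on \<Omega>. frechet_derivative \<psi> (at x) b * \<phi> x)"
    by (intro Bochner_Integration.integral_add L2_mult_integrable test_L2 \<psi> \<phi> p\<psi> p\<phi>)
  finally show "(LINT x|lebesgue_on \<Omega>. \<psi> x * frechet_derivative \<phi> (at x) b) = - (LINT x|lebesgue_on \<Omega>. (grad \<psi> x \<bullet> b) * \<phi> x)"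
    using b by (simp add: grad_inner)
qed

text \<open>\<open>weak_grad\<close> is an arbitrary choice among weak gradients; whatever is known
  about it passes through this uniqueness up to null sets.\<close>

lemma is_weak_grad_unique:
  assumes G: "is_weak_grad \<Omega> u G" and H: "is_weak_grad \<Omega> u H"
  shows "AE x in lebesgue_on \<Omega>. G x = H x"
proof -
  have "AE x in lebesgue_on \<Omega>. G x \<bullet> b = H x \<bullet> b" if b: "b \<in> Basis" for b
  proof -
    note Gb = is_weak_gradD[OF G b] and Hb = is_weak_gradD[OF H b]
    have "AE x in lebesgue_on \<Omega>. G x \<bullet> b - H x \<bullet> b = 0"
    proof (rule fundamental_lemma[OF dom])
      show "integrable (lebesgue_on \<Omega>) (\<lambda>x. G x \<bullet> b - H x \<bullet> b)"
        by (rule L2_integrable[OF L2_diff[OF Gb(1) Hb(1)]])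
      fix \<phi> assume \<phi>: "\<phi> \<in> test_functions \<Omega>"
      have "(LINT x|lebesgue_on \<Omega>. (G x \<bullet> b - H x \<bullet> b) * \<phi> x) = (LINT x|lebesgue_on \<Omega>. (G x \<bullet> b) * \<phi> x) - (LINT x|lebesgue_on \<Omega>. (H x \<bullet> b) * \<phi> x)"
        unfolding left_diff_distrib
        by (intro Bochner_Integration.integral_diff L2_mult_integrable Gb(1) Hb(1) test_L2[OF \<phi>])
      also have "\<dots> = 0" using Gb(2)[OF \<phi>] Hb(2)[OF \<phi>] by simp
      finally show "(LINT x|lebesgue_on \<Omega>. (G x \<bullet> b - H x \<bullet> b) * \<phi> x) = 0" .
    qed
    then show ?thesis by simp
  qed
  then have "AE x in lebesgue_on \<Omega>. \<forall>b\<in>Basis. G x \<bullet> b = H x \<bullet> b"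
    by (subst AE_finite_all) auto
  then show ?thesis by (rule eventually_mono) (auto intro: euclidean_eqI)
qed

lemma is_weak_grad_linear:
  assumes u: "u \<in> L2_space \<Omega>" "is_weak_grad \<Omega> u G" and v: "v \<in> L2_space \<Omega>" "is_weak_grad \<Omega> v H"
  shows "is_weak_grad \<Omega> (\<lambda>x. c * u x + d * v x) (\<lambda>x. c *\<^sub>R G x + d *\<^sub>R H x)"
  unfolding is_weak_grad_def
proof (intro ballI conjI)
  fix b :: 'a assume b: "b \<in> Basis"
  note Gb = is_weak_gradD[OF u(2) b] and Hb = is_weak_gradD[OF v(2) b]
  show "(\<lambda>x. (c *\<^sub>R G x + d *\<^sub>R H x) \<bullet> b) \<in> L2_space \<Omega>"
    using L2_linear[OF Gb(1) Hb(1), of c d] by (simp add: inner_add_left)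
  fix \<phi> assume \<phi>: "\<phi> \<in> test_functions \<Omega>"
  have p\<phi>: "(\<lambda>x. frechet_derivative \<phi> (at x) b) \<in> L2_space \<Omega>" by (rule test_L2[OF test_functions_partial[OF \<phi> b]])
  have "(LINT x|lebesgue_on \<Omega>. (c * u x + d * v x) * frechet_derivative \<phi> (at x) b) =
     (LINT x|lebesgue_on \<Omega>. c * (u x * frechet_derivative \<phi> (at x) b) + d * (v x * frechet_derivative \<phi> (at x) b))"
    by (simp add: algebra_simps)
  also have "\<dots> = c * (LINT x|lebesgue_on \<Omega>. u x * frechet_derivative \<phi> (at x) b) + d * (LINT x|lebesgue_on \<Omega>. v x * frechet_derivative \<phi> (at x) b)"
    using L2_mult_integrable[OF u(1) p\<phi>] L2_mult_integrable[OF v(1) p\<phi>] by simp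
  also have "\<dots> = - (c * (LINT x|lebesgue_on \<Omega>. (G x \<bullet> b) * \<phi> x) + d * (LINT x|lebesgue_on \<Omega>. (H x \<bullet> b) * \<phi> x))"
    using Gb(2)[OF \<phi>] Hb(2)[OF \<phi>] by simp
  also have "\<dots> = - (LINT x|lebesgue_on \<Omega>. c * ((G x \<bullet> b) * \<phi> x) + d * ((H x \<bullet> b) * \<phi> x))"
    using L2_mult_integrable[OF Gb(1) test_L2[OF \<phi>]] L2_mult_integrable[OF Hb(1) test_L2[OF \<phi>]] by simp
  also have "\<dots> = - (LINT x|lebesgue_on \<Omega>. ((c *\<^sub>R G x + d *\<^sub>R H x) \<bullet> b) * \<phi> x)"
    by (simp add: inner_add_left algebra_simps)
  finally show "(LINT x|lebesgue_on \<Omega>. (c * u x + d * v x) * frechet_derivative \<phi> (at x) b) = - (LINT x|lebesgue_on \<Omega>. ((c *\<^sub>R G x + d *\<^sub>R H x) \<bullet> b) * \<phi> x)" .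
qed

lemma H1_L2: "u \<in> H1_space \<Omega> \<Longrightarrow> u \<in> L2_space \<Omega>"
  by (simp add: H1_space_def)

lemma H10_H1: "u \<in> H10_space \<Omega> \<Longrightarrow> u \<in> H1_space \<Omega>"
  by (simp add: H10_space_def)

lemma H10_L2: "u \<in> H10_space \<Omega> \<Longrightarrow> u \<in> L2_space \<Omega>"
  by (rule H1_L2[OF H10_H1])

lemma weak_grad_is: "u \<in> H1_space \<Omega> \<Longrightarrow> is_weak_grad \<Omega> u (weak_grad \<Omega> u)"
  unfolding H1_space_def weak_grad_def using someI_ex[of "is_weak_grad \<Omega> u"] by blast

lemma weak_grad_L2: "u \<in> H1_space \<Omega> \<Longrightarrow> b \<in> Basis \<Longrightarrow> (\<lambda>x. weak_grad \<Omega> u x \<bullet> b) \<in> L2_space \<Omega>"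
  by (rule is_weak_gradD(1)[OF weak_grad_is])

lemma weak_grad_AE:
  assumes "is_weak_grad \<Omega> u G"
  shows "AE x in lebesgue_on \<Omega>. weak_grad \<Omega> u x = G x"
proof -
  have "is_weak_grad \<Omega> u (weak_grad \<Omega> u)"
    unfolding weak_grad_def by (rule someI[of "is_weak_grad \<Omega> u", OF assms])
  then show ?thesis by (rule is_weak_grad_unique[OF _ assms])
qed

lemma H1_linear:
  assumes "u \<in> H1_space \<Omega>" "v \<in> H1_space \<Omega>"
  shows "(\<lambda>x. c * u x + d * v x) \<in> H1_space \<Omega>"
    and "AE x in lebesgue_on \<Omega>. weak_grad \<Omega> (\<lambda>x. c * u x + d * v x) x = c *\<^sub>R weak_grad \<Omega> u x + d *\<^sub>R weak_grad \<Omega> v x"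
proof -
  have g: "is_weak_grad \<Omega> (\<lambda>x. c * u x + d * v x) (\<lambda>x. c *\<^sub>R weak_grad \<Omega> u x + d *\<^sub>R weak_grad \<Omega> v x)"
    by (intro is_weak_grad_linear H1_L2 weak_grad_is assms)
  then show "(\<lambda>x. c * u x + d * v x) \<in> H1_space \<Omega>"
    unfolding H1_space_def using L2_linear[OF H1_L2[OF assms(1)] H1_L2[OF assms(2)]] by blast
  show "AE x in lebesgue_on \<Omega>. weak_grad \<Omega> (\<lambda>x. c * u x + d * v x) x = c *\<^sub>R weak_grad \<Omega> u x + d *\<^sub>R weak_grad \<Omega> v x"
    by (rule weak_grad_AE[OF g])
qed

lemma LINT_inner_cong_AE:
  assumes "AE x in lebesgue_on \<Omega>. G x = G' x" "AE x in lebesgue_on \<Omega>. H x = H' x"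
    "integrable (lebesgue_on \<Omega>) (\<lambda>x. G x \<bullet> H x)" "integrable (lebesgue_on \<Omega>) (\<lambda>x. G' x \<bullet> H' x)"
  shows "(LINT x|lebesgue_on \<Omega>. G x \<bullet> H x) = (LINT x|lebesgue_on \<Omega>. G' x \<bullet> H' x)"
proof (rule integral_cong_AE[OF borel_measurable_integrable[OF assms(3)] borel_measurable_integrable[OF assms(4)]])
  show "AE x in lebesgue_on \<Omega>. G x \<bullet> H x = G' x \<bullet> H' x" using assms(1,2) by eventually_elim simp
qed

lemma test_H1: "\<phi> \<in> test_functions \<Omega> \<Longrightarrow> \<phi> \<in> H1_space \<Omega>"
  unfolding H1_space_def using is_weak_grad_test test_L2 by blast

text \<open>Even for the zero function the chosen gradient is zero only almost everywhere. This is
  what puts a test function, approximated by itself, into \<open>H10_space\<close>.\<close>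

lemma norm_H1_zero: "norm_H1 \<Omega> (\<lambda>x. 0) = 0"
proof -
  have z: "(\<lambda>x. 0) \<in> test_functions \<Omega>" by (rule test_functions_zero)
  have g: "grad (\<lambda>x::'a. 0) = (\<lambda>x. 0)" by (simp add: grad_def fun_eq_iff)
  have "AE x in lebesgue_on \<Omega>. weak_grad \<Omega> (\<lambda>x. 0) x = 0"
    using weak_grad_AE[OF is_weak_grad_test[OF z]] by (simp add: g)
  moreover have "integrable (lebesgue_on \<Omega>) (\<lambda>x. weak_grad \<Omega> (\<lambda>x. 0) x \<bullet> weak_grad \<Omega> (\<lambda>x. 0) x)"
    by (intro inner_L2_integrable weak_grad_L2 test_H1 z)
  ultimately have "(LINT x|lebesgue_on \<Omega>. weak_grad \<Omega> (\<lambda>x. 0) x \<bullet> weak_grad \<Omega> (\<lambda>x. 0) x) = (LINT x|lebesgue_on \<Omega>. (0::'a) \<bullet> (0::'a))"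
    by (intro LINT_inner_cong_AE) auto
  then show ?thesis by (simp add: norm_H1_def power2_norm_eq_inner)
qed

lemma test_H10: "\<phi> \<in> test_functions \<Omega> \<Longrightarrow> \<phi> \<in> H10_space \<Omega>"
  unfolding H10_space_def using test_H1 norm_H1_zero by (auto intro!: bexI[of _ \<phi>])

text \<open>Both derivatives move onto \<psi>, whose partial derivatives are again test functions;
  this leads from the Dirichlet Laplacian to the form of the equation in
  \<open>weak_wave\<close>.\<close>

lemma laplacian_test:
  assumes u: "u \<in> H1_space \<Omega>" and \<psi>: "\<psi> \<in> test_functions \<Omega>"
  shows "laplacian \<Omega> u \<psi> = (LINT x|lebesgue_on \<Omega>. u x * lap \<psi> x)"
proof -
  let ?G = "weak_grad \<Omega> u"
  have G: "\<And>b. b \<in> Basis \<Longrightarrow> (\<lambda>x. ?G x \<bullet> b) \<in> L2_space \<Omega>" by (rule weak_grad_L2[OF u])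
  have p\<psi>: "(\<lambda>x. frechet_derivative \<psi> (at x) b) \<in> test_functions \<Omega>" if "b \<in> Basis" for b
    by (rule test_functions_partial[OF \<psi> that])
  have pp\<psi>: "(\<lambda>x. frechet_derivative (\<lambda>x. frechet_derivative \<psi> (at x) b) (at x) b) \<in> test_functions \<Omega>" if "b \<in> Basis" for b
    by (rule test_functions_partial[OF p\<psi>[OF that] that])
  have gL: "(\<lambda>x. grad \<psi> x \<bullet> b) \<in> L2_space \<Omega>" if "b \<in> Basis" for b
    using test_L2[OF p\<psi>[OF that]] that by (simp add: grad_inner)
  have "(LINT x|lebesgue_on \<Omega>. ?G x \<bullet> weak_grad \<Omega> \<psi> x) = (LINT x|lebesgue_on \<Omega>. ?G x \<bullet> grad \<psi> x)"
  proof (rule LINT_inner_cong_AE)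
    show "AE x in lebesgue_on \<Omega>. weak_grad \<Omega> \<psi> x = grad \<psi> x" by (rule weak_grad_AE[OF is_weak_grad_test[OF \<psi>]])
    show "integrable (lebesgue_on \<Omega>) (\<lambda>x. ?G x \<bullet> weak_grad \<Omega> \<psi> x)"
      by (intro inner_L2_integrable G weak_grad_L2[OF test_H1[OF \<psi>]])
    show "integrable (lebesgue_on \<Omega>) (\<lambda>x. ?G x \<bullet> grad \<psi> x)" by (intro inner_L2_integrable G gL)
  qed simp
  also have "\<dots> = (LINT x|lebesgue_on \<Omega>. (\<Sum>b\<in>Basis. (?G x \<bullet> b) * frechet_derivative \<psi> (at x) b))"
  proof (rule Bochner_Integration.integral_cong[OF refl])
    fix x
    have "?G x \<bullet> grad \<psi> x = (\<Sum>b\<in>Basis. (?G x \<bullet> b) * (grad \<psi> x \<bullet> b))" by (rule euclidean_inner)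
    also have "\<dots> = (\<Sum>b\<in>Basis. (?G x \<bullet> b) * frechet_derivative \<psi> (at x) b)"
      by (intro sum.cong refl) (simp only: grad_inner)
    finally show "?G x \<bullet> grad \<psi> x = (\<Sum>b\<in>Basis. (?G x \<bullet> b) * frechet_derivative \<psi> (at x) b)" .
  qed
  also have "\<dots> = (\<Sum>b\<in>Basis. LINT x|lebesgue_on \<Omega>. (?G x \<bullet> b) * frechet_derivative \<psi> (at x) b)"
    by (intro Bochner_Integration.integral_sum L2_mult_integrable G test_L2 p\<psi>)
  also have "\<dots> = (\<Sum>b\<in>Basis. - (LINT x|lebesgue_on \<Omega>. u x * frechet_derivative (\<lambda>x. frechet_derivative \<psi> (at x) b) (at x) b))"
    by (intro sum.cong refl) (simp add: is_weak_gradD(2)[OF weak_grad_is[OF u] _ p\<psi>])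
  also have "\<dots> = - (\<Sum>b\<in>Basis. LINT x|lebesgue_on \<Omega>. u x * frechet_derivative (\<lambda>x. frechet_derivative \<psi> (at x) b) (at x) b)"
    by (rule sum_negf)
  also have "(\<Sum>b\<in>Basis. LINT x|lebesgue_on \<Omega>. u x * frechet_derivative (\<lambda>x. frechet_derivative \<psi> (at x) b) (at x) b)
      = (LINT x|lebesgue_on \<Omega>. (\<Sum>b\<in>Basis. u x * frechet_derivative (\<lambda>x. frechet_derivative \<psi> (at x) b) (at x) b))"
    by (intro Bochner_Integration.integral_sum[symmetric] L2_mult_integrable H1_L2[OF u] test_L2 pp\<psi>)
  also have "\<dots> = (LINT x|lebesgue_on \<Omega>. u x * lap \<psi> x)" by (simp add: lap_def sum_distrib_left)
  finally show ?thesis by (simp add: laplacian_def)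
qed

end

section \<open>Continuous representatives of weak solutions\<close>

lemma complete_measure_lebesgue_on:
  assumes S: "S \<in> sets lebesgue"
  shows "complete_measure (lebesgue_on S)"
proof
  fix A B assume B: "B \<subseteq> A" "A \<in> null_sets (lebesgue_on S)"
  then have A: "A \<subseteq> S" "A \<in> null_sets lebesgue" using null_sets_restrict_space[OF S] by auto
  then have "B \<in> sets lebesgue" by (intro completion.complete[OF B(1)])
  then show "B \<in> sets (lebesgue_on S)" using A B(1) S by (subst sets_restrict_space_iff) auto
qed

lemma borel_measurable_cong_AE_lebesgue_on:
  fixes f g :: "'a::euclidean_space \<Rightarrow> real"
  assumes S: "S \<in> sets lebesgue" and ae: "AE x in lebesgue_on S. f x = g x" and f: "f \<in> borel_measurable (lebesgue_on S)"
  shows "g \<in> borel_measurable (lebesgue_on S)"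
proof (rule measurableI)
  interpret complete_measure "lebesgue_on S" by (rule complete_measure_lebesgue_on[OF S])
  fix A :: "real set" assume A: "A \<in> sets borel"
  let ?P = "\<lambda>h. h -` A \<inter> space (lebesgue_on S)"
  show "?P g \<in> sets (lebesgue_on S)"
  proof (rule in_sets_AE)
    show "?P f \<in> sets (lebesgue_on S)" using f A by (rule measurable_sets)
    show "AE x in lebesgue_on S. (x \<in> ?P f) = (x \<in> ?P g)" using ae by eventually_elim simp
  qed simp
qed simp

text \<open>By completeness of the measure, \<open>f\<close> and \<open>g\<close> are measurable
  together or not at all. Thus values in H10 or its dual may be replaced almost everywhere in time
  before measurability of the integrand is known.\<close>

lemma LINT_cong_AE_lebesgue_on:
  fixes f g :: "'a::euclidean_space \<Rightarrow> real"
  assumes S: "S \<in> sets lebesgue" and ae: "AE x in lebesgue_on S. f x = g x"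
  shows "(LINT x|lebesgue_on S. f x) = (LINT x|lebesgue_on S. g x)"
proof (cases "f \<in> borel_measurable (lebesgue_on S)")
  case True
  then show ?thesis
    by (rule integral_cong_AE[OF _ borel_measurable_cong_AE_lebesgue_on[OF S ae] ae]) (rule True)
next
  case False
  have "AE x in lebesgue_on S. g x = f x" using ae by eventually_elim simp
  from False borel_measurable_cong_AE_lebesgue_on[OF S this]
  have "g \<notin> borel_measurable (lebesgue_on S)" by (rule contrapos_nn)
  \<comment> \<open>Neither function is integrable, so both integrals take the default value
    0.\<close>
  then have "\<not> integrable (lebesgue_on S) f" "\<not> integrable (lebesgue_on S) g"
    using False borel_measurable_integrable[of "lebesgue_on S" f] borel_measurable_integrable[of "lebesgue_on S" g] by auto
  then show ?thesis by (simp add: not_integrable_integral_eq)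
qed

lemma integrable_lebesgue_on_superset:
  fixes f :: "'a::euclidean_space \<Rightarrow> real"
  assumes f: "integrable (lebesgue_on A) f" and AB: "A \<in> sets lebesgue" "B \<in> sets lebesgue" "A \<subseteq> B"
    and z: "\<And>x. x \<in> B \<Longrightarrow> x \<notin> A \<Longrightarrow> f x = 0"
  shows "integrable (lebesgue_on B) f"
proof -
  have "(\<lambda>x. indicator A x *\<^sub>R f x) = (\<lambda>x. indicator B x *\<^sub>R f x)"
  proof
    fix x show "indicator A x *\<^sub>R f x = indicator B x *\<^sub>R f x"
      using z[of x] AB(3) by (cases "x \<in> A"; cases "x \<in> B") auto
  qed
  then show ?thesis
    using f integrable_restrict_space[of A lebesgue f] integrable_restrict_space[of B lebesgue f] AB(1,2) by simp
qed

text \<open>A compact subset of the open interval stays away from both ends; a symmetric interval is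
  what the bounds in time are stated for.\<close>

lemma time_test_support:
  assumes \<theta>: "\<theta> \<in> test_functions {-T<..<T::real}"
  obtains c where "c < T" "\<And>t. t \<notin> {-c..c} \<Longrightarrow> \<theta> t = 0"
proof -
  let ?K = "closure {t. \<theta> t \<noteq> 0}"
  have K: "compact ?K" "?K \<subseteq> {-T<..<T}" using \<theta> by (auto simp: test_functions_def)
  have z: "\<theta> t = 0" if "t \<notin> ?K" for t using that closure_subset[of "{t. \<theta> t \<noteq> 0}"] by blast
  show ?thesis
  proof (cases "?K = {}")
    case True
    \<comment> \<open>The zero function: any number below \<open>T\<close> will do.\<close>
    show ?thesis
    proof (rule that[of "T - 1"])
      show "\<theta> t = 0" for t by (rule z) (simp add: True)
    qed simp
  next
    case False
    have "continuous_on ?K (\<lambda>t. \<bar>t\<bar>)" by (intro continuous_intros)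
    from continuous_attains_sup[OF K(1) False this]
    obtain m where m: "m \<in> ?K" "\<And>t. t \<in> ?K \<Longrightarrow> \<bar>t\<bar> \<le> \<bar>m\<bar>" by blast
    show ?thesis
    proof (rule that[of "\<bar>m\<bar>"])
      have "m \<in> {-T<..<T}" by (rule subsetD[OF K(2) m(1)])
      then show "\<bar>m\<bar> < T" by auto
      show "\<theta> t = 0" if t: "t \<notin> {-\<bar>m\<bar>..\<bar>m\<bar>}" for t
      proof (rule z)
        show "t \<notin> ?K"
        proof
          assume "t \<in> ?K"
          then have "\<bar>t\<bar> \<le> \<bar>m\<bar>" by (rule m(2))
          then show False using t by auto
        qed
      qed
    qed
  qed
qed

lemma time_test_mult_integrable:
  assumes \<theta>: "\<theta> \<in> test_functions {-T<..<T::real}" and f: "continuous_on {-T<..<T} f"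
  shows "integrable (lebesgue_on {-T<..<T}) (\<lambda>t. \<theta> t * f t)"
proof -
  obtain c where c: "c < T" "\<And>t. t \<notin> {-c..c} \<Longrightarrow> \<theta> t = 0" by (rule time_test_support[OF \<theta>]) blast
  have sub: "{-c..c} \<subseteq> {-T<..<T}" using c(1) by auto
  have "continuous_on {-c..c} (\<lambda>t. \<theta> t * f t)"
    by (intro continuous_on_mult continuous_on_subset[OF f sub] smooth_on_continuous_on_UNIV[OF test_functions_smooth[OF \<theta>]])
  then have "integrable (lebesgue_on {-c..c}) (\<lambda>t. \<theta> t * f t)" by (rule continuous_imp_integrable_real)
  then show ?thesis
    by (rule integrable_lebesgue_on_superset) (use c(2) sub in auto)
qed

text \<open>The comparison of two solutions happens at this level: linearity of the interior
  formulation is enough for the cone argument.\<close>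

lemma weak_wave_diff:
  fixes \<Omega> :: "'a::euclidean_space set"
  assumes "weak_wave \<Omega> T u" "weak_wave \<Omega> T v"
  shows "weak_wave \<Omega> T (\<lambda>t x. u t x - v t x)"
proof -
  interpret u: weak_wave \<Omega> T u by fact
  interpret v: weak_wave \<Omega> T v by fact
  let ?I = "{-T<..<T}"
  have diff: "(LINT x|lebesgue_on \<Omega>. (u t x - v t x) * \<psi> x) = (LINT x|lebesgue_on \<Omega>. u t x * \<psi> x) - (LINT x|lebesgue_on \<Omega>. v t x * \<psi> x)"
    if t: "t \<in> ?I" and \<psi>: "\<psi> \<in> borel_measurable (lebesgue_on \<Omega>)" "\<And>x. x \<in> \<Omega> \<Longrightarrow> \<bar>\<psi> x\<bar> \<le> C" for t \<psi> C
    unfolding left_diff_distrib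
    by (intro Bochner_Integration.integral_diff bounded_mult_integrable[OF _ \<psi>(1), of _ C] u.u_int v.u_int t) (use \<psi>(2) in auto)
  have diffc: "(LINT x|lebesgue_on \<Omega>. (u t x - v t x) * \<psi> x) = (LINT x|lebesgue_on \<Omega>. u t x * \<psi> x) - (LINT x|lebesgue_on \<Omega>. v t x * \<psi> x)"
    if t: "t \<in> ?I" and \<psi>: "continuous_on UNIV \<psi>" for t \<psi>
  proof -
    obtain C where "\<And>x. x \<in> \<Omega> \<Longrightarrow> \<bar>\<psi> x\<bar> \<le> C" by (rule continuous_bounded_on_bounded[OF \<psi> u.dom(2)]) blast
    then show ?thesis by (rule diff[OF t continuous_on_imp_measurable_lebesgue_on[OF \<psi>]])
  qed
  show ?thesis
  proof
    show "open \<Omega>" "bounded \<Omega>" by (rule u.dom)+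
    show "integrable (lebesgue_on \<Omega>) (\<lambda>x. u t x - v t x)" if "t \<in> ?I" for t
      using u.u_int[OF that] v.u_int[OF that] by simp
    show "continuous_on ?I (\<lambda>t. LINT x|lebesgue_on \<Omega>. (u t x - v t x) * \<psi> x)"
      if \<psi>: "\<psi> \<in> borel_measurable (lebesgue_on \<Omega>)" "\<And>x. x \<in> \<Omega> \<Longrightarrow> \<bar>\<psi> x\<bar> \<le> C" for \<psi> C
    proof -
      have "continuous_on ?I (\<lambda>t. (LINT x|lebesgue_on \<Omega>. u t x * \<psi> x) - (LINT x|lebesgue_on \<Omega>. v t x * \<psi> x))"
        by (intro continuous_on_diff u.u_cont[OF \<psi>] v.u_cont[OF \<psi>])
      moreover have "continuous_on ?I (\<lambda>t. LINT x|lebesgue_on \<Omega>. (u t x - v t x) * \<psi> x) = continuous_on ?I (\<lambda>t. (LINT x|lebesgue_on \<Omega>. u t x * \<psi> x) - (LINT x|lebesgue_on \<Omega>. v t x * \<psi> x))"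
        by (rule continuous_on_cong[OF refl]) (rule diff[OF _ \<psi>])
      ultimately show ?thesis by simp
    qed
    show "\<exists>C. \<forall>t\<in>{-c..c}. (LINT x|lebesgue_on \<Omega>. \<bar>u t x - v t x\<bar>) \<le> C" if c: "c < T" for c
    proof -
      obtain C1 where C1: "\<And>t. t \<in> {-c..c} \<Longrightarrow> (LINT x|lebesgue_on \<Omega>. \<bar>u t x\<bar>) \<le> C1" using u.u_bound[OF c] by blast
      obtain C2 where C2: "\<And>t. t \<in> {-c..c} \<Longrightarrow> (LINT x|lebesgue_on \<Omega>. \<bar>v t x\<bar>) \<le> C2" using v.u_bound[OF c] by blast
      have "(LINT x|lebesgue_on \<Omega>. \<bar>u t x - v t x\<bar>) \<le> C1 + C2" if t: "t \<in> {-c..c}" for t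
      proof -
        have tI: "t \<in> ?I" using t c by auto
        have "(LINT x|lebesgue_on \<Omega>. \<bar>u t x - v t x\<bar>) \<le> (LINT x|lebesgue_on \<Omega>. \<bar>u t x\<bar> + \<bar>v t x\<bar>)"
          by (rule integral_mono) (use u.u_int[OF tI] v.u_int[OF tI] in auto)
        also have "\<dots> = (LINT x|lebesgue_on \<Omega>. \<bar>u t x\<bar>) + (LINT x|lebesgue_on \<Omega>. \<bar>v t x\<bar>)"
          using u.u_int[OF tI] v.u_int[OF tI] by simp
        finally show ?thesis using C1[OF t] C2[OF t] by simp
      qed
      then show ?thesis by blast
    qed
    fix \<theta> \<psi> assume \<theta>: "\<theta> \<in> test_functions ?I" and \<psi>: "\<psi> \<in> test_functions \<Omega>"
    have \<theta>'': "deriv (deriv \<theta>) \<in> test_functions ?I" by (intro test_functions_deriv \<theta>)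
    have c\<psi>: "continuous_on UNIV \<psi>" by (rule smooth_on_continuous_on[OF test_functions_smooth[OF \<psi>]])
    have cl: "continuous_on UNIV (lap \<psi>)"
      unfolding lap_def[abs_def]
      by (intro continuous_on_sum smooth_on_continuous_on smooth_on_partial test_functions_smooth[OF \<psi>])
    have split: "(LINT t|lebesgue_on ?I. \<eta> t * (LINT x|lebesgue_on \<Omega>. (u t x - v t x) * f x)) =
      (LINT t|lebesgue_on ?I. \<eta> t * (LINT x|lebesgue_on \<Omega>. u t x * f x)) - (LINT t|lebesgue_on ?I. \<eta> t * (LINT x|lebesgue_on \<Omega>. v t x * f x))"
      if \<eta>: "\<eta> \<in> test_functions ?I" and f: "continuous_on UNIV f" for \<eta> f
    proof -
      have "(LINT t|lebesgue_on ?I. \<eta> t * (LINT x|lebesgue_on \<Omega>. (u t x - v t x) * f x)) =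
        (LINT t|lebesgue_on ?I. \<eta> t * (LINT x|lebesgue_on \<Omega>. u t x * f x) - \<eta> t * (LINT x|lebesgue_on \<Omega>. v t x * f x))"
        by (rule Bochner_Integration.integral_cong[OF refl]) (simp add: diffc[OF _ f] right_diff_distrib)
      then show ?thesis
        using time_test_mult_integrable[OF \<eta> u.u_cont_continuous[OF f]] time_test_mult_integrable[OF \<eta> v.u_cont_continuous[OF f]] by simp
    qed
    show "(LINT t|lebesgue_on ?I. deriv (deriv \<theta>) t * (LINT x|lebesgue_on \<Omega>. (u t x - v t x) * \<psi> x)) =
      (LINT t|lebesgue_on ?I. \<theta> t * (LINT x|lebesgue_on \<Omega>. (u t x - v t x) * lap \<psi> x))"
      unfolding split[OF \<theta>'' c\<psi>] split[OF \<theta> cl] u.u_wave[OF \<theta> \<psi>] v.u_wave[OF \<theta> \<psi>] ..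
  qed
qed

section \<open>Pairings in the dual space and passage to continuous representatives\<close>

context bounded_domain
begin

lemma norm_H1_scale:
  assumes u: "u \<in> H1_space \<Omega>"
  shows "norm_H1 \<Omega> (\<lambda>x. c * u x) = \<bar>c\<bar> * norm_H1 \<Omega> u"
proof -
  have g: "AE x in lebesgue_on \<Omega>. weak_grad \<Omega> (\<lambda>x. c * u x) x = c *\<^sub>R weak_grad \<Omega> u x"
    and H: "(\<lambda>x. c * u x) \<in> H1_space \<Omega>"
    using H1_linear[OF u u, of c 0] by simp_all
  have G: "\<And>b. b \<in> Basis \<Longrightarrow> (\<lambda>x. weak_grad \<Omega> u x \<bullet> b) \<in> L2_space \<Omega>" by (rule weak_grad_L2[OF u])
  have cG: "\<And>b. b \<in> Basis \<Longrightarrow> (\<lambda>x. (c *\<^sub>R weak_grad \<Omega> u x) \<bullet> b) \<in> L2_space \<Omega>"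
    using L2_linear[OF G G, of _ _ c 0] by simp
  have "(LINT x|lebesgue_on \<Omega>. weak_grad \<Omega> (\<lambda>x. c * u x) x \<bullet> weak_grad \<Omega> (\<lambda>x. c * u x) x) = (LINT x|lebesgue_on \<Omega>. (c *\<^sub>R weak_grad \<Omega> u x) \<bullet> (c *\<^sub>R weak_grad \<Omega> u x))"
    by (intro LINT_inner_cong_AE g inner_L2_integrable weak_grad_L2[OF H] cG)
  also have "\<dots> = c\<^sup>2 * (LINT x|lebesgue_on \<Omega>. weak_grad \<Omega> u x \<bullet> weak_grad \<Omega> u x)"
    by (simp add: power2_eq_square mult.assoc)
  finally have 1: "(LINT x|lebesgue_on \<Omega>. weak_grad \<Omega> (\<lambda>x. c * u x) x \<bullet> weak_grad \<Omega> (\<lambda>x. c * u x) x) = c\<^sup>2 * (LINT x|lebesgue_on \<Omega>. weak_grad \<Omega> u x \<bullet> weak_grad \<Omega> u x)" .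
  have 2: "(LINT x|lebesgue_on \<Omega>. (c * u x)\<^sup>2) = c\<^sup>2 * (LINT x|lebesgue_on \<Omega>. (u x)\<^sup>2)"
    by (simp add: power_mult_distrib)
  show ?thesis
    unfolding norm_H1_def power2_norm_eq_inner 1 2 distrib_left[symmetric] by (simp add: real_sqrt_mult)
qed

text \<open>\<open>norm_Hm1\<close> is a real supremum, which bounds its members only when the
  family is bounded above; the continuity constants of \<open>F\<close> and \<open>G\<close> provide
  this. Rescaling brings \<psi> into the unit ball.\<close>

lemma Hm1_pairing_bound:
  assumes \<psi>: "\<psi> \<in> test_functions \<Omega>"
  obtains K where "\<And>F G. F \<in> Hm1_space \<Omega> \<Longrightarrow> G \<in> Hm1_space \<Omega> \<Longrightarrow> \<bar>F \<psi> - G \<psi>\<bar> \<le> K * norm_Hm1 \<Omega> (\<lambda>v. F v - G v)"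
proof -
  \<comment> \<open>Adding 1 avoids dividing by the norm of a \<psi> that may be zero.\<close>
  define K where "K = norm_H1 \<Omega> \<psi> + 1"
  have n0: "norm_H1 \<Omega> \<psi> \<ge> 0" unfolding norm_H1_def by (intro real_sqrt_ge_zero add_nonneg_nonneg integral_nonneg_AE) auto
  then have K: "K > 0" by (simp add: K_def)
  define \<phi> where "\<phi> x = (1 / K) * \<psi> x" for x
  have \<phi>t: "\<phi> \<in> test_functions \<Omega>"
    using test_functions_mult_smooth[OF \<psi> smooth_on_const[OF open_UNIV, of "1 / K"]] by (simp add: \<phi>_def[abs_def] mult.commute)
  have "norm_H1 \<Omega> \<phi> = \<bar>1 / K\<bar> * norm_H1 \<Omega> \<psi>"
    unfolding \<phi>_def[abs_def] by (rule norm_H1_scale[OF test_H1[OF \<psi>]])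
  also have "\<dots> \<le> 1" using K n0 by (simp add: K_def)
  finally have n1: "norm_H1 \<Omega> \<phi> \<le> 1" .
  show ?thesis
  proof (rule that[of K])
    fix F G assume F: "F \<in> Hm1_space \<Omega>" and G: "G \<in> Hm1_space \<Omega>"
    have lin: "H \<phi> = (1 / K) * H \<psi>" if "H \<in> Hm1_space \<Omega>" for H
    proof -
      have "H (\<lambda>x. (1 / K) * \<psi> x + 0 * \<psi> x) = (1 / K) * H \<psi> + 0 * H \<psi>"
        using that test_H10[OF \<psi>] unfolding Hm1_space_def by blast
      then show ?thesis by (simp add: \<phi>_def[abs_def])
    qed
    obtain C1 where C1: "\<And>u. u \<in> H10_space \<Omega> \<Longrightarrow> \<bar>F u\<bar> \<le> C1 * norm_H1 \<Omega> u" using F unfolding Hm1_space_def by blast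
    obtain C2 where C2: "\<And>u. u \<in> H10_space \<Omega> \<Longrightarrow> \<bar>G u\<bar> \<le> C2 * norm_H1 \<Omega> u" using G unfolding Hm1_space_def by blast
    have "\<bar>F \<phi> - G \<phi>\<bar> \<le> norm_Hm1 \<Omega> (\<lambda>v. F v - G v)"
      unfolding norm_Hm1_def
    proof (rule cSUP_upper)
      show "\<phi> \<in> {u \<in> H10_space \<Omega>. norm_H1 \<Omega> u \<le> 1}" using test_H10[OF \<phi>t] n1 by simp
      show "bdd_above ((\<lambda>u. \<bar>F u - G u\<bar>) ` {u \<in> H10_space \<Omega>. norm_H1 \<Omega> u \<le> 1})"
      proof (rule bdd_aboveI2)
        fix u assume "u \<in> {u \<in> H10_space \<Omega>. norm_H1 \<Omega> u \<le> 1}"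
        then have u: "u \<in> H10_space \<Omega>" "norm_H1 \<Omega> u \<le> 1" by auto
        have nn: "norm_H1 \<Omega> u \<ge> 0" unfolding norm_H1_def by (intro real_sqrt_ge_zero add_nonneg_nonneg integral_nonneg_AE) auto
        have "\<bar>F u - G u\<bar> \<le> C1 * norm_H1 \<Omega> u + C2 * norm_H1 \<Omega> u"
          using C1[OF u(1)] C2[OF u(1)] by linarith
        also have "\<dots> \<le> \<bar>C1\<bar> * norm_H1 \<Omega> u + \<bar>C2\<bar> * norm_H1 \<Omega> u"
          by (intro add_mono mult_right_mono nn) auto
        also have "\<dots> \<le> \<bar>C1\<bar> * 1 + \<bar>C2\<bar> * 1"
          by (intro add_mono mult_left_mono u(2)) auto
        finally show "\<bar>F u - G u\<bar> \<le> \<bar>C1\<bar> * 1 + \<bar>C2\<bar> * 1" .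
      qed
    qed
    moreover have "F \<phi> - G \<phi> = (F \<psi> - G \<psi>) / K" by (simp add: lin[OF F] lin[OF G] diff_divide_distrib)
    ultimately have "\<bar>F \<psi> - G \<psi>\<bar> / K \<le> norm_Hm1 \<Omega> (\<lambda>v. F v - G v)" using K by (simp add: abs_divide)
    then show "\<bar>F \<psi> - G \<psi>\<bar> \<le> K * norm_Hm1 \<Omega> (\<lambda>v. F v - G v)" using K by (simp add: pos_divide_le_eq mult.commute)
  qed
qed

definition L2_continuous :: "real set \<Rightarrow> (real \<Rightarrow> 'a \<Rightarrow> real) \<Rightarrow> bool" where
  "L2_continuous I g \<longleftrightarrow> (\<forall>t\<in>I. g t \<in> L2_space \<Omega> \<and> ((\<lambda>s. norm_L2 \<Omega> (\<lambda>x. g s x - g t x)) \<longlongrightarrow> 0) (at t within I))"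

lemma L2_continuous_inner:
  assumes g: "L2_continuous I g" and \<psi>: "\<psi> \<in> L2_space \<Omega>"
  shows "continuous_on I (\<lambda>t. LINT x|lebesgue_on \<Omega>. g t x * \<psi> x)"
  unfolding continuous_on_def
proof
  fix t assume t: "t \<in> I"
  have gt: "g s \<in> L2_space \<Omega>" if "s \<in> I" for s using g that by (simp add: L2_continuous_def)
  show "((\<lambda>t. LINT x|lebesgue_on \<Omega>. g t x * \<psi> x) \<longlongrightarrow> (LINT x|lebesgue_on \<Omega>. g t x * \<psi> x)) (at t within I)"
  proof (rule LIM_zero_cancel, rule Lim_null_comparison)
    show "eventually (\<lambda>s. norm ((LINT x|lebesgue_on \<Omega>. g s x * \<psi> x) - (LINT x|lebesgue_on \<Omega>. g t x * \<psi> x)) \<le> norm_L2 \<Omega> (\<lambda>x. g s x - g t x) * norm_L2 \<Omega> \<psi>) (at t within I)"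
      unfolding eventually_at_filter
    proof (intro always_eventually allI impI)
      fix s assume s: "s \<in> I"
      have "(LINT x|lebesgue_on \<Omega>. g s x * \<psi> x) - (LINT x|lebesgue_on \<Omega>. g t x * \<psi> x) = (LINT x|lebesgue_on \<Omega>. (g s x - g t x) * \<psi> x)"
        unfolding left_diff_distrib
        by (rule Bochner_Integration.integral_diff[symmetric]) (intro L2_mult_integrable gt s t \<psi>)+
      then show "norm ((LINT x|lebesgue_on \<Omega>. g s x * \<psi> x) - (LINT x|lebesgue_on \<Omega>. g t x * \<psi> x)) \<le> norm_L2 \<Omega> (\<lambda>x. g s x - g t x) * norm_L2 \<Omega> \<psi>"
        using L2_Cauchy_Schwarz[OF L2_diff[OF gt[OF s] gt[OF t]] \<psi>] by simp
    qed
    have "((\<lambda>s. norm_L2 \<Omega> (\<lambda>x. g s x - g t x) * norm_L2 \<Omega> \<psi>) \<longlongrightarrow> 0 * norm_L2 \<Omega> \<psi>) (at t within I)"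
      using g t by (intro tendsto_mult_right) (simp add: L2_continuous_def)
    then show "((\<lambda>s. norm_L2 \<Omega> (\<lambda>x. g s x - g t x) * norm_L2 \<Omega> \<psi>) \<longlongrightarrow> 0) (at t within I)" by simp
  qed
qed

lemma L2_continuous_abs_integral:
  assumes g: "L2_continuous I g"
  shows "continuous_on I (\<lambda>t. LINT x|lebesgue_on \<Omega>. \<bar>g t x\<bar>)"
  unfolding continuous_on_def
proof
  fix t assume t: "t \<in> I"
  have gt: "g s \<in> L2_space \<Omega>" if "s \<in> I" for s using g that by (simp add: L2_continuous_def)
  show "((\<lambda>t. LINT x|lebesgue_on \<Omega>. \<bar>g t x\<bar>) \<longlongrightarrow> (LINT x|lebesgue_on \<Omega>. \<bar>g t x\<bar>)) (at t within I)"
  proof (rule LIM_zero_cancel, rule Lim_null_comparison)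
    show "eventually (\<lambda>s. norm ((LINT x|lebesgue_on \<Omega>. \<bar>g s x\<bar>) - (LINT x|lebesgue_on \<Omega>. \<bar>g t x\<bar>)) \<le> norm_L2 \<Omega> (\<lambda>x. g s x - g t x) * norm_L2 \<Omega> (\<lambda>_. 1)) (at t within I)"
      unfolding eventually_at_filter
    proof (intro always_eventually allI impI)
      fix s assume s: "s \<in> I"
      note i = L2_integrable[OF gt[OF s]] L2_integrable[OF gt[OF t]]
      have "\<bar>(LINT x|lebesgue_on \<Omega>. \<bar>g s x\<bar>) - (LINT x|lebesgue_on \<Omega>. \<bar>g t x\<bar>)\<bar> = \<bar>LINT x|lebesgue_on \<Omega>. \<bar>g s x\<bar> - \<bar>g t x\<bar>\<bar>"
        using i by simp
      also have "\<dots> \<le> (LINT x|lebesgue_on \<Omega>. \<bar>\<bar>g s x\<bar> - \<bar>g t x\<bar>\<bar>)" by (rule integral_abs_bound)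
      also have "\<dots> \<le> (LINT x|lebesgue_on \<Omega>. \<bar>g s x - g t x\<bar>)"
        by (rule integral_mono) (use i in auto)
      also have "\<dots> \<le> norm_L2 \<Omega> (\<lambda>x. g s x - g t x) * norm_L2 \<Omega> (\<lambda>_. 1)"
        by (rule L2_abs_integral_le[OF L2_diff[OF gt[OF s] gt[OF t]]])
      finally show "norm ((LINT x|lebesgue_on \<Omega>. \<bar>g s x\<bar>) - (LINT x|lebesgue_on \<Omega>. \<bar>g t x\<bar>)) \<le> norm_L2 \<Omega> (\<lambda>x. g s x - g t x) * norm_L2 \<Omega> (\<lambda>_. 1)"
        by simp
    qed
    have "((\<lambda>s. norm_L2 \<Omega> (\<lambda>x. g s x - g t x) * norm_L2 \<Omega> (\<lambda>_. 1)) \<longlongrightarrow> 0 * norm_L2 \<Omega> (\<lambda>_. 1)) (at t within I)"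
      using g t by (intro tendsto_mult_right) (simp add: L2_continuous_def)
    then show "((\<lambda>s. norm_L2 \<Omega> (\<lambda>x. g s x - g t x) * norm_L2 \<Omega> (\<lambda>_. 1)) \<longlongrightarrow> 0) (at t within I)" by simp
  qed
qed

lemma LINT_mult_cong_AE:
  fixes u v \<psi> :: "'a \<Rightarrow> real"
  assumes "AE x in lebesgue_on \<Omega>. u x = v x"
  shows "(LINT x|lebesgue_on \<Omega>. u x * \<psi> x) = (LINT x|lebesgue_on \<Omega>. v x * \<psi> x)"
proof (rule LINT_cong_AE_lebesgue_on[OF dom_sets])
  show "AE x in lebesgue_on \<Omega>. u x * \<psi> x = v x * \<psi> x" using assms by eventually_elim simp
qed

text \<open>Here \<psi> ranges over all of H10 and not only over test functions, since values of
  \<open>w\<close> itself will be inserted. The right-hand side keeps \<open>w\<close>, whose values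
  are known to lie in H10 at almost every time.\<close>

definition represents :: "real \<Rightarrow> (real \<Rightarrow> 'a \<Rightarrow> real) \<Rightarrow> (real \<Rightarrow> 'a \<Rightarrow> real) \<Rightarrow> bool" where
  "represents T w g \<longleftrightarrow> L2_continuous {-T<..<T} g \<and>
     (AE t in lebesgue_on {-T<..<T}. w t \<in> H10_space \<Omega> \<and> (AE x in lebesgue_on \<Omega>. w t x = g t x)) \<and>
     (\<forall>\<theta>\<in>test_functions {-T<..<T}. \<forall>\<psi>\<in>H10_space \<Omega>.
       (LINT t|lebesgue_on {-T<..<T}. deriv (deriv \<theta>) t * (LINT x|lebesgue_on \<Omega>. g t x * \<psi> x)) =
       (LINT t|lebesgue_on {-T<..<T}. \<theta> t * laplacian \<Omega> (w t) \<psi>))"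

text \<open>\<gamma> is the continuous representative of the time derivative with values in the dual
  of H10. It is recorded only through its pairings with test functions, and these suffice to
  identify \<open>v0\<close>.\<close>

definition velocity :: "real \<Rightarrow> ('a \<Rightarrow> real) \<Rightarrow> (real \<Rightarrow> 'a \<Rightarrow> real) \<Rightarrow> (real \<Rightarrow> ('a \<Rightarrow> real) \<Rightarrow> real) \<Rightarrow> bool" where
  "velocity T v0 g \<gamma> \<longleftrightarrow> (\<forall>\<psi>\<in>test_functions \<Omega>.
     continuous_on {-T<..<T} (\<lambda>t. \<gamma> t \<psi>) \<and> \<gamma> 0 \<psi> = (LINT x|lebesgue_on \<Omega>. v0 x * \<psi> x) \<and>
     (\<forall>\<theta>\<in>test_functions {-T<..<T}.
       (LINT t|lebesgue_on {-T<..<T}. deriv \<theta> t * (LINT x|lebesgue_on \<Omega>. g t x * \<psi> x)) =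
       - (LINT t|lebesgue_on {-T<..<T}. \<theta> t * \<gamma> t \<psi>)))"

lemma representsD:
  assumes "represents T w g"
  shows "L2_continuous {-T<..<T} g"
    and "AE t in lebesgue_on {-T<..<T}. w t \<in> H10_space \<Omega> \<and> (AE x in lebesgue_on \<Omega>. w t x = g t x)"
    and "\<theta> \<in> test_functions {-T<..<T} \<Longrightarrow> \<psi> \<in> H10_space \<Omega> \<Longrightarrow>
       (LINT t|lebesgue_on {-T<..<T}. deriv (deriv \<theta>) t * (LINT x|lebesgue_on \<Omega>. g t x * \<psi> x)) =
       (LINT t|lebesgue_on {-T<..<T}. \<theta> t * laplacian \<Omega> (w t) \<psi>)"
  using assms unfolding represents_def by blast+

lemma velocityD:
  assumes "velocity T v0 g \<gamma>" "\<psi> \<in> test_functions \<Omega>"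
  shows "continuous_on {-T<..<T} (\<lambda>t. \<gamma> t \<psi>)"
    and "\<gamma> 0 \<psi> = (LINT x|lebesgue_on \<Omega>. v0 x * \<psi> x)"
    and "\<theta> \<in> test_functions {-T<..<T} \<Longrightarrow>
       (LINT t|lebesgue_on {-T<..<T}. deriv \<theta> t * (LINT x|lebesgue_on \<Omega>. g t x * \<psi> x)) =
       - (LINT t|lebesgue_on {-T<..<T}. \<theta> t * \<gamma> t \<psi>)"
  using assms unfolding velocity_def by blast+

text \<open>Chaining the two time derivatives gives one equation of second order in time, from which
  \<open>w1\<close> and \<open>w2\<close> have disappeared; the continuous versions come from the
  two initial conditions.\<close>

lemma wave_solutionD:
  assumes sol: "wave_solution \<Omega> T w0 v0 w" and T: "T > 0" and w0: "w0 \<in> L2_space \<Omega>"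
  obtains g \<gamma> where "represents T w g" "AE x in lebesgue_on \<Omega>. g 0 x = w0 x" "velocity T v0 g \<gamma>"
proof -
  let ?I = "{-T<..<T}"
  have Is: "?I \<in> sets lebesgue" by simp
  from sol obtain w1 w2 where
      wB: "w \<in> bochner_L2 ?I (H10_space \<Omega>) (norm_H1 \<Omega>)"
      and d1: "has_time_derivative ?I \<Omega> (\<lambda>t. L2_to_Hm1 \<Omega> (w t)) (\<lambda>t. L2_to_Hm1 \<Omega> (w1 t))"
      and d2: "has_time_derivative ?I \<Omega> (\<lambda>t. L2_to_Hm1 \<Omega> (w1 t)) w2"
      and eq: "AE t in lebesgue_on ?I. \<forall>\<psi>\<in>H10_space \<Omega>. w2 t \<psi> - laplacian \<Omega> (w t) \<psi> = 0"
      and v: "has_value_at ?I (L2_space \<Omega>) (norm_L2 \<Omega>) w 0 w0"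
      and v': "has_value_at ?I (Hm1_space \<Omega>) (norm_Hm1 \<Omega>) (\<lambda>t. L2_to_Hm1 \<Omega> (w1 t)) 0 (L2_to_Hm1 \<Omega> v0)"
    unfolding wave_solution_def by blast
  from v obtain g where g: "\<forall>t\<in>?I. g t \<in> L2_space \<Omega>"
      "\<forall>t\<in>?I. ((\<lambda>s. norm_L2 \<Omega> (\<lambda>x. g s x - g t x)) \<longlongrightarrow> 0) (at t within ?I)"
      "AE t in lebesgue_on ?I. w t \<in> L2_space \<Omega> \<and> norm_L2 \<Omega> (\<lambda>x. g t x - w t x) = 0"
      "norm_L2 \<Omega> (\<lambda>x. g 0 x - w0 x) = 0"
    unfolding has_value_at_def by blast
  from v' obtain \<gamma> where \<gamma>: "\<forall>t\<in>?I. \<gamma> t \<in> Hm1_space \<Omega>"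
      "\<forall>t\<in>?I. ((\<lambda>s. norm_Hm1 \<Omega> (\<lambda>x. \<gamma> s x - \<gamma> t x)) \<longlongrightarrow> 0) (at t within ?I)"
      "AE t in lebesgue_on ?I. L2_to_Hm1 \<Omega> (w1 t) \<in> Hm1_space \<Omega> \<and> norm_Hm1 \<Omega> (\<lambda>x. \<gamma> t x - L2_to_Hm1 \<Omega> (w1 t) x) = 0"
      "L2_to_Hm1 \<Omega> v0 \<in> Hm1_space \<Omega>" "norm_Hm1 \<Omega> (\<lambda>x. \<gamma> 0 x - L2_to_Hm1 \<Omega> v0 x) = 0"
    unfolding has_value_at_def by blast
  have gI: "g t \<in> L2_space \<Omega>" if "t \<in> ?I" for t using g(1) that by blast
  have \<gamma>I: "\<gamma> t \<in> Hm1_space \<Omega>" if "t \<in> ?I" for t using \<gamma>(1) that by blast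
  have I0: "0 \<in> ?I" using T by simp
  have H10: "AE t in lebesgue_on ?I. w t \<in> H10_space \<Omega>" using wB by (simp add: bochner_L2_def)
  have wg: "AE t in lebesgue_on ?I. AE x in lebesgue_on \<Omega>. w t x = g t x"
    using g(3) AE_space[of "lebesgue_on ?I"]
  proof eventually_elim
    case (elim t)
    then have t: "t \<in> ?I" by simp
    have "AE x in lebesgue_on \<Omega>. g t x - w t x = 0"
      by (rule norm_L2_zero_imp_AE[OF L2_diff[OF gI[OF t]]]) (use elim in auto)
    then show ?case by eventually_elim simp
  qed
  have wgL: "AE t in lebesgue_on ?I. L2_to_Hm1 \<Omega> (w t) \<psi> = (LINT x|lebesgue_on \<Omega>. g t x * \<psi> x)" for \<psi>
    using wg by eventually_elim (simp add: L2_to_Hm1_def LINT_mult_cong_AE)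
  have t1: "(LINT t|lebesgue_on ?I. deriv \<theta> t * (LINT x|lebesgue_on \<Omega>. g t x * \<psi> x)) = - (LINT t|lebesgue_on ?I. \<theta> t * L2_to_Hm1 \<Omega> (w1 t) \<psi>)"
    if \<theta>: "\<theta> \<in> test_functions ?I" and \<psi>: "\<psi> \<in> H10_space \<Omega>" for \<theta> \<psi>
  proof -
    have "(LINT t|lebesgue_on ?I. deriv \<theta> t * (LINT x|lebesgue_on \<Omega>. g t x * \<psi> x)) = (LINT t|lebesgue_on ?I. deriv \<theta> t * L2_to_Hm1 \<Omega> (w t) \<psi>)"
      by (rule LINT_cong_AE_lebesgue_on[OF Is]) (use wgL[of \<psi>] in \<open>eventually_elim, simp\<close>)
    also have "\<dots> = - (LINT t|lebesgue_on ?I. \<theta> t * L2_to_Hm1 \<Omega> (w1 t) \<psi>)"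
      using d1 \<theta> \<psi> unfolding has_time_derivative_def by blast
    finally show ?thesis .
  qed
  have "AE x in lebesgue_on \<Omega>. g 0 x - w0 x = 0"
    by (rule norm_L2_zero_imp_AE[OF L2_diff[OF gI[OF I0] w0] g(4)])
  then have g0: "AE x in lebesgue_on \<Omega>. g 0 x = w0 x" by eventually_elim simp
  have rep: "represents T w g"
    unfolding represents_def
  proof (intro conjI ballI)
    show "L2_continuous ?I g" using g(1,2) by (simp add: L2_continuous_def)
    show "AE t in lebesgue_on ?I. w t \<in> H10_space \<Omega> \<and> (AE x in lebesgue_on \<Omega>. w t x = g t x)"
      using H10 wg by eventually_elim simp
    fix \<theta> \<psi> assume \<theta>: "\<theta> \<in> test_functions ?I" and \<psi>: "\<psi> \<in> H10_space \<Omega>"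
    have "(LINT t|lebesgue_on ?I. deriv (deriv \<theta>) t * (LINT x|lebesgue_on \<Omega>. g t x * \<psi> x)) = - (LINT t|lebesgue_on ?I. deriv \<theta> t * L2_to_Hm1 \<Omega> (w1 t) \<psi>)"
      by (rule t1[OF test_functions_deriv[OF \<theta>] \<psi>])
    also have "\<dots> = (LINT t|lebesgue_on ?I. \<theta> t * w2 t \<psi>)"
      using d2 \<theta> \<psi> unfolding has_time_derivative_def by simp
    also have "\<dots> = (LINT t|lebesgue_on ?I. \<theta> t * laplacian \<Omega> (w t) \<psi>)"
      by (rule LINT_cong_AE_lebesgue_on[OF Is]) (use eq in \<open>eventually_elim, use \<psi> in simp\<close>)
    finally show "(LINT t|lebesgue_on ?I. deriv (deriv \<theta>) t * (LINT x|lebesgue_on \<Omega>. g t x * \<psi> x)) = (LINT t|lebesgue_on ?I. \<theta> t * laplacian \<Omega> (w t) \<psi>)" .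
  qed
  have vel: "velocity T v0 g \<gamma>"
    unfolding velocity_def
  proof (intro ballI conjI)
    fix \<psi> assume \<psi>: "\<psi> \<in> test_functions \<Omega>"
    obtain K where K: "\<And>F G. F \<in> Hm1_space \<Omega> \<Longrightarrow> G \<in> Hm1_space \<Omega> \<Longrightarrow> \<bar>F \<psi> - G \<psi>\<bar> \<le> K * norm_Hm1 \<Omega> (\<lambda>v. F v - G v)"
      by (rule Hm1_pairing_bound[OF \<psi>]) blast
    show "continuous_on ?I (\<lambda>t. \<gamma> t \<psi>)"
      unfolding continuous_on_def
    proof
      fix t assume t: "t \<in> ?I"
      show "((\<lambda>t. \<gamma> t \<psi>) \<longlongrightarrow> \<gamma> t \<psi>) (at t within ?I)"
      proof (rule LIM_zero_cancel, rule Lim_null_comparison)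
        show "eventually (\<lambda>s. norm (\<gamma> s \<psi> - \<gamma> t \<psi>) \<le> K * norm_Hm1 \<Omega> (\<lambda>x. \<gamma> s x - \<gamma> t x)) (at t within ?I)"
          unfolding eventually_at_filter using K[OF \<gamma>I \<gamma>I[OF t]] by (intro always_eventually) auto
        have "((\<lambda>s. K * norm_Hm1 \<Omega> (\<lambda>x. \<gamma> s x - \<gamma> t x)) \<longlongrightarrow> K * 0) (at t within ?I)"
          by (intro tendsto_mult_left) (use \<gamma>(2) t in blast)
        then show "((\<lambda>s. K * norm_Hm1 \<Omega> (\<lambda>x. \<gamma> s x - \<gamma> t x)) \<longlongrightarrow> 0) (at t within ?I)" by simp
      qed
    qed
    show "\<gamma> 0 \<psi> = (LINT x|lebesgue_on \<Omega>. v0 x * \<psi> x)"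
      using K[OF \<gamma>I[OF I0] \<gamma>(4)] \<gamma>(5) by (simp add: L2_to_Hm1_def)
    fix \<theta> assume \<theta>: "\<theta> \<in> test_functions ?I"
    have "AE t in lebesgue_on ?I. L2_to_Hm1 \<Omega> (w1 t) \<psi> = \<gamma> t \<psi>"
      using \<gamma>(3) AE_space[of "lebesgue_on ?I"]
    proof eventually_elim
      case (elim t)
      then have t: "t \<in> ?I" by simp
      show ?case using K[OF \<gamma>I[OF t], of "L2_to_Hm1 \<Omega> (w1 t)"] elim by simp
    qed
    then have "AE t in lebesgue_on ?I. \<theta> t * L2_to_Hm1 \<Omega> (w1 t) \<psi> = \<theta> t * \<gamma> t \<psi>" by eventually_elim simp
    then have "(LINT t|lebesgue_on ?I. \<theta> t * L2_to_Hm1 \<Omega> (w1 t) \<psi>) = (LINT t|lebesgue_on ?I. \<theta> t * \<gamma> t \<psi>)"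
      by (rule LINT_cong_AE_lebesgue_on[OF Is])
    then show "(LINT t|lebesgue_on ?I. deriv \<theta> t * (LINT x|lebesgue_on \<Omega>. g t x * \<psi> x)) = - (LINT t|lebesgue_on ?I. \<theta> t * \<gamma> t \<psi>)"
      using t1[OF \<theta> test_H10[OF \<psi>]] by simp
  qed
  show ?thesis by (rule that[OF rep g0 vel])
qed

lemma represents_imp_weak_wave:
  assumes rep: "represents T w g"
  shows "weak_wave \<Omega> T g"
proof
  let ?I = "{-T<..<T}"
  note g = representsD(1)[OF rep] and wg = representsD(2)[OF rep] and wave = representsD(3)[OF rep]
  show "open \<Omega>" "bounded \<Omega>" by (rule dom)+
  have gt: "g t \<in> L2_space \<Omega>" if "t \<in> ?I" for t using g that by (simp add: L2_continuous_def)
  show "integrable (lebesgue_on \<Omega>) (g t)" if "t \<in> ?I" for t by (rule L2_integrable[OF gt[OF that]])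
  show "continuous_on ?I (\<lambda>t. LINT x|lebesgue_on \<Omega>. g t x * \<psi> x)"
    if "\<psi> \<in> borel_measurable (lebesgue_on \<Omega>)" "\<And>x. x \<in> \<Omega> \<Longrightarrow> \<bar>\<psi> x\<bar> \<le> C" for \<psi> C
    by (rule L2_continuous_inner[OF g bounded_L2[OF that]])
  show "\<exists>C. \<forall>t\<in>{-c..c}. (LINT x|lebesgue_on \<Omega>. \<bar>g t x\<bar>) \<le> C" if "c < T" for c
  proof -
    have "compact ((\<lambda>t. LINT x|lebesgue_on \<Omega>. \<bar>g t x\<bar>) ` {-c..c})"
      by (intro compact_continuous_image continuous_on_subset[OF L2_continuous_abs_integral[OF g]]) (use that in auto)
    then obtain C where "\<forall>y\<in>(\<lambda>t. LINT x|lebesgue_on \<Omega>. \<bar>g t x\<bar>) ` {-c..c}. norm y \<le> C"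
      using compact_imp_bounded bounded_iff by blast
    then show ?thesis by (intro exI[of _ C]) fastforce
  qed
  fix \<theta> \<psi> assume \<theta>: "\<theta> \<in> test_functions ?I" and \<psi>: "\<psi> \<in> test_functions \<Omega>"
  have "(LINT t|lebesgue_on ?I. \<theta> t * laplacian \<Omega> (w t) \<psi>) = (LINT t|lebesgue_on ?I. \<theta> t * (LINT x|lebesgue_on \<Omega>. g t x * lap \<psi> x))"
  proof (rule LINT_cong_AE_lebesgue_on)
    show "AE t in lebesgue_on ?I. \<theta> t * laplacian \<Omega> (w t) \<psi> = \<theta> t * (LINT x|lebesgue_on \<Omega>. g t x * lap \<psi> x)"
      using wg
    proof eventually_elim
      case (elim t)
      then show ?case using laplacian_test[OF H10_H1 \<psi>, of "w t"] LINT_mult_cong_AE[of "w t" "g t"] by simp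
    qed
  qed simp
  then show "(LINT t|lebesgue_on ?I. deriv (deriv \<theta>) t * (LINT x|lebesgue_on \<Omega>. g t x * \<psi> x)) =
      (LINT t|lebesgue_on ?I. \<theta> t * (LINT x|lebesgue_on \<Omega>. g t x * lap \<psi> x))"
    using wave[OF \<theta> test_H10[OF \<psi>]] by simp
qed

end

section \<open>A uniqueness result for symmetric kernels\<close>

text \<open>\<open>P t s\<close> stands for the L2 inner product of the solution at the times
  \<open>t\<close> and \<open>s\<close>. The assumption \<open>sym\<close> is the equation
  \<partial>_tt P = \<partial>_ss P, tested with products, and \<open>zero\<close> is a strip of
  vanishing about s = 0.\<close>

locale wave_kernel =
  fixes P :: "real \<Rightarrow> real \<Rightarrow> real" and T b :: real
  assumes b: "0 < b" "b < T"
    and cont: "continuous_on ({-T<..<T} \<times> {-T<..<T}) (\<lambda>(t, s). P t s)"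
    and zero: "\<And>t s. \<lbrakk>t \<in> {-T<..<T}; \<bar>s\<bar> < b\<rbrakk> \<Longrightarrow> P t s = 0"
    and sym: "\<And>c \<theta> \<eta>. \<lbrakk>c < T; smooth_on UNIV \<theta>; smooth_on UNIV \<eta>; \<And>t. t \<notin> {-c..c} \<Longrightarrow> \<theta> t = 0; \<And>t. t \<notin> {-c..c} \<Longrightarrow> \<eta> t = 0\<rbrakk> \<Longrightarrow>
      integral {-c..c} (\<lambda>t. deriv (deriv \<theta>) t * integral {-c..c} (\<lambda>s. \<eta> s * P t s)) =
      integral {-c..c} (\<lambda>t. \<theta> t * integral {-c..c} (\<lambda>s. deriv (deriv \<eta>) s * P t s))"
begin

lemma cont_compose:
  assumes "continuous_on A f" "continuous_on A g" "f ` A \<subseteq> {-T<..<T}" "g ` A \<subseteq> {-T<..<T}"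
  shows "continuous_on A (\<lambda>x. P (f x) (g x))"
proof -
  have "continuous_on A (\<lambda>x. case (f x, g x) of (t, s) \<Rightarrow> P t s)"
    by (rule continuous_on_compose2[OF cont]) (use assms in \<open>auto intro!: continuous_on_Pair\<close>)
  then show ?thesis by simp
qed

text \<open>One-dimensional uniqueness once more, with \<open>s\<close> as the evolution variable:
  the strip of vanishing in \<open>s\<close> plays the part of the ball on which a spherical wave
  was invisible.\<close>

lemma zero_half:
  assumes t: "\<bar>t\<bar> < T - 3 / 4 * (T - b)" and s: "0 \<le> s" "s < T - 3 / 4 * (T - b)"
  shows "P t s = 0"
proof -
  \<comment> \<open>This is b + (T - b)/4. From the strip, vanishing spreads to \<bar>t\<bar> + s <
    T + b, so the corner (\<beta>, \<beta>) lies strictly inside because 2 \<beta> - b < T;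
    \<open>c\<close> is placed between these two numbers.\<close>
  define \<beta> where "\<beta> = T - 3 / 4 * (T - b)"
  define c where "c = T - (T - b) / 8"
  have c: "\<beta> < c" "2 * \<beta> - b < c" "c < T" "b < \<beta>" "0 < c" using b by (auto simp: \<beta>_def c_def field_simps)
  have I: "{-c..c} \<subseteq> {-T<..<T}" "{0..c} \<subseteq> {-T<..<T}" using c b by auto
  define m where "m F t = integral {0..c} (\<lambda>s. F s * P t s)" for F t
  have cP: "continuous_on {0..c} (P t)" "continuous_on {-c..c} (P t)" if "t \<in> {-T<..<T}" for t
    by (rule cont_compose; use that I in \<open>auto intro!: continuous_intros\<close>)+
  have scont: "continuous_on A (\<lambda>x. F (h x))" if "smooth_on UNIV F" "continuous_on A h"
    for F :: "real \<Rightarrow> real" and A :: "'x::topological_space set" and h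
    by (rule continuous_on_smooth_compose[OF that])
  interpret W: wave_1d m "-c" c b \<beta>
  proof
    show "b \<le> \<beta>" using c by simp
  next
    fix F t l assume F: "admissible \<beta> F" and t: "t \<in> {-c..c}" and l: "l \<in> {0..\<beta> - b}"
    have sF: "smooth_on UNIV F" "smooth_on UNIV (deriv F)" using F by (auto simp: admissible_def smooth_on_deriv)
    have tI: "t \<in> {-T<..<T}" using t I by blast
    have "((\<lambda>l. integral (cbox 0 c) (\<lambda>s. F (s + l) * P t s)) has_real_derivative integral (cbox 0 c) (\<lambda>s. deriv F (s + l) * P t s)) (at l within {0..\<beta> - b})"
    proof (rule leibniz_rule_field_derivative)
      fix l s
      have "((\<lambda>l. F (s + l)) has_real_derivative deriv F (s + l)) (at l)"
        using smooth_on_has_real_derivative[OF sF(1), of "l + s"] DERIV_shift[of F "deriv F (l + s)" l s] by (simp add: add.commute)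
      from DERIV_cmult_right[OF this, of "P t s"]
      show "((\<lambda>l. F (s + l) * P t s) has_real_derivative deriv F (s + l) * P t s) (at l within {0..\<beta> - b})"
        by (rule DERIV_subset) simp
    next
      fix l show "(\<lambda>s. F (s + l) * P t s) integrable_on cbox 0 c"
        unfolding cbox_interval
        by (intro integrable_continuous_real continuous_on_mult scont[OF sF(1)] cP(1)[OF tI]) (intro continuous_intros)
    next
      show "continuous_on ({0..\<beta> - b} \<times> cbox 0 c) (\<lambda>(l, s). deriv F (s + l) * P t s)"
        unfolding case_prod_unfold cbox_interval
        by (intro continuous_on_mult scont[OF sF(2)] cont_compose) (use tI I in \<open>auto intro!: continuous_intros\<close>)
    qed (use l in auto)
    then show "((\<lambda>l. m (\<lambda>r. F (r + l)) t) has_real_derivative m (\<lambda>r. deriv F (r + l)) t) (at l within {0..\<beta> - b})"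
      by (simp add: m_def cbox_interval)
  next
    fix F assume F: "admissible \<beta> F"
    have sF: "smooth_on UNIV F" using F by (simp add: admissible_def)
    have "continuous_on ({0..\<beta> - b} \<times> {-c..c}) (\<lambda>p. integral (cbox 0 c) (\<lambda>s. F (s + fst p) * P (snd p) s))"
    proof (rule integral_continuous_on_param)
      show "continuous_on (({0..\<beta> - b} \<times> {-c..c}) \<times> cbox 0 c) (\<lambda>(p, s). F (s + fst p) * P (snd p) s)"
        unfolding case_prod_unfold cbox_interval
        by (intro continuous_on_mult scont[OF sF] cont_compose) (use I in \<open>auto intro!: continuous_intros\<close>)
    qed
    then show "continuous_on ({0..\<beta> - b} \<times> {-c..c}) (\<lambda>(l, t). m (\<lambda>r. F (r + l)) t)"
      by (simp add: m_def cbox_interval case_prod_unfold)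
  next
    fix \<theta> F assume \<theta>: "smooth_on UNIV \<theta>" "\<And>t. t \<notin> {-c..c} \<Longrightarrow> \<theta> t = 0" and F: "admissible \<beta> F"
    have sF: "smooth_on UNIV F" and F0: "\<And>r. r \<ge> \<beta> \<Longrightarrow> F r = 0" using F by (auto simp: admissible_def)
    \<comment> \<open>An admissible profile need not vanish for negative \<open>s\<close>, as
      \<open>sym\<close> requires. The cutoff changes it only for s < b/2, and on the half-line s
      \<ge> 0 used by \<open>m\<close> the kernel is zero there.\<close>
    obtain \<kappa> where \<kappa>: "smooth_on UNIV \<kappa>" "\<And>s. s \<le> 0 \<Longrightarrow> \<kappa> s = 0" "\<And>s. s \<ge> b / 2 \<Longrightarrow> \<kappa> s = 1"
      by (rule smooth_step_exists[of "b / 2"]) (use b in auto)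
    define \<eta> where "\<eta> s = F s * \<kappa> s" for s
    have s\<eta>: "smooth_on UNIV \<eta>" unfolding \<eta>_def[abs_def] by (intro smooth_on_mult sF \<kappa>(1) open_UNIV)
    have \<eta>0: "\<eta> s = 0" if "s \<notin> {0..c}" for s
      using that F0[of s] \<kappa>(2)[of s] c by (cases "s < 0") (auto simp: \<eta>_def)
    have \<eta>''0: "deriv (deriv \<eta>) s = 0" if "s \<notin> {0..c}" for s
      by (rule deriv_zero_outside[OF deriv_zero_outside[OF \<eta>0] that])
    have \<eta>'': "deriv (deriv \<eta>) s = deriv (deriv F) s" if "s \<ge> b" for s
    proof -
      have "(deriv ^^ 2) \<eta> s = (deriv ^^ 2) F s"
        by (rule higher_deriv_cong_open[of "{b / 2<..}"]) (use that b \<kappa>(3) in \<open>auto simp: \<eta>_def\<close>)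
      then show ?thesis by (simp add: numeral_2_eq_2)
    qed
    \<comment> \<open>Negative \<open>s\<close> contribute nothing because \<open>h\<close> vanishes
      there, and where \<open>f\<close> and \<open>h\<close> may differ on the positive side the
      kernel is zero.\<close>
    have red: "integral {-c..c} (\<lambda>s. h s * P t s) = integral {0..c} (\<lambda>s. f s * P t s)"
      if t: "t \<in> {-c..c}" and h: "smooth_on UNIV h" "\<And>s. s \<notin> {0..c} \<Longrightarrow> h s = 0" "\<And>s. s \<ge> b \<Longrightarrow> h s = f s" for t h f
    proof -
      have tI: "t \<in> {-T<..<T}" using t I by blast
      have "(\<lambda>s. h s * P t s) integrable_on {-c..c}"
        by (intro integrable_continuous_real continuous_on_mult smooth_on_continuous_on_UNIV[OF h(1)] cP(2)[OF tI])
      from Henstock_Kurzweil_Integration.integral_combine[OF _ _ this, of 0]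
      have "integral {-c..c} (\<lambda>s. h s * P t s) = integral {-c..0} (\<lambda>s. h s * P t s) + integral {0..c} (\<lambda>s. h s * P t s)"
        using c by simp
      also have "integral {-c..0} (\<lambda>s. h s * P t s) = integral {-c..0} (\<lambda>s. 0)"
      proof (rule integral_cong)
        fix s assume "s \<in> {-c..0}"
        then show "h s * P t s = 0" using h(2)[of s] zero[OF tI, of 0] b by (cases "s = 0") auto
      qed
      also have "integral {0..c} (\<lambda>s. h s * P t s) = integral {0..c} (\<lambda>s. f s * P t s)"
      proof (rule integral_cong)
        fix s assume "s \<in> {0..c}"
        then show "h s * P t s = f s * P t s" using h(3)[of s] zero[OF tI, of s] by (cases "s < b") auto
      qed
      finally show ?thesis by simp
    qed
    have "integral {-c..c} (\<lambda>t. deriv (deriv \<theta>) t * m F t) = integral {-c..c} (\<lambda>t. deriv (deriv \<theta>) t * integral {-c..c} (\<lambda>s. \<eta> s * P t s))"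
    proof (rule integral_cong)
      fix t assume t: "t \<in> {-c..c}"
      have "integral {-c..c} (\<lambda>s. \<eta> s * P t s) = m F t"
        unfolding m_def by (rule red[OF t s\<eta> \<eta>0]) (use \<kappa>(3) b in \<open>auto simp: \<eta>_def\<close>)
      then show "deriv (deriv \<theta>) t * m F t = deriv (deriv \<theta>) t * integral {-c..c} (\<lambda>s. \<eta> s * P t s)" by simp
    qed
    also have "\<dots> = integral {-c..c} (\<lambda>t. \<theta> t * integral {-c..c} (\<lambda>s. deriv (deriv \<eta>) s * P t s))"
      by (rule sym[OF c(3) \<theta>(1) s\<eta> \<theta>(2) \<eta>0]) auto
    also have "\<dots> = integral {-c..c} (\<lambda>t. \<theta> t * m (deriv (deriv F)) t)"
    proof (rule integral_cong)
      fix t assume t: "t \<in> {-c..c}"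
      have "integral {-c..c} (\<lambda>s. deriv (deriv \<eta>) s * P t s) = m (deriv (deriv F)) t"
        unfolding m_def by (rule red[OF t _ \<eta>''0 \<eta>'']) (auto intro!: smooth_on_deriv s\<eta>)
      then show "\<theta> t * integral {-c..c} (\<lambda>s. deriv (deriv \<eta>) s * P t s) = \<theta> t * m (deriv (deriv F)) t" by simp
    qed
    finally show "integral {-c..c} (\<lambda>t. deriv (deriv \<theta>) t * m F t) = integral {-c..c} (\<lambda>t. \<theta> t * m (deriv (deriv F)) t)" .
  next
    fix F :: "real \<Rightarrow> real" and t assume F: "\<And>r. r \<ge> b \<Longrightarrow> F r = 0" and t: "t \<in> {-c..c}"
    have "m F t = integral {0..c} (\<lambda>s. 0)"
      unfolding m_def
    proof (rule integral_cong)
      fix s assume "s \<in> {0..c}"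
      then show "F s * P t s = 0" using F[of s] zero[of t s] t I by (cases "s < b") auto
    qed
    then show "m F t = 0" by simp
  qed
  have tI: "t \<in> {-T<..<T}" using t b by (auto simp: field_simps)
  have m0: "m F t = 0" if F: "admissible \<beta> F" for F
  proof (rule fundamental_lemma_time[where f = "m F" and t = t and \<alpha>' = "-c + (\<beta> - b)" and \<beta>' = "c - (\<beta> - b)"])
    have "continuous_on {-c..c} (m (\<lambda>r. F (r + 0)))" by (rule W.m_cont_shift[OF F]) (use c in auto)
    then show "continuous_on {-c..c} (m F)" by simp
    show "t \<in> {-c + (\<beta> - b)<..<c - (\<beta> - b)}" using t c unfolding \<beta>_def[symmetric] by auto
    show "integral {-c..c} (\<lambda>t. \<theta> t * m F t) = 0"
      if "smooth_on UNIV \<theta>" "\<And>t. t \<notin> {-c + (\<beta> - b)..c - (\<beta> - b)} \<Longrightarrow> \<theta> t = 0" for \<theta>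
      by (rule W.wave_1d_unique[OF that F])
  qed (use c in auto)
  show ?thesis
  proof (cases "s = 0")
    case True
    then show ?thesis using zero[OF tI, of s] b by simp
  next
    case False
    show ?thesis
    \<comment> \<open>The midpoint of \<open>s\<close> and \<beta> as upper end keeps
      \<open>s\<close> interior while all weights still vanish from \<beta> on, so they are
      admissible profiles.\<close>
    proof (rule fundamental_lemma_time[where f = "P t" and t = s and \<alpha>' = 0 and \<beta>' = "(s + \<beta>) / 2"])
      show "continuous_on {0..c} (P t)" by (rule cP(1)[OF tI])
      show "s \<in> {0<..<(s + \<beta>) / 2}" using False s by (auto simp: \<beta>_def)
      show "(s + \<beta>) / 2 \<le> c" using s(2) c unfolding \<beta>_def[symmetric] by simp
      fix \<theta> :: "real \<Rightarrow> real" assume \<theta>: "smooth_on UNIV \<theta>" "\<And>r. r \<notin> {0..(s + \<beta>) / 2} \<Longrightarrow> \<theta> r = 0"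
      have "admissible \<beta> \<theta>"
        unfolding admissible_def
      proof (intro conjI allI impI \<theta>(1) \<theta>(2))
        fix r assume "\<beta> \<le> r" then show "r \<notin> {0..(s + \<beta>) / 2}" using s(2) by (auto simp: \<beta>_def)
      qed
      from m0[OF this] show "integral {0..c} (\<lambda>t'. \<theta> t' * P t t') = 0" by (simp add: m_def)
    qed simp
  qed
qed

end

section \<open>Reflection in time\<close>

lemma deriv_reflect:
  fixes f :: "real \<Rightarrow> real"
  assumes "smooth_on UNIV f" shows "deriv (\<lambda>t. f (- t)) = (\<lambda>t. - deriv f (- t))"
proof (rule has_real_derivative_ext)
  fix x
  have "((\<lambda>t. f (- t)) has_real_derivative deriv f (- x) * (- 1)) (at x)"
    by (rule DERIV_chain2[OF smooth_on_has_real_derivative[OF assms]]) (auto intro!: derivative_eq_intros)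
  then show "((\<lambda>t. f (- t)) has_real_derivative - deriv f (- x)) (at x)" by simp
qed

lemma smooth_on_reflect: "smooth_on UNIV f \<Longrightarrow> smooth_on UNIV (\<lambda>t::real. f (- t))"
  by (rule smooth_on_compose_UNIV) auto

lemma deriv2_reflect:
  fixes f :: "real \<Rightarrow> real"
  assumes f: "smooth_on UNIV f" shows "deriv (deriv (\<lambda>t. f (- t))) = (\<lambda>t. deriv (deriv f) (- t))"
proof -
  have f': "smooth_on UNIV (deriv f)" by (rule smooth_on_deriv[OF open_UNIV f])
  show ?thesis
    unfolding deriv_reflect[OF f]
  proof (rule has_real_derivative_ext)
    fix x
    have "((\<lambda>t. - deriv f (- t)) has_real_derivative - (deriv (deriv f) (- x) * (- 1))) (at x)"
      by (rule DERIV_minus[OF DERIV_chain2[OF smooth_on_has_real_derivative[OF f']]]) (auto intro!: derivative_eq_intros)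
    then show "((\<lambda>t. - deriv f (- t)) has_real_derivative deriv (deriv f) (- x)) (at x)" by simp
  qed
qed

lemma integral_symmetric_reflect: "integral {-c..c} (\<lambda>t::real. f (- t)) = integral {-c..c} f"
  for f :: "real \<Rightarrow> real"
  using Henstock_Kurzweil_Integration.integral_reflect_real[of c "-c" f] by simp

lemma (in wave_kernel) reflected: "wave_kernel (\<lambda>t s. P (- t) (- s)) T b"
proof
  show "0 < b" "b < T" by (rule b)+
  have "continuous_on ({-T<..<T} \<times> {-T<..<T}) (\<lambda>x. P (- fst x) (- snd x))"
    by (rule cont_compose) (auto intro!: continuous_intros)
  then show "continuous_on ({-T<..<T} \<times> {-T<..<T}) (\<lambda>(t, s). P (- t) (- s))" by (simp add: case_prod_unfold)
  show "P (- t) (- s) = 0" if "t \<in> {-T<..<T}" "\<bar>s\<bar> < b" for t s using that by (intro zero) auto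
  fix c and \<theta> \<eta> :: "real \<Rightarrow> real"
  assume c: "c < T" and \<theta>: "smooth_on UNIV \<theta>" and \<eta>: "smooth_on UNIV \<eta>"
    and z: "\<And>t. t \<notin> {-c..c} \<Longrightarrow> \<theta> t = 0" "\<And>t. t \<notin> {-c..c} \<Longrightarrow> \<eta> t = 0"
  have r: "integral {-c..c} (\<lambda>t. f t * integral {-c..c} (\<lambda>s. g s * P (- t) (- s))) = integral {-c..c} (\<lambda>t. f (- t) * integral {-c..c} (\<lambda>s. g (- s) * P t s))" for f g
  proof -
    have "integral {-c..c} (\<lambda>s. g s * P (- t) (- s)) = integral {-c..c} (\<lambda>s. g (- s) * P (- t) s)" for t
      using integral_symmetric_reflect[of c "\<lambda>s. g (- s) * P (- t) s"] by simp
    then show ?thesis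
      using integral_symmetric_reflect[of c "\<lambda>t. f (- t) * integral {-c..c} (\<lambda>s. g (- s) * P t s)"] by simp
  qed
  have z': "\<theta> (- t) = 0" "\<eta> (- t) = 0" if "t \<notin> {-c..c}" for t
  proof -
    have "- t \<notin> {-c..c}" using that by auto
    then show "\<theta> (- t) = 0" "\<eta> (- t) = 0" by (rule z(1), rule z(2))
  qed
  have "integral {-c..c} (\<lambda>t. deriv (deriv (\<lambda>t. \<theta> (- t))) t * integral {-c..c} (\<lambda>s. \<eta> (- s) * P t s)) =
      integral {-c..c} (\<lambda>t. \<theta> (- t) * integral {-c..c} (\<lambda>s. deriv (deriv (\<lambda>s. \<eta> (- s))) s * P t s))"
    by (rule sym[OF c smooth_on_reflect[OF \<theta>] smooth_on_reflect[OF \<eta>]]) (rule z'(1), assumption, rule z'(2), assumption)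
  then show "integral {-c..c} (\<lambda>t. deriv (deriv \<theta>) t * integral {-c..c} (\<lambda>s. \<eta> s * P (- t) (- s))) =
      integral {-c..c} (\<lambda>t. \<theta> t * integral {-c..c} (\<lambda>s. deriv (deriv \<eta>) s * P (- t) (- s)))"
    unfolding r deriv2_reflect[OF \<theta>] deriv2_reflect[OF \<eta>] .
qed

text \<open>Only the diagonal is needed for the norm, and there both variables have the same sign;
  the reflection of both reduces negative times to positive ones.\<close>

lemma (in wave_kernel) zero_diagonal:
  assumes t: "\<bar>t\<bar> < T - 3 / 4 * (T - b)"
  shows "P t t = 0"
proof (cases "t \<ge> 0")
  case True
  then show ?thesis using zero_half[of t t] t by simp
next
  case False
  interpret r: wave_kernel "\<lambda>t s. P (- t) (- s)" T b by (rule reflected)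
  show ?thesis using r.zero_half[of "- t" "- t"] t False by simp
qed

section \<open>Exchanging the order of integration for Bochner functions\<close>

text \<open>The issue is joint measurability of \<open>ip (w t) (w s)\<close>: it is the limit of
  the same expression for the simple functions that approximate \<open>w\<close>, by
  \<open>ip_diff\<close>. Domination by the product of the norms at \<open>t\<close> and
  \<open>s\<close> then gives integrability on the square.\<close>

lemma bochner_kernel_Fubini:
  fixes ip :: "('c \<Rightarrow> real) \<Rightarrow> ('c \<Rightarrow> real) \<Rightarrow> real" and T :: real
  assumes w: "w \<in> bochner_L2 {-T<..<T} V nrm"
    and nn: "\<And>a. nrm a \<ge> 0"
    and ip_le: "\<And>a b. a \<in> V \<Longrightarrow> b \<in> V \<Longrightarrow> \<bar>ip a b\<bar> \<le> nrm a * nrm b"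
    and ip_diff: "\<And>a b a' b'. \<lbrakk>a \<in> V; b \<in> V; a' \<in> V; b' \<in> V\<rbrakk> \<Longrightarrow>
      \<bar>ip a' b' - ip a b\<bar> \<le> nrm (\<lambda>x. a' x - a x) * nrm (\<lambda>x. b' x - b x) + nrm (\<lambda>x. a' x - a x) * nrm b + nrm a * nrm (\<lambda>x. b' x - b x)"
    and \<theta>: "\<theta> \<in> borel_measurable (lebesgue_on {-T<..<T})" "\<And>t. \<bar>\<theta> t\<bar> \<le> C\<theta>"
    and \<eta>: "\<eta> \<in> borel_measurable (lebesgue_on {-T<..<T})" "\<And>t. \<bar>\<eta> t\<bar> \<le> C\<eta>"
  shows "(LINT s|lebesgue_on {-T<..<T}. \<eta> s * (LINT t|lebesgue_on {-T<..<T}. \<theta> t * ip (w t) (w s))) =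
         (LINT t|lebesgue_on {-T<..<T}. \<theta> t * (LINT s|lebesgue_on {-T<..<T}. \<eta> s * ip (w t) (w s)))"
proof -
  define M where "M = lebesgue_on {-T<..<T}"
  have sp: "space M = {-T<..<T}" by (simp add: M_def)
  interpret fm: finite_measure M
    unfolding M_def by (rule finite_measure_lebesgue_on_bounded) auto
  interpret pr: pair_sigma_finite M M ..
  obtain S where S: "\<And>n. simple_function M (S n)" "\<And>n. S n ` {-T<..<T} \<subseteq> V"
      "AE t in M. (\<lambda>n. nrm (\<lambda>x. S n t x - w t x)) \<longlonglongrightarrow> 0"
    and wV: "AE t in M. w t \<in> V" and wI: "integrable M (\<lambda>t. (nrm (w t))\<^sup>2)"
    using w unfolding bochner_L2_def M_def by blast
  have "AE t in M. w t \<in> V \<and> (\<lambda>n. nrm (\<lambda>x. S n t x - w t x)) \<longlonglongrightarrow> 0"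
    using wV S(3) by eventually_elim simp
  then obtain B where B: "{t \<in> space M. \<not> (w t \<in> V \<and> (\<lambda>n. nrm (\<lambda>x. S n t x - w t x)) \<longlonglongrightarrow> 0)} \<subseteq> B"
      "emeasure M B = 0" "B \<in> sets M"
    by (rule AE_E)
  \<comment> \<open>A measurable set of full measure where all properties hold. The kernels are set
    to zero off it, since the theorem on measurable limits requires convergence at every
    point.\<close>
  define G where "G = space M - B"
  have Gs: "G \<in> sets M" using B(3) by (auto simp: G_def)
  have G: "w t \<in> V" "(\<lambda>n. nrm (\<lambda>x. S n t x - w t x)) \<longlonglongrightarrow> 0" "t \<in> {-T<..<T}" if "t \<in> G" for t
    using that B(1) sp unfolding G_def by blast+
  have "AE t in M. t \<notin> B" using B(2,3) by (intro AE_not_in null_setsI)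
  then have aeG: "AE t in M. t \<in> G"
    using AE_space[of M] by eventually_elim (simp add: G_def)
  define N where "N t = nrm (w t)" for t
  have "(\<lambda>t. sqrt ((nrm (w t))\<^sup>2)) \<in> borel_measurable M"
    using borel_measurable_integrable[OF wI] by measurable
  then have Nm: "N \<in> borel_measurable M" using nn by (simp add: N_def[abs_def])
  have Ni: "integrable M N"
  proof (rule Bochner_Integration.integrable_bound[of _ "\<lambda>t. 1 + (nrm (w t))\<^sup>2"])
    have "\<bar>x\<bar> \<le> 1 + x\<^sup>2" for x :: real
    proof -
      have "0 \<le> (\<bar>x\<bar> - 1)\<^sup>2" "0 \<le> x\<^sup>2" by simp_all
      then show ?thesis by (simp add: power2_diff)
    qed
    then show "AE t in M. norm (N t) \<le> norm (1 + (nrm (w t))\<^sup>2)" by (intro AE_I2) (simp add: N_def)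
    show "integrable M (\<lambda>t. 1 + (nrm (w t))\<^sup>2)" using wI by simp
  qed (rule Nm)
  define K where "K n p = indicator G (fst p) * indicator G (snd p) * ip (S n (fst p)) (S n (snd p))" for n and p :: "real \<times> real"
  define L where "L p = indicator G (fst p) * indicator G (snd p) * ip (w (fst p)) (w (snd p))" for p :: "real \<times> real"
  have iG: "(\<lambda>p. indicator G (fst p) :: real) \<in> borel_measurable (M \<Otimes>\<^sub>M M)" "(\<lambda>p. indicator G (snd p) :: real) \<in> borel_measurable (M \<Otimes>\<^sub>M M)"
    by (rule measurable_compose[OF measurable_fst], rule borel_measurable_indicator[OF Gs],
        rule measurable_compose[OF measurable_snd], rule borel_measurable_indicator[OF Gs])
  have Km: "K n \<in> borel_measurable (M \<Otimes>\<^sub>M M)" for n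
  proof -
    let ?A = "S n ` space M"
    have fin: "finite ?A" using S(1)[of n] by (simp add: simple_function_def)
    \<comment> \<open>\<open>S n\<close> has finitely many values, so the kernel is assembled value
      by value and \<open>ip\<close> only ever enters as a constant.\<close>
    have Sm: "S n \<in> measurable M (count_space ?A)"
      using S(1)[of n] by (subst measurable_count_space_eq2[OF fin]) (auto simp: simple_function_def)
    have 1: "(\<lambda>p. ip a (S n (snd p))) \<in> borel_measurable (M \<Otimes>\<^sub>M M)" for a
      by (rule measurable_compose_countable'[of ?A "\<lambda>b p. ip a b"])
         (auto intro: measurable_compose[OF measurable_snd Sm] countable_finite[OF fin])
    have "(\<lambda>p. ip (S n (fst p)) (S n (snd p))) \<in> borel_measurable (M \<Otimes>\<^sub>M M)"
      by (rule measurable_compose_countable'[of ?A "\<lambda>a p. ip a (S n (snd p))"])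
         (auto intro: measurable_compose[OF measurable_fst Sm] countable_finite[OF fin] 1)
    then show ?thesis unfolding K_def[abs_def] using iG by (intro borel_measurable_times)
  qed
  have Lm: "L \<in> borel_measurable (M \<Otimes>\<^sub>M M)"
  proof (rule borel_measurable_LIMSEQ_real[OF _ Km])
    fix p :: "real \<times> real"
    show "(\<lambda>n. K n p) \<longlonglongrightarrow> L p"
    proof (cases "fst p \<in> G \<and> snd p \<in> G")
      case True
      define t where "t = fst p"
      define s where "s = snd p"
      have t: "t \<in> G" and s: "s \<in> G" using True by (auto simp: t_def s_def)
      let ?d = "\<lambda>t n. nrm (\<lambda>x. S n t x - w t x)"
      have SV: "S n r \<in> V" if "r \<in> G" for n r using S(2)[of n] G(3)[OF that] by blast
      have "(\<lambda>n. ip (S n t) (S n s)) \<longlonglongrightarrow> ip (w t) (w s)"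
      proof (rule LIM_zero_cancel, rule Lim_null_comparison)
        show "eventually (\<lambda>n. norm (ip (S n t) (S n s) - ip (w t) (w s)) \<le> ?d t n * ?d s n + ?d t n * nrm (w s) + nrm (w t) * ?d s n) sequentially"
          using ip_diff[OF G(1)[OF t] G(1)[OF s] SV[OF t] SV[OF s]] by (intro always_eventually allI) simp
        have "(\<lambda>n. ?d t n * ?d s n + ?d t n * nrm (w s) + nrm (w t) * ?d s n) \<longlonglongrightarrow> 0 * 0 + 0 * nrm (w s) + nrm (w t) * 0"
          by (intro tendsto_intros G(2) t s)
        then show "(\<lambda>n. ?d t n * ?d s n + ?d t n * nrm (w s) + nrm (w t) * ?d s n) \<longlonglongrightarrow> 0" by simp
      qed
      then show ?thesis using True by (simp add: K_def L_def t_def s_def)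
    next
      case False
      then have "K n p = 0" "L p = 0" for n by (auto simp: K_def L_def)
      then show ?thesis by simp
    qed
  qed
  define F where "F t s = \<theta> t * \<eta> s * L (t, s)" for t s
  have NN: "integrable (M \<Otimes>\<^sub>M M) (\<lambda>p. N (fst p) * N (snd p))"
  proof (rule pr.Fubini_integrable)
    show "(\<lambda>p. N (fst p) * N (snd p)) \<in> borel_measurable (M \<Otimes>\<^sub>M M)"
      by (intro borel_measurable_times measurable_compose[OF measurable_fst Nm] measurable_compose[OF measurable_snd Nm])
    show "AE x in M. integrable M (\<lambda>y. N (fst (x, y)) * N (snd (x, y)))" using Ni by simp
    have "integrable M (\<lambda>x. \<bar>N x\<bar> * (LINT y|M. \<bar>N y\<bar>))" using Ni by simp
    then show "integrable M (\<lambda>x. LINT y|M. norm (N (fst (x, y)) * N (snd (x, y))))" by (simp add: abs_mult)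
  qed
  have Fi: "integrable (M \<Otimes>\<^sub>M M) (case_prod F)"
  proof (rule Bochner_Integration.integrable_bound[of _ "\<lambda>p. C\<theta> * C\<eta> * (N (fst p) * N (snd p))"])
    show "integrable (M \<Otimes>\<^sub>M M) (\<lambda>p. C\<theta> * C\<eta> * (N (fst p) * N (snd p)))" using NN by simp
    have "\<theta> \<in> borel_measurable M" "\<eta> \<in> borel_measurable M" using \<theta>(1) \<eta>(1) by (simp_all add: M_def)
    then have "(\<lambda>p. \<theta> (fst p) * \<eta> (snd p) * L p) \<in> borel_measurable (M \<Otimes>\<^sub>M M)"
      by (intro borel_measurable_times Lm measurable_compose[OF measurable_fst] measurable_compose[OF measurable_snd])
    then show "case_prod F \<in> borel_measurable (M \<Otimes>\<^sub>M M)" by (simp add: F_def[abs_def] case_prod_unfold)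
    show "AE p in M \<Otimes>\<^sub>M M. norm (case_prod F p) \<le> norm (C\<theta> * C\<eta> * (N (fst p) * N (snd p)))"
    proof (rule AE_I2)
      fix p :: "real \<times> real"
      obtain t s where p: "p = (t, s)" by (cases p)
      have L: "\<bar>L (t, s)\<bar> \<le> N t * N s"
        using ip_le[OF G(1) G(1), of t s] nn by (auto simp: L_def N_def indicator_def)
      have C0: "0 \<le> C\<theta>" "0 \<le> C\<eta>" using \<theta>(2)[of 0] \<eta>(2)[of 0] by linarith+
      have "\<bar>\<theta> t\<bar> * \<bar>\<eta> s\<bar> * \<bar>L (t, s)\<bar> \<le> C\<theta> * C\<eta> * (N t * N s)"
        by (intro mult_mono \<theta>(2) \<eta>(2) L mult_nonneg_nonneg C0) auto
      also have "\<dots> \<le> \<bar>C\<theta> * C\<eta> * (N t * N s)\<bar>" by simp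
      finally show "norm (case_prod F p) \<le> norm (C\<theta> * C\<eta> * (N (fst p) * N (snd p)))"
        by (simp add: p F_def abs_mult)
    qed
  qed
  have Is: "{-T<..<T} \<in> sets lebesgue" by simp
  have 1: "(LINT t|M. F t s) = \<eta> s * (LINT t|M. \<theta> t * ip (w t) (w s))" if s: "s \<in> G" for s
  proof -
    have "(LINT t|M. F t s) = (LINT t|M. \<eta> s * (\<theta> t * ip (w t) (w s)))"
      unfolding M_def
    proof (rule LINT_cong_AE_lebesgue_on[OF Is])
      show "AE t in lebesgue_on {-T<..<T}. F t s = \<eta> s * (\<theta> t * ip (w t) (w s))"
        using aeG unfolding M_def by eventually_elim (simp add: F_def L_def s)
    qed
    then show ?thesis by simp
  qed
  have 2: "(LINT s|M. F t s) = \<theta> t * (LINT s|M. \<eta> s * ip (w t) (w s))" if t: "t \<in> G" for t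
  proof -
    have "(LINT s|M. F t s) = (LINT s|M. \<theta> t * (\<eta> s * ip (w t) (w s)))"
      unfolding M_def
    proof (rule LINT_cong_AE_lebesgue_on[OF Is])
      show "AE s in lebesgue_on {-T<..<T}. F t s = \<theta> t * (\<eta> s * ip (w t) (w s))"
        using aeG unfolding M_def by eventually_elim (simp add: F_def L_def t)
    qed
    then show ?thesis by simp
  qed
  have 3: "(LINT s|M. \<eta> s * (LINT t|M. \<theta> t * ip (w t) (w s))) = (LINT s|M. LINT t|M. F t s)"
    unfolding M_def
  proof (rule LINT_cong_AE_lebesgue_on[OF Is])
    show "AE s in lebesgue_on {-T<..<T}. \<eta> s * (LINT t|lebesgue_on {-T<..<T}. \<theta> t * ip (w t) (w s)) = (LINT t|lebesgue_on {-T<..<T}. F t s)"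
      using aeG unfolding M_def by eventually_elim (simp add: 1[unfolded M_def])
  qed
  have 4: "(LINT t|M. \<theta> t * (LINT s|M. \<eta> s * ip (w t) (w s))) = (LINT t|M. LINT s|M. F t s)"
    unfolding M_def
  proof (rule LINT_cong_AE_lebesgue_on[OF Is])
    show "AE t in lebesgue_on {-T<..<T}. \<theta> t * (LINT s|lebesgue_on {-T<..<T}. \<eta> s * ip (w t) (w s)) = (LINT s|lebesgue_on {-T<..<T}. F t s)"
      using aeG unfolding M_def by eventually_elim (simp add: 2[unfolded M_def])
  qed
  show ?thesis
    using 3 4 pr.Fubini_integral[OF Fi] unfolding M_def by simp
qed

section \<open>Extension in time and the main theorem\<close>

context bounded_domain
begin

section \<open>The Dirichlet form\<close>

definition gip :: "('a \<Rightarrow> real) \<Rightarrow> ('a \<Rightarrow> real) \<Rightarrow> real" where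
  "gip u v = (LINT x|lebesgue_on \<Omega>. weak_grad \<Omega> u x \<bullet> weak_grad \<Omega> v x)"

lemma gip_commute: "gip u v = gip v u"
  by (simp add: gip_def inner_commute)

lemma laplacian_gip: "laplacian \<Omega> u v = - gip u v"
  by (simp add: laplacian_def gip_def)

lemma norm_H1_nonneg: "norm_H1 \<Omega> u \<ge> 0"
  unfolding norm_H1_def by (intro real_sqrt_ge_zero add_nonneg_nonneg integral_nonneg_AE) auto

lemma gip_le:
  assumes "u \<in> H1_space \<Omega>" "v \<in> H1_space \<Omega>"
  shows "\<bar>gip u v\<bar> \<le> norm_H1 \<Omega> u * norm_H1 \<Omega> v"
proof -
  have le: "sqrt (LINT x|lebesgue_on \<Omega>. (norm (weak_grad \<Omega> f x))\<^sup>2) \<le> norm_H1 \<Omega> f" for f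
    unfolding norm_H1_def by (intro real_sqrt_le_mono) simp
  have "\<bar>gip u v\<bar> \<le> sqrt (LINT x|lebesgue_on \<Omega>. (norm (weak_grad \<Omega> u x))\<^sup>2) * sqrt (LINT x|lebesgue_on \<Omega>. (norm (weak_grad \<Omega> v x))\<^sup>2)"
    unfolding gip_def by (intro inner_L2_Cauchy_Schwarz weak_grad_L2 assms)
  also have "\<dots> \<le> norm_H1 \<Omega> u * norm_H1 \<Omega> v"
    by (intro mult_mono le norm_H1_nonneg real_sqrt_ge_zero integral_nonneg_AE) auto
  finally show ?thesis .
qed

lemma H1_diff: "u \<in> H1_space \<Omega> \<Longrightarrow> v \<in> H1_space \<Omega> \<Longrightarrow> (\<lambda>x. u x - v x) \<in> H1_space \<Omega>"
  using H1_linear(1)[of u v 1 "-1"] by simp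

lemma gip_diff_left:
  assumes u: "u \<in> H1_space \<Omega>" and v: "v \<in> H1_space \<Omega>" and f: "f \<in> H1_space \<Omega>"
  shows "gip (\<lambda>x. u x - v x) f = gip u f - gip v f"
proof -
  note L = weak_grad_L2
  have ae: "AE x in lebesgue_on \<Omega>. weak_grad \<Omega> (\<lambda>x. u x - v x) x = weak_grad \<Omega> u x - weak_grad \<Omega> v x"
    using H1_linear(2)[OF u v, of 1 "-1"] by simp
  have i: "integrable (lebesgue_on \<Omega>) (\<lambda>x. weak_grad \<Omega> h x \<bullet> weak_grad \<Omega> f x)" if "h \<in> H1_space \<Omega>" for h
    by (intro inner_L2_integrable L that f)
  have "gip (\<lambda>x. u x - v x) f = (LINT x|lebesgue_on \<Omega>. (weak_grad \<Omega> u x - weak_grad \<Omega> v x) \<bullet> weak_grad \<Omega> f x)"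
    unfolding gip_def
  proof (rule LINT_inner_cong_AE[OF ae])
    show "integrable (lebesgue_on \<Omega>) (\<lambda>x. weak_grad \<Omega> (\<lambda>x. u x - v x) x \<bullet> weak_grad \<Omega> f x)"
      by (intro inner_L2_integrable L H1_diff u v f)
    show "integrable (lebesgue_on \<Omega>) (\<lambda>x. (weak_grad \<Omega> u x - weak_grad \<Omega> v x) \<bullet> weak_grad \<Omega> f x)"
      using i[OF u] i[OF v] by (simp add: inner_diff_left)
  qed simp
  also have "\<dots> = gip u f - gip v f"
    using i[OF u] i[OF v] by (simp add: inner_diff_left gip_def)
  finally show ?thesis .
qed

text \<open>Expanding both arguments about \<open>a\<close> and \<open>b\<close> leaves only the
  norms of the limit values and of the differences, the form in which convergence of simple
  functions is available.\<close>

lemma gip_diff_le: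
  assumes a: "a \<in> H1_space \<Omega>" and b: "b \<in> H1_space \<Omega>" and a': "a' \<in> H1_space \<Omega>" and b': "b' \<in> H1_space \<Omega>"
  shows "\<bar>gip a' b' - gip a b\<bar> \<le> norm_H1 \<Omega> (\<lambda>x. a' x - a x) * norm_H1 \<Omega> (\<lambda>x. b' x - b x)
    + norm_H1 \<Omega> (\<lambda>x. a' x - a x) * norm_H1 \<Omega> b + norm_H1 \<Omega> a * norm_H1 \<Omega> (\<lambda>x. b' x - b x)"
proof -
  let ?da = "\<lambda>x. a' x - a x" and ?db = "\<lambda>x. b' x - b x"
  have da: "?da \<in> H1_space \<Omega>" and db: "?db \<in> H1_space \<Omega>" by (intro H1_diff a a' b b')+
  have r: "gip f ?db = gip f b' - gip f b" if "f \<in> H1_space \<Omega>" for f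
    using gip_diff_left[OF b' b that] by (simp add: gip_commute)
  have "gip a' b' - gip a b = gip ?da ?db + gip ?da b + gip a ?db"
    unfolding r[OF da] r[OF a] gip_diff_left[OF a' a b'] gip_diff_left[OF a' a b] by simp
  then show ?thesis
    using gip_le[OF da db] gip_le[OF da b] gip_le[OF a db] by linarith
qed

lemma L2_continuous_kernel:
  assumes g: "L2_continuous I g"
  shows "continuous_on (I \<times> I) (\<lambda>(t, s). LINT x|lebesgue_on \<Omega>. g t x * g s x)"
  unfolding continuous_on_def
proof
  fix p assume "p \<in> I \<times> I"
  then obtain t s where p: "p = (t, s)" "t \<in> I" "s \<in> I" by blast
  have gL: "g r \<in> L2_space \<Omega>" if "r \<in> I" for r using g that by (simp add: L2_continuous_def)
  let ?F = "at p within I \<times> I" and ?n = "norm_L2 \<Omega>"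
  let ?d = "\<lambda>t r. ?n (\<lambda>x. g r x - g t x)"
  have d: "continuous (at t within I) (?d t)" "?d t t = 0" if "t \<in> I" for t
    using g that by (simp_all add: L2_continuous_def continuous_within norm_L2_def)
  have lim: "((\<lambda>q. ?d t (fst q)) \<longlongrightarrow> 0) ?F" "((\<lambda>q. ?d s (snd q)) \<longlongrightarrow> 0) ?F"
  proof -
    have "continuous ?F (\<lambda>q. ?d t (fst q))"
    proof (rule continuous_within_compose2[of p "I \<times> I" fst])
      show "continuous (at (fst p) within fst ` (I \<times> I)) (?d t)"
        using continuous_within_subset[OF d(1)[OF p(2)], of "fst ` (I \<times> I)"] p(1) by auto
    qed (intro continuous_intros)
    then show "((\<lambda>q. ?d t (fst q)) \<longlongrightarrow> 0) ?F" using d(2)[OF p(2)] p(1) by (simp add: continuous_within)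
    have "continuous ?F (\<lambda>q. ?d s (snd q))"
    proof (rule continuous_within_compose2[of p "I \<times> I" snd])
      show "continuous (at (snd p) within snd ` (I \<times> I)) (?d s)"
        using continuous_within_subset[OF d(1)[OF p(3)], of "snd ` (I \<times> I)"] p(1) by auto
    qed (intro continuous_intros)
    then show "((\<lambda>q. ?d s (snd q)) \<longlongrightarrow> 0) ?F" using d(2)[OF p(3)] p(1) by (simp add: continuous_within)
  qed
  have "((\<lambda>q. LINT x|lebesgue_on \<Omega>. g (fst q) x * g (snd q) x) \<longlongrightarrow> (LINT x|lebesgue_on \<Omega>. g t x * g s x)) ?F"
  proof (rule LIM_zero_cancel, rule Lim_null_comparison)
    show "eventually (\<lambda>q. norm ((LINT x|lebesgue_on \<Omega>. g (fst q) x * g (snd q) x) - (LINT x|lebesgue_on \<Omega>. g t x * g s x))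
       \<le> ?d t (fst q) * ?d s (snd q) + ?d t (fst q) * ?n (g s) + ?n (g t) * ?d s (snd q)) ?F"
      unfolding eventually_at_filter
    proof (intro always_eventually allI impI)
      fix q assume "q \<in> I \<times> I"
      then have q: "fst q \<in> I" "snd q \<in> I" by auto
      let ?a = "g (fst q)" and ?b = "g (snd q)"
      have da: "(\<lambda>x. ?a x - g t x) \<in> L2_space \<Omega>" and db: "(\<lambda>x. ?b x - g s x) \<in> L2_space \<Omega>" by (intro L2_diff gL q p)+
      note i1 = L2_mult_integrable[OF da db] and i2 = L2_mult_integrable[OF da gL[OF p(3)]] and i3 = L2_mult_integrable[OF gL[OF p(2)] db]
        and i4 = L2_mult_integrable[OF gL[OF q(1)] gL[OF q(2)]] and i5 = L2_mult_integrable[OF gL[OF p(2)] gL[OF p(3)]]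
      have "(LINT x|lebesgue_on \<Omega>. ?a x * ?b x) - (LINT x|lebesgue_on \<Omega>. g t x * g s x) = (LINT x|lebesgue_on \<Omega>. ?a x * ?b x - g t x * g s x)"
        using i4 i5 by simp
      also have "\<dots> = (LINT x|lebesgue_on \<Omega>. (?a x - g t x) * (?b x - g s x) + (?a x - g t x) * g s x + g t x * (?b x - g s x))"
        by (rule Bochner_Integration.integral_cong) (auto simp: algebra_simps)
      also have "\<dots> = (LINT x|lebesgue_on \<Omega>. (?a x - g t x) * (?b x - g s x)) + (LINT x|lebesgue_on \<Omega>. (?a x - g t x) * g s x) + (LINT x|lebesgue_on \<Omega>. g t x * (?b x - g s x))"
        by (simp only: Bochner_Integration.integral_add[OF Bochner_Integration.integrable_add[OF i1 i2] i3] Bochner_Integration.integral_add[OF i1 i2])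
      finally show "norm ((LINT x|lebesgue_on \<Omega>. ?a x * ?b x) - (LINT x|lebesgue_on \<Omega>. g t x * g s x))
         \<le> ?d t (fst q) * ?d s (snd q) + ?d t (fst q) * ?n (g s) + ?n (g t) * ?d s (snd q)"
        using L2_Cauchy_Schwarz[OF da db] L2_Cauchy_Schwarz[OF da gL[OF p(3)]] L2_Cauchy_Schwarz[OF gL[OF p(2)] db]
        unfolding real_norm_def by linarith
    qed
    have "((\<lambda>q. ?d t (fst q) * ?d s (snd q) + ?d t (fst q) * ?n (g s) + ?n (g t) * ?d s (snd q)) \<longlongrightarrow> 0 * 0 + 0 * ?n (g s) + ?n (g t) * 0) ?F"
      by (intro tendsto_intros lim)
    then show "((\<lambda>q. ?d t (fst q) * ?d s (snd q) + ?d t (fst q) * ?n (g s) + ?n (g t) * ?d s (snd q)) \<longlongrightarrow> 0) ?F" by simp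
  qed
  then show "((\<lambda>(t, s). LINT x|lebesgue_on \<Omega>. g t x * g s x) \<longlongrightarrow> (case p of (t, s) \<Rightarrow> LINT x|lebesgue_on \<Omega>. g t x * g s x)) ?F"
    by (simp add: p case_prod_unfold)
qed

lemma smooth_supported_bounded:
  fixes \<theta> :: "real \<Rightarrow> real"
  assumes "smooth_on UNIV \<theta>" "\<And>t. t \<notin> {-c..c} \<Longrightarrow> \<theta> t = 0"
  obtains C where "\<And>t. \<bar>\<theta> t\<bar> \<le> C"
proof -
  obtain C where C: "C \<ge> 0" "\<And>t. t \<in> {-c..c} \<Longrightarrow> \<bar>\<theta> t\<bar> \<le> C"
    by (rule continuous_bounded_on_bounded[OF smooth_on_continuous_on[OF assms(1)], of "{-c..c}"]) auto
  show ?thesis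
  proof (rule that)
    fix t show "\<bar>\<theta> t\<bar> \<le> C" using C assms(2)[of t] by (cases "t \<in> {-c..c}") auto
  qed
qed

text \<open>Testing the equation at time \<open>t\<close> with \<open>w s\<close> shows that \<open>LINT g t * g s\<close> is a weak solution
  of the wave equation in \<open>(t, s)\<close>, as the Dirichlet form is symmetric.\<close>

lemma inner_kernel_symmetric:
  assumes w: "w \<in> bochner_L2 {-T<..<T} (H10_space \<Omega>) (norm_H1 \<Omega>)"
    and rep: "represents T w g"
    and c: "c < T" and \<theta>: "smooth_on UNIV \<theta>" "\<And>t. t \<notin> {-c..c} \<Longrightarrow> \<theta> t = 0"
    and \<eta>: "smooth_on UNIV \<eta>" "\<And>t. t \<notin> {-c..c} \<Longrightarrow> \<eta> t = 0"
  shows "integral {-c..c} (\<lambda>t. deriv (deriv \<theta>) t * integral {-c..c} (\<lambda>s. \<eta> s * (LINT x|lebesgue_on \<Omega>. g t x * g s x))) =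
         integral {-c..c} (\<lambda>t. \<theta> t * integral {-c..c} (\<lambda>s. deriv (deriv \<eta>) s * (LINT x|lebesgue_on \<Omega>. g t x * g s x)))"
proof -
  let ?I = "{-T<..<T}"
  have sub: "{-c..c} \<subseteq> ?I" using c by auto
  have Is: "?I \<in> sets lebesgue" by simp
  note g = representsD(1)[OF rep] and wg = representsD(2)[OF rep] and wave = representsD(3)[OF rep]
  have wae: "AE t in lebesgue_on ?I. w t \<in> H10_space \<Omega>" "AE t in lebesgue_on ?I. AE x in lebesgue_on \<Omega>. w t x = g t x"
    using wg by (eventually_elim, simp)+
  define Q where "Q t s = (LINT x|lebesgue_on \<Omega>. g t x * g s x)" for t s
  have Qc: "Q t s = Q s t" for t s by (simp add: Q_def mult.commute)
  have gL: "g t \<in> L2_space \<Omega>" if "t \<in> ?I" for t using g that by (simp add: L2_continuous_def)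
  have Q1: "continuous_on {-c..c} (\<lambda>t. Q t s)" if "s \<in> ?I" for s
    unfolding Q_def by (rule continuous_on_subset[OF L2_continuous_inner[OF g gL[OF that]] sub])
  have Q2: "continuous_on ({-c..c} \<times> {-c..c}) (\<lambda>x. Q (fst x) (snd x))"
    using continuous_on_subset[OF L2_continuous_kernel[OF g] Sigma_mono[OF sub sub]] by (simp add: Q_def case_prod_unfold)
  have dd: "smooth_on UNIV (deriv (deriv \<theta>))" "smooth_on UNIV (deriv (deriv \<eta>))"
    using \<theta>(1) \<eta>(1) by (auto intro!: smooth_on_deriv)

  obtain C\<theta> where C\<theta>: "\<And>t. \<bar>\<theta> t\<bar> \<le> C\<theta>" 
  proof (rule smooth_supported_bounded[OF \<theta>])
    fix C assume *: "\<And>t. \<bar>\<theta> t\<bar> \<le> C"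
    show thesis by (rule that[OF *])
  qed
  obtain C\<eta> where C\<eta>: "\<And>t. \<bar>\<eta> t\<bar> \<le> C\<eta>" 
  proof (rule smooth_supported_bounded[OF \<eta>])
    fix C assume *: "\<And>t. \<bar>\<eta> t\<bar> \<le> C"
    show thesis by (rule that[OF *])
  qed
  have toI: "(LINT t|lebesgue_on ?I. f t * h t) = integral {-c..c} (\<lambda>t. f t * h t)"
    if "smooth_on UNIV f" "\<And>t. t \<notin> {-c..c} \<Longrightarrow> f t = 0" "continuous_on {-c..c} h" for f h :: "real \<Rightarrow> real"
  proof (rule LINT_continuous_on_eq_integral[OF Is sub])
    show "continuous_on {-c..c} (\<lambda>t. f t * h t)"
      by (rule continuous_on_mult[OF smooth_on_continuous_on_UNIV[OF that(1)] that(3)])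
    show "f t * h t = 0" if "t \<notin> {-c..c}" for t using \<open>\<And>t. t \<notin> {-c..c} \<Longrightarrow> f t = 0\<close>[OF that] by simp
  qed
  have ci: "continuous_on {-c..c} (\<lambda>s. integral {-c..c} (\<lambda>t. f t * Q t s))" if f: "smooth_on UNIV f" for f :: "real \<Rightarrow> real"
  proof -
    have "continuous_on {-c..c} (\<lambda>s. integral (cbox (-c) c) (\<lambda>t. f t * Q t s))"
    proof (rule integral_continuous_on_param)
      have "continuous_on ({-c..c} \<times> {-c..c}) (\<lambda>x. Q (fst (snd x, fst x)) (snd (snd x, fst x)))"
        by (rule continuous_on_compose2[OF Q2]) (auto intro!: continuous_intros)
      then show "continuous_on ({-c..c} \<times> cbox (-c) c) (\<lambda>(s, t). f t * Q t s)"
        unfolding case_prod_unfold cbox_interval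
        by (intro continuous_on_mult continuous_on_smooth_compose[OF f] continuous_on_snd continuous_on_id) simp_all
    qed
    then show ?thesis by (simp add: cbox_interval)
  qed
  \<comment> \<open>For almost every \<open>s\<close> the function \<open>w s\<close> is in H10 and
    can be inserted for \<psi>; there it also agrees with \<open>g s\<close> almost everywhere in
    space, whence \<open>Q\<close> on the left.\<close>
  have key: "AE s in lebesgue_on ?I. (LINT t|lebesgue_on ?I. deriv (deriv f) t * Q t s) = - (LINT t|lebesgue_on ?I. f t * gip (w t) (w s))"
    if f: "smooth_on UNIV f" "\<And>t. t \<notin> {-c..c} \<Longrightarrow> f t = 0" for f
    using wae
  proof eventually_elim
    case (elim s)
    have "(LINT x|lebesgue_on \<Omega>. g t x * w s x) = Q t s" for t
      unfolding Q_def using LINT_mult_cong_AE[OF elim(2), of "g t"] by (simp add: mult.commute)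
    then have "(LINT t|lebesgue_on ?I. deriv (deriv f) t * Q t s) = (LINT t|lebesgue_on ?I. f t * laplacian \<Omega> (w t) (w s))"
      using wave[OF time_test_function[OF f sub] elim(1)] by simp
    then show ?case by (simp add: laplacian_gip)
  qed
  have E: "(LINT s|lebesgue_on ?I. h s * integral {-c..c} (\<lambda>t. deriv (deriv f) t * Q t s)) = - (LINT s|lebesgue_on ?I. h s * (LINT t|lebesgue_on ?I. f t * gip (w t) (w s)))"
    if f: "smooth_on UNIV f" "\<And>t. t \<notin> {-c..c} \<Longrightarrow> f t = 0" for f h
  proof -
    have sf: "smooth_on UNIV (deriv (deriv f))" using f(1) by (auto intro!: smooth_on_deriv)
    have zf: "deriv (deriv f) t = 0" if "t \<notin> {-c..c}" for t
      by (rule deriv_zero_outside[OF deriv_zero_outside[OF f(2)] that])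
    have "(LINT s|lebesgue_on ?I. h s * integral {-c..c} (\<lambda>t. deriv (deriv f) t * Q t s)) = (LINT s|lebesgue_on ?I. - (h s * (LINT t|lebesgue_on ?I. f t * gip (w t) (w s))))"
    proof (rule LINT_cong_AE_lebesgue_on[OF Is])
      show "AE s in lebesgue_on ?I. h s * integral {-c..c} (\<lambda>t. deriv (deriv f) t * Q t s) = - (h s * (LINT t|lebesgue_on ?I. f t * gip (w t) (w s)))"
      proof -
        have "AE s in lebesgue_on ?I. (LINT t|lebesgue_on ?I. deriv (deriv f) t * Q t s) = - (LINT t|lebesgue_on ?I. f t * gip (w t) (w s))"
          by (rule key[OF f])
        then show ?thesis using AE_space[of "lebesgue_on ?I"]
      proof eventually_elim
        case (elim s)
        then have "s \<in> ?I" by simp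
        have "(LINT t|lebesgue_on ?I. deriv (deriv f) t * Q t s) = integral {-c..c} (\<lambda>t. deriv (deriv f) t * Q t s)"
          by (rule toI[OF sf zf Q1[OF \<open>s \<in> ?I\<close>]])
        then have e: "integral {-c..c} (\<lambda>t. deriv (deriv f) t * Q t s) = - (LINT t|lebesgue_on ?I. f t * gip (w t) (w s))"
          using elim(1) by simp
        show ?case unfolding e by simp
      qed
      qed
    qed
    then show ?thesis by simp
  qed
  have Fub: "(LINT s|lebesgue_on ?I. \<eta> s * (LINT t|lebesgue_on ?I. \<theta> t * gip (w t) (w s))) =
         (LINT t|lebesgue_on ?I. \<theta> t * (LINT s|lebesgue_on ?I. \<eta> s * gip (w t) (w s)))"
  proof (rule bochner_kernel_Fubini[OF w])
    show "norm_H1 \<Omega> a \<ge> 0" for a by (rule norm_H1_nonneg)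
    show "\<bar>gip a b\<bar> \<le> norm_H1 \<Omega> a * norm_H1 \<Omega> b" if "a \<in> H10_space \<Omega>" "b \<in> H10_space \<Omega>" for a b
      by (intro gip_le H10_H1 that)
    show "\<bar>gip a' b' - gip a b\<bar> \<le> norm_H1 \<Omega> (\<lambda>x. a' x - a x) * norm_H1 \<Omega> (\<lambda>x. b' x - b x) + norm_H1 \<Omega> (\<lambda>x. a' x - a x) * norm_H1 \<Omega> b + norm_H1 \<Omega> a * norm_H1 \<Omega> (\<lambda>x. b' x - b x)"
      if "a \<in> H10_space \<Omega>" "b \<in> H10_space \<Omega>" "a' \<in> H10_space \<Omega>" "b' \<in> H10_space \<Omega>" for a b a' b'
      by (intro gip_diff_le H10_H1 that)
    show "\<theta> \<in> borel_measurable (lebesgue_on ?I)" "\<eta> \<in> borel_measurable (lebesgue_on ?I)"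
      by (rule continuous_on_imp_measurable_lebesgue_on[OF smooth_on_continuous_on[OF \<theta>(1)]],
          rule continuous_on_imp_measurable_lebesgue_on[OF smooth_on_continuous_on[OF \<eta>(1)]])
    show "\<bar>\<theta> t\<bar> \<le> C\<theta>" "\<bar>\<eta> t\<bar> \<le> C\<eta>" for t by (rule C\<theta>, rule C\<eta>)
  qed
  have "integral {-c..c} (\<lambda>t. deriv (deriv \<theta>) t * integral {-c..c} (\<lambda>s. \<eta> s * Q t s)) =
      integral (cbox (-c) c) (\<lambda>t. integral (cbox (-c) c) (\<lambda>s. deriv (deriv \<theta>) t * \<eta> s * Q t s))"
    by (simp add: cbox_interval mult.assoc)
  \<comment> \<open>The equation is applied in \<open>t\<close> with \<open>s\<close> frozen, so the
    integral over \<open>t\<close> has to become the inner one.\<close>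
  also have "\<dots> = integral (cbox (-c) c) (\<lambda>s. integral (cbox (-c) c) (\<lambda>t. deriv (deriv \<theta>) t * \<eta> s * Q t s))"
  proof (rule integral_swap_continuous)
    have "cbox (- c, - c) (c, c) = {-c..c} \<times> {-c..c}" unfolding cbox_Pair_eq by (simp only: cbox_interval)
    then show "continuous_on (cbox (- c, - c) (c, c)) (\<lambda>(t, s). deriv (deriv \<theta>) t * \<eta> s * Q t s)"
      unfolding case_prod_unfold using Q2
      by (auto intro!: continuous_on_mult continuous_on_smooth_compose[OF dd(1)] continuous_on_smooth_compose[OF \<eta>(1)] continuous_intros)
  qed
  also have "\<dots> = integral {-c..c} (\<lambda>s. \<eta> s * integral {-c..c} (\<lambda>t. deriv (deriv \<theta>) t * Q t s))"
  proof -
    have "(\<lambda>t. deriv (deriv \<theta>) t * \<eta> s * Q t s) = (\<lambda>t. \<eta> s * (deriv (deriv \<theta>) t * Q t s))" for s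
      by (simp add: fun_eq_iff)
    then show ?thesis by (simp add: cbox_interval)
  qed
  also have "\<dots> = (LINT s|lebesgue_on ?I. \<eta> s * integral {-c..c} (\<lambda>t. deriv (deriv \<theta>) t * Q t s))"
    by (rule toI[symmetric, OF \<eta> ci[OF dd(1)]])
  also have "\<dots> = - (LINT s|lebesgue_on ?I. \<eta> s * (LINT t|lebesgue_on ?I. \<theta> t * gip (w t) (w s)))"
    by (rule E[OF \<theta>])
  \<comment> \<open>Fubini and the symmetry of the Dirichlet form exchange the roles of the two
    times; what follows retraces the same steps with \<eta> in place of \<theta>.\<close>
  also have "\<dots> = - (LINT t|lebesgue_on ?I. \<theta> t * (LINT s|lebesgue_on ?I. \<eta> s * gip (w s) (w t)))"
    unfolding Fub by (simp add: gip_commute)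
  also have "\<dots> = (LINT t|lebesgue_on ?I. \<theta> t * integral {-c..c} (\<lambda>s. deriv (deriv \<eta>) s * Q s t))"
    by (rule E[OF \<eta>, symmetric])
  also have "\<dots> = integral {-c..c} (\<lambda>t. \<theta> t * integral {-c..c} (\<lambda>s. deriv (deriv \<eta>) s * Q s t))"
    by (rule toI[OF \<theta> ci[OF dd(2)]])
  also have "\<dots> = integral {-c..c} (\<lambda>t. \<theta> t * integral {-c..c} (\<lambda>s. deriv (deriv \<eta>) s * Q t s))"
    by (simp add: Qc)
  finally show ?thesis by (simp add: Q_def)
qed

end

section \<open>Passing to all times, initial data, and conclusion\<close>

lemma path_length_nonneg: "path_length g \<ge> 0"
proof -
  have m: "(0, \<lambda>_. 0) \<in> {(n::nat, t::nat \<Rightarrow> real). (\<forall>i\<le>n. t i \<in> {0..1}) \<and> (\<forall>i<n. t i \<le> t (Suc i))}" by simp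
  show ?thesis
    unfolding path_length_def
    using SUP_upper[OF m, of "\<lambda>(n, t). ereal (\<Sum>i<n. dist (g (t i)) (g (t (Suc i))))"] by (simp add: zero_ereal_def)
qed

text \<open>A point of the domain is required because the supremum over the empty set is -
  \<infinity>; an infimum over no path at all is \<infinity> and does no harm.\<close>

lemma T_max_nonneg:
  assumes "P \<in> \<Omega>" shows "T_max \<Omega> \<omega> \<ge> 0"
proof -
  have "0 \<le> gd_set \<Omega> P \<omega>"
    unfolding gd_set_def gd_def by (intro INF_greatest path_length_nonneg)
  also have "\<dots> \<le> T_max \<Omega> \<omega>" unfolding T_max_def by (rule SUP_upper[OF assms])
  finally show ?thesis .
qed

lemma AE_lebesgue_on_subset_iff:
  assumes "open \<Omega>" "open \<omega>" "\<omega> \<subseteq> \<Omega>"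
  shows "(AE x in lebesgue_on \<omega>. P x) \<longleftrightarrow> (AE x in lebesgue_on \<Omega>. x \<in> \<omega> \<longrightarrow> P x)"
proof -
  have "(AE x in lebesgue_on \<omega>. P x) \<longleftrightarrow> (AE x in lebesgue. x \<in> \<omega> \<longrightarrow> P x)"
    by (rule AE_restrict_space_iff) (use assms in auto)
  moreover have "(AE x in lebesgue_on \<Omega>. x \<in> \<omega> \<longrightarrow> P x) \<longleftrightarrow> (AE x in lebesgue. x \<in> \<Omega> \<longrightarrow> x \<in> \<omega> \<longrightarrow> P x)"
    by (rule AE_restrict_space_iff) (use assms in auto)
  moreover have "(AE x in lebesgue. x \<in> \<Omega> \<longrightarrow> x \<in> \<omega> \<longrightarrow> P x) \<longleftrightarrow> (AE x in lebesgue. x \<in> \<omega> \<longrightarrow> P x)"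
    using assms(3) by (intro AE_cong) blast
  ultimately show ?thesis by simp
qed

text \<open>For each test function supported in \<omega> the pairing is continuous in time and zero
  at almost every time, hence zero at every time; the fundamental lemma on \<omega> turns this into
  vanishing of each slice.\<close>

lemma (in weak_wave) vanishes_at_all_times:
  assumes \<omega>: "open \<omega>" "\<omega> \<subseteq> \<Omega>"
    and ae: "AE t in lebesgue_on {-T<..<T}. AE x in lebesgue_on \<Omega>. x \<in> \<omega> \<longrightarrow> u t x = 0"
    and t: "t \<in> {-T<..<T}"
  shows "AE x in lebesgue_on \<Omega>. x \<in> \<omega> \<longrightarrow> u t x = 0"
proof -
  have \<omega>s: "\<omega> \<in> sets lebesgue" "\<Omega> \<in> sets lebesgue" using \<omega> dom by auto
  have "AE x in lebesgue_on \<omega>. u t x = 0"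
  proof (rule fundamental_lemma[OF \<omega>(1) bounded_subset[OF dom(2) \<omega>(2)]])
    show "integrable (lebesgue_on \<omega>) (u t)"
      by (rule integrable_lebesgue_on_subset[OF u_int[OF t] \<omega>s(2,1) \<omega>(2)])
    fix \<phi> assume \<phi>: "\<phi> \<in> test_functions \<omega>"
    have o: "\<phi> x = 0" if "x \<notin> \<omega>" for x by (rule test_function_outside[OF \<phi> that])
    have "(LINT x|lebesgue_on \<Omega>. u t x * \<phi> x) = 0"
    proof (rule AE_zero_continuous[OF _ u_cont_continuous _ t])
      show "continuous_on UNIV \<phi>" by (rule smooth_on_continuous_on[OF test_functions_smooth[OF \<phi>]])
      show "AE t in lebesgue_on {-T<..<T}. (LINT x|lebesgue_on \<Omega>. u t x * \<phi> x) = 0"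
        using ae
      proof eventually_elim
        case (elim t)
        have "(LINT x|lebesgue_on \<Omega>. u t x * \<phi> x) = (LINT x|lebesgue_on \<Omega>. 0)"
        proof (rule LINT_cong_AE_lebesgue_on[OF \<omega>s(2)])
          show "AE x in lebesgue_on \<Omega>. u t x * \<phi> x = 0"
            using elim by (rule eventually_mono) (use o in auto)
        qed
        then show ?case by simp
      qed
    qed simp
    then show "(LINT x|lebesgue_on \<omega>. u t x * \<phi> x) = 0"
      using LINT_lebesgue_on_eq[OF \<omega>s, of "\<lambda>x. u t x * \<phi> x"] o \<omega>(2) by auto
  qed
  then show ?thesis using AE_lebesgue_on_subset_iff[OF dom(1) \<omega>] by simp
qed

context bounded_domain
begin

text \<open>If \<open>g\<close> vanishes for \<open>\<bar>t\<bar> < b\<close>, then it does so for \<open>\<bar>t\<bar> < T - 3/4 * (T - b)\<close>; iterate.\<close>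

lemma vanishes_extend:
  assumes w: "w \<in> bochner_L2 {-T<..<T} (H10_space \<Omega>) (norm_H1 \<Omega>)"
    and rep: "represents T w g"
    and b: "0 < b" and van: "\<And>t. \<bar>t\<bar> < b \<Longrightarrow> AE x in lebesgue_on \<Omega>. g t x = 0"
    and t: "t \<in> {-T<..<T}"
  shows "AE x in lebesgue_on \<Omega>. g t x = 0"
proof (cases "\<bar>t\<bar> < b")
  case False
  then have bT: "b < T" using t by auto
  note g = representsD(1)[OF rep]
  \<comment> \<open>The map from \<open>b\<close> to T - 3/4 (T - b) shrinks the distance to
    \<open>T\<close> by the factor 3/4, so its iterates approach \<open>T\<close> and pass every
    \<bar>t\<bar> < T.\<close>
  define \<beta> where "\<beta> n = T - (3 / 4) ^ n * (T - b)" for n :: nat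
  have \<beta>: "0 < \<beta> n" "\<beta> n < T" "\<beta> (Suc n) = T - 3 / 4 * (T - \<beta> n)" for n
  proof -
    have "(3 / 4 :: real) ^ n * (T - b) \<le> 1 * (T - b)" using bT by (intro mult_right_mono power_le_one) auto
    then show "0 < \<beta> n" using b by (simp add: \<beta>_def)
    show "\<beta> n < T" using bT by (simp add: \<beta>_def)
    show "\<beta> (Suc n) = T - 3 / 4 * (T - \<beta> n)" by (simp add: \<beta>_def)
  qed
  have *: "AE x in lebesgue_on \<Omega>. g t x = 0" if "\<bar>t\<bar> < \<beta> n" for n t
    using that
  proof (induction n arbitrary: t)
    case 0
    then show ?case by (intro van) (simp add: \<beta>_def)
  next
    case (Suc n)
    interpret wave_kernel "\<lambda>t s. LINT x|lebesgue_on \<Omega>. g t x * g s x" T "\<beta> n"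
    proof
      show "0 < \<beta> n" "\<beta> n < T" by (rule \<beta>)+
      show "continuous_on ({-T<..<T} \<times> {-T<..<T}) (\<lambda>(t, s). LINT x|lebesgue_on \<Omega>. g t x * g s x)"
        by (rule L2_continuous_kernel[OF g])
      show "(LINT x|lebesgue_on \<Omega>. g t x * g s x) = 0" if "\<bar>s\<bar> < \<beta> n" for t s
        using LINT_mult_cong_AE[OF Suc.IH[OF that], of "g t"] by (simp add: mult.commute)
    qed (rule inner_kernel_symmetric[OF w rep])
    \<comment> \<open>On the diagonal the kernel is the squared L2 norm of
      \<open>g t\<close>.\<close>
    have "(LINT x|lebesgue_on \<Omega>. g t x * g t x) = 0"
      by (rule zero_diagonal) (use Suc.prems \<beta>(3) in simp)
    then have "norm_L2 \<Omega> (g t) = 0" by (simp add: norm_L2_def power2_eq_square)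
    moreover have "g t \<in> L2_space \<Omega>"
    proof -
      have "\<bar>t\<bar> < T" using Suc.prems \<beta>(2)[of "Suc n"] by linarith
      then have "t \<in> {-T<..<T}" by auto
      then show ?thesis using g by (simp add: L2_continuous_def)
    qed
    ultimately show ?case by (intro norm_L2_zero_imp_AE)
  qed
  have "0 < (T - \<bar>t\<bar>) / (T - b)" using t bT by (intro divide_pos_pos) auto
  then obtain n where "(3 / 4) ^ n < (T - \<bar>t\<bar>) / (T - b)"
    using real_arch_pow_inv[of "(T - \<bar>t\<bar>) / (T - b)" "3 / 4"] by auto
  then have "(3 / 4) ^ n * (T - b) < T - \<bar>t\<bar>" using bT by (simp add: pos_less_divide_eq)
  then have "\<bar>t\<bar> < \<beta> n" by (simp add: \<beta>_def)
  then show ?thesis by (rule *)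
qed (rule van)

text \<open>Near time 0 the two representatives agree, so their distributional time derivatives
  agree there; continuity of the pairings with \<gamma> and \<gamma>' makes the values at 0
  equal.\<close>

lemma initial_velocity_unique:
  assumes b: "0 < b" "b < T"
    and eq: "\<And>t. \<bar>t\<bar> < b \<Longrightarrow> AE x in lebesgue_on \<Omega>. g t x = g' t x"
    and v0: "v0 \<in> L2_space \<Omega>" and v0': "v0' \<in> L2_space \<Omega>"
    and vel: "velocity T v0 g \<gamma>" and vel': "velocity T v0' g' \<gamma>'"
  shows "AE x in lebesgue_on \<Omega>. v0 x = v0' x"
proof -
  \<comment> \<open>A closed window inside the open interval on which the two representatives
    agree.\<close>
  let ?I = "{-T<..<T}" and ?c = "b / 2"
  note \<gamma> = velocityD[OF vel] and \<gamma>' = velocityD[OF vel']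
  have sub: "{-?c..?c} \<subseteq> ?I" using b by auto
  have "(LINT x|lebesgue_on \<Omega>. v0 x * \<psi> x) = (LINT x|lebesgue_on \<Omega>. v0' x * \<psi> x)" if \<psi>: "\<psi> \<in> test_functions \<Omega>" for \<psi>
  proof -
    let ?d = "\<lambda>t. \<gamma> t \<psi> - \<gamma>' t \<psi>"
    note cs = continuous_on_subset[OF \<gamma>(1)[OF \<psi>] sub] continuous_on_subset[OF \<gamma>'(1)[OF \<psi>] sub]
    have "?d 0 = 0"
    proof (rule fundamental_lemma_time[where f = ?d and t = 0 and \<alpha>' = "-?c" and \<beta>' = "?c"])
      show "continuous_on {-?c..?c} ?d" by (intro continuous_on_diff cs)
      fix \<theta> :: "real \<Rightarrow> real" assume \<theta>: "smooth_on UNIV \<theta>" "\<And>t. t \<notin> {-?c..?c} \<Longrightarrow> \<theta> t = 0"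
      have test: "\<theta> \<in> test_functions ?I" by (rule time_test_function[OF \<theta> sub])
      have "(LINT t|lebesgue_on ?I. deriv \<theta> t * (LINT x|lebesgue_on \<Omega>. g t x * \<psi> x)) = (LINT t|lebesgue_on ?I. deriv \<theta> t * (LINT x|lebesgue_on \<Omega>. g' t x * \<psi> x))"
      proof (rule Bochner_Integration.integral_cong[OF refl])
        fix t
        show "deriv \<theta> t * (LINT x|lebesgue_on \<Omega>. g t x * \<psi> x) = deriv \<theta> t * (LINT x|lebesgue_on \<Omega>. g' t x * \<psi> x)"
        proof (cases "t \<in> {-?c..?c}")
          case True
          then have "\<bar>t\<bar> < b" using b by auto
          from LINT_mult_cong_AE[OF eq[OF this]] show ?thesis by simp
        next
          case False
          have "deriv \<theta> t = 0" by (rule deriv_zero_outside[OF \<theta>(2) False])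
          then show ?thesis by simp
        qed
      qed
      then have e: "(LINT t|lebesgue_on ?I. \<theta> t * \<gamma> t \<psi>) = (LINT t|lebesgue_on ?I. \<theta> t * \<gamma>' t \<psi>)"
        using \<gamma>(3)[OF \<psi> test] \<gamma>'(3)[OF \<psi> test] by simp
      have toI: "(LINT t|lebesgue_on ?I. \<theta> t * h t) = integral {-?c..?c} (\<lambda>t. \<theta> t * h t)" if h: "continuous_on {-?c..?c} h" for h
      proof (rule LINT_continuous_on_eq_integral[OF _ sub])
        show "continuous_on {-?c..?c} (\<lambda>t. \<theta> t * h t)"
          by (rule continuous_on_mult[OF smooth_on_continuous_on_UNIV[OF \<theta>(1)] h])
        show "\<theta> t * h t = 0" if "t \<notin> {-?c..?c}" for t using \<theta>(2)[OF that] by simp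
      qed simp
      have i: "(\<lambda>t. \<theta> t * h t) integrable_on {-?c..?c}" if h: "continuous_on {-?c..?c} h" for h
        by (rule integrable_continuous_real[OF continuous_on_mult[OF smooth_on_continuous_on_UNIV[OF \<theta>(1)] h]])
      show "integral {-?c..?c} (\<lambda>t. \<theta> t * ?d t) = 0"
        unfolding right_diff_distrib Henstock_Kurzweil_Integration.integral_diff[OF i[OF cs(1)] i[OF cs(2)]]
        using e toI[OF cs(1)] toI[OF cs(2)] by simp
    qed (use b in auto)
    then show ?thesis using \<gamma>(2)[OF \<psi>] \<gamma>'(2)[OF \<psi>] by simp
  qed
  note eqv = this
  have "AE x in lebesgue_on \<Omega>. v0 x - v0' x = 0"
  proof (rule fundamental_lemma[OF dom])
    show "integrable (lebesgue_on \<Omega>) (\<lambda>x. v0 x - v0' x)" by (rule L2_integrable[OF L2_diff[OF v0 v0']])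
    fix \<psi> assume \<psi>: "\<psi> \<in> test_functions \<Omega>"
    have "(LINT x|lebesgue_on \<Omega>. (v0 x - v0' x) * \<psi> x) = (LINT x|lebesgue_on \<Omega>. v0 x * \<psi> x) - (LINT x|lebesgue_on \<Omega>. v0' x * \<psi> x)"
      unfolding left_diff_distrib
      by (intro Bochner_Integration.integral_diff L2_mult_integrable v0 v0' test_L2[OF \<psi>])
    then show "(LINT x|lebesgue_on \<Omega>. (v0 x - v0' x) * \<psi> x) = 0" using eqv[OF \<psi>] by simp
  qed
  then show ?thesis by eventually_elim simp
qed

end

theorem mainTheorem3:
  fixes \<Omega> \<omega> :: "'a::euclidean_space set" and T :: real
  assumes "open \<Omega>" "bounded \<Omega>" "connected \<Omega>"
    and "continuous_boundary \<Omega>" "piecewise_smooth_boundary \<Omega>"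
    and "open \<omega>" "\<omega> \<subseteq> \<Omega>" "\<omega> \<noteq> {}"
    and "ereal T > T_max \<Omega> \<omega>"
  shows "(\<forall>w0\<in>H10_space \<Omega>. \<forall>v0\<in>L2_space \<Omega>. \<forall>w.
            wave_solution \<Omega> T w0 v0 w \<longrightarrow>
            (AE t in lebesgue_on {-T<..<T}. AE x in lebesgue_on \<omega>. w t x = 0) \<longrightarrow>
            (AE t in lebesgue_on {-T<..<T}. AE x in lebesgue_on \<Omega>. w t x = 0)) \<and>
         (\<forall>w0\<in>H10_space \<Omega>. \<forall>v0\<in>L2_space \<Omega>. \<forall>w0'\<in>H10_space \<Omega>. \<forall>v0'\<in>L2_space \<Omega>. \<forall>w w'.
            wave_solution \<Omega> T w0 v0 w \<longrightarrow>
            wave_solution \<Omega> T w0' v0' w' \<longrightarrow>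
            (AE t in lebesgue_on {-T<..<T}. AE x in lebesgue_on \<omega>. w t x = w' t x) \<longrightarrow>
            (AE x in lebesgue_on \<Omega>. w0 x = w0' x) \<and> (AE x in lebesgue_on \<Omega>. v0 x = v0' x))"
proof -
  interpret bounded_domain \<Omega> using assms(1,2) by unfold_locales
  let ?I = "{-T<..<T}"
  obtain P where "P \<in> \<Omega>" using assms(7,8) by blast
  then have T0: "T_max \<Omega> \<omega> \<ge> 0" by (rule T_max_nonneg)
  \<comment> \<open>A real number strictly between: every point is then reached by a path shorter
    than \<tau>, and a time window of half-width T - \<tau> > 0 about 0 remains.\<close>
  obtain \<tau> where \<tau>: "T_max \<Omega> \<omega> < ereal \<tau>" "ereal \<tau> < ereal T" using ereal_dense2[OF assms(9)] by blast
  have "0 < ereal \<tau>" using T0 \<tau>(1) by (rule le_less_trans)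
  then have b: "0 < \<tau>" "\<tau> < T" "0 < T" using \<tau>(2) by auto
  note iff = AE_lebesgue_on_subset_iff[OF assms(1,6,7)]
  show ?thesis
  proof (intro conjI ballI allI impI)
    fix w0 v0 w
    assume w0: "w0 \<in> H10_space \<Omega>" and sol: "wave_solution \<Omega> T w0 v0 w"
      and van: "AE t in lebesgue_on ?I. AE x in lebesgue_on \<omega>. w t x = 0"
    have w_bochner: "w \<in> bochner_L2 ?I (H10_space \<Omega>) (norm_H1 \<Omega>)" using sol by (simp add: wave_solution_def)
    obtain g where rep: "represents T w g"
      by (rule wave_solutionD[OF sol b(3) H10_L2[OF w0]]) blast
    note wg = representsD(2)[OF rep]
    interpret u: weak_wave \<Omega> T g by (rule represents_imp_weak_wave[OF rep])
    have "AE t in lebesgue_on ?I. AE x in lebesgue_on \<Omega>. x \<in> \<omega> \<longrightarrow> g t x = 0"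
      using van wg
    proof eventually_elim
      case (elim t)
      then have "AE x in lebesgue_on \<Omega>. x \<in> \<omega> \<longrightarrow> w t x = 0" "AE x in lebesgue_on \<Omega>. w t x = g t x"
        using iff by auto
      then show ?case by eventually_elim simp
    qed
    then have "AE x in lebesgue_on \<Omega>. x \<in> \<omega> \<longrightarrow> g t x = 0" if "t \<in> ?I" for t
      by (rule u.vanishes_at_all_times[OF assms(6,7) _ that])
    then have small: "AE x in lebesgue_on \<Omega>. g t x = 0" if "\<bar>t\<bar> < T - \<tau>" for t
      by (rule u.unique_continuation[OF assms(6) _ \<tau>(1)]) (use that in auto)
    have all: "AE x in lebesgue_on \<Omega>. g t x = 0" if "t \<in> ?I" for t
    proof (rule vanishes_extend[OF w_bochner rep, where b = "T - \<tau>"])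
      show "0 < T - \<tau>" using b by simp
      show "t \<in> ?I" by (rule that)
    qed (rule small)
    show "AE t in lebesgue_on ?I. AE x in lebesgue_on \<Omega>. w t x = 0"
      using wg AE_space[of "lebesgue_on ?I"]
    proof eventually_elim
      case (elim t)
      then have "AE x in lebesgue_on \<Omega>. w t x = g t x" "AE x in lebesgue_on \<Omega>. g t x = 0" using all by auto
      then show ?case by eventually_elim simp
    qed
  next
    fix w0 v0 w0' v0' w w'
    assume w0: "w0 \<in> H10_space \<Omega>" and v0: "v0 \<in> L2_space \<Omega>" and w0': "w0' \<in> H10_space \<Omega>" and v0': "v0' \<in> L2_space \<Omega>"
      and sol: "wave_solution \<Omega> T w0 v0 w" and sol': "wave_solution \<Omega> T w0' v0' w'"
      and eq: "AE t in lebesgue_on ?I. AE x in lebesgue_on \<omega>. w t x = w' t x"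
    obtain g \<gamma> where rep: "represents T w g" and g0: "AE x in lebesgue_on \<Omega>. g 0 x = w0 x" and vel: "velocity T v0 g \<gamma>"
      by (rule wave_solutionD[OF sol b(3) H10_L2[OF w0]])
    obtain g' \<gamma>' where rep': "represents T w' g'" and g0': "AE x in lebesgue_on \<Omega>. g' 0 x = w0' x" and vel': "velocity T v0' g' \<gamma>'"
      by (rule wave_solutionD[OF sol' b(3) H10_L2[OF w0']])
    \<comment> \<open>Agreement for \<bar>t\<bar> < T - \<tau> already determines the data, since
      they are read off at time 0: the position from \<open>g 0\<close>, the velocity from the limit
      behaviour of \<gamma>. The extension to all times is therefore not called here.\<close>
    interpret u: weak_wave \<Omega> T "\<lambda>t x. g t x - g' t x"
      by (rule weak_wave_diff[OF represents_imp_weak_wave[OF rep] represents_imp_weak_wave[OF rep']])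
    have "AE t in lebesgue_on ?I. AE x in lebesgue_on \<Omega>. x \<in> \<omega> \<longrightarrow> g t x - g' t x = 0"
      using eq representsD(2)[OF rep] representsD(2)[OF rep']
    proof eventually_elim
      case (elim t)
      then have "AE x in lebesgue_on \<Omega>. x \<in> \<omega> \<longrightarrow> w t x = w' t x" "AE x in lebesgue_on \<Omega>. w t x = g t x" "AE x in lebesgue_on \<Omega>. w' t x = g' t x"
        using iff by auto
      then show ?case by eventually_elim simp
    qed
    then have "AE x in lebesgue_on \<Omega>. x \<in> \<omega> \<longrightarrow> g t x - g' t x = 0" if "t \<in> ?I" for t
      by (rule u.vanishes_at_all_times[OF assms(6,7) _ that])
    then have z: "AE x in lebesgue_on \<Omega>. g t x - g' t x = 0" if "\<bar>t\<bar> < T - \<tau>" for t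
      by (rule u.unique_continuation[OF assms(6) _ \<tau>(1)]) (use that in auto)
    have eqg: "AE x in lebesgue_on \<Omega>. g t x = g' t x" if "\<bar>t\<bar> < T - \<tau>" for t
      using z[OF that] by eventually_elim simp
    have "AE x in lebesgue_on \<Omega>. g 0 x = g' 0 x" by (rule eqg) (use b in simp)
    then show "AE x in lebesgue_on \<Omega>. w0 x = w0' x" using g0 g0' by eventually_elim simp
    show "AE x in lebesgue_on \<Omega>. v0 x = v0' x"
      by (rule initial_velocity_unique[OF _ _ eqg v0 v0' vel vel']) (use b in auto)
  qed
qed

end
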